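(* Let $f\in C^2(\mathbb{R}^d)$ with $\inf f>-\infty$, let $\gamma:\mathbb{R}_+\to\mathbb{R}_+$ be continuous with $c\le\gamma(t)\le C$ for all $t\ge0$ ($0<c\le C$), and let $0<\beta<\frac{2c}{C^2}$. Consider $$\ddot x(t)+\gamma(t)\dot x(t)+\nabla f(x(t)+\beta\dot x(t))=0,\ t>0,\qquad x(0)=x_0,\ \dot x(0)=v_0. \tag{ISIHD}$$ Then: (i) there exists a global solution $x\in C^2(\mathbb{R}_+;\mathbb{R}^d)$ of (ISIHD); (ii) $\dot x\in L^2(\mathbb{R}_+;\mathbb{R}^d)$ and $\nabla f\circ(x+\beta\dot x)\in L^2(\mathbb{R}_+;\mathbb{R}^d)$; (iii) if $x$ is bounded on $\mathbb{R}_+$, then $\nabla f\circ x\in L^2(\mathbb{R}_+;\mathbb{R}^d)$, $\lim_{t\to\infty}\|\nabla f(x(t))\|=\lim_{t\to\infty}\|\dot x(t)\|=0$, and $\lim_{t\to\infty}f(x(t))$ exists; (iv) if in addition to (iii) $f$ is definable, then $\dot x\in L^1(\mathbb{R}_+;\mathbb{R}^d)$ and $x(t)$ converges as $t\to+\infty$ to a critical point of $f$.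
   Context: Definable: definable in an o-minimal structure over $\mathbb{R}$. Critical point: $u$ with $\nabla f(u)=0$. *)

theory Defs
  imports "HOL-Analysis.Analysis"
begin

definition grad :: "('a::real_inner \<Rightarrow> real) \<Rightarrow> 'a \<Rightarrow> 'a" where
  "grad f u = (THE g. GDERIV f u :> g)"

definition C2 :: "('a::real_inner \<Rightarrow> real) \<Rightarrow> bool" where
  "C2 f \<longleftrightarrow> (\<exists>H :: 'a \<Rightarrow> ('a \<Rightarrow>\<^sub>L 'a).
      continuous_on UNIV H \<and>
      (\<forall>u. GDERIV f u :> grad f u \<and> (grad f has_derivative blinfun_apply (H u)) (at u)))"

text \<open>A structure is a family S n of subsets of R^n, points of R^n being real lists of
  length n. Following van den Dries: each S n is a Boolean algebra of subsets of R^n,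
  closed under products with R, containing diagonals, closed under projection; it
  expands the ordered real field (contains the order, the graphs of + and *, and all
  singletons); and it is o-minimal: the sets in S 1 are finite unions of points and
  open intervals.\<close>

definition rlists :: "nat \<Rightarrow> real list set" where
  "rlists n = {xs. length xs = n}"

definition finite_union_points_intervals :: "real set \<Rightarrow> bool" where
  "finite_union_points_intervals A \<longleftrightarrow>
     (\<exists>P. finite P \<and> A = \<Union>P \<and>
        (\<forall>I\<in>P. (\<exists>a. I = {a}) \<or> (\<exists>a b :: ereal. I = {x. a < ereal x \<and> ereal x < b})))"

definition o_minimal_structure :: "(nat \<Rightarrow> real list set set) \<Rightarrow> bool" where
  "o_minimal_structure S \<longleftrightarrow>
     (\<forall>n. \<forall>A\<in>S n. A \<subseteq> rlists n) \<and>
     (\<forall>n. {} \<in> S n) \<and>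
     (\<forall>n. \<forall>A\<in>S n. rlists n - A \<in> S n) \<and>
     (\<forall>n. \<forall>A\<in>S n. \<forall>B\<in>S n. A \<union> B \<in> S n) \<and>
     (\<forall>n. \<forall>A\<in>S n. {xs @ [y] | xs y. xs \<in> A} \<in> S (Suc n)) \<and>
     (\<forall>n. \<forall>A\<in>S n. {y # xs | xs y. xs \<in> A} \<in> S (Suc n)) \<and>
     (\<forall>n i j. i < n \<longrightarrow> j < n \<longrightarrow> {xs \<in> rlists n. xs ! i = xs ! j} \<in> S n) \<and>
     (\<forall>n. \<forall>A\<in>S (Suc n). butlast ` A \<in> S n) \<and>
     (\<forall>c. {[c]} \<in> S 1) \<and>
     {[x, y] | x y. x < y} \<in> S 2 \<and>
     {[x, y, x + y] | x y. True} \<in> S 3 \<and>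
     {[x, y, x * y] | x y. True} \<in> S 3 \<and>
     (\<forall>A\<in>S 1. finite_union_points_intervals {x. [x] \<in> A})"

definition coords :: "(nat \<Rightarrow> 'd::finite) \<Rightarrow> real^'d \<Rightarrow> real list" where
  "coords e x = map (\<lambda>i. x $ e i) [0..<CARD('d)]"

text \<open>f : R^d \<rightarrow> R is definable in S if its graph is in S (d+1), for some ordering of the
  coordinates (definable sets are closed under coordinate permutations, so the choice is
  immaterial).\<close>
definition definable_fun :: "(nat \<Rightarrow> real list set set) \<Rightarrow> (real^'d::finite \<Rightarrow> real) \<Rightarrow> bool" where
  "definable_fun S f \<longleftrightarrow>
     (\<exists>e. bij_betw e {..<CARD('d)} (UNIV :: 'd set) \<and>
          {coords e x @ [f x] | x. True} \<in> S (Suc CARD('d)))"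

definition definable :: "(real^'d::finite \<Rightarrow> real) \<Rightarrow> bool" where
  "definable f \<longleftrightarrow> (\<exists>S. o_minimal_structure S \<and> definable_fun S f)"

definition isihd_sol ::
  "(real^'d::finite \<Rightarrow> real) \<Rightarrow> (real \<Rightarrow> real) \<Rightarrow> real \<Rightarrow> real^'d \<Rightarrow> real^'d
   \<Rightarrow> (real \<Rightarrow> real^'d) \<Rightarrow> (real \<Rightarrow> real^'d) \<Rightarrow> (real \<Rightarrow> real^'d) \<Rightarrow> bool" where
  "isihd_sol f \<gamma> \<beta> x0 v0 x v a \<longleftrightarrow>
     (\<forall>t\<ge>0. (x has_vector_derivative v t) (at t within {0..})) \<and>
     (\<forall>t\<ge>0. (v has_vector_derivative a t) (at t within {0..})) \<and>
     continuous_on {0..} a \<and>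
     (\<forall>t>0. a t + \<gamma> t *\<^sub>R v t + grad f (x t + \<beta> *\<^sub>R v t) = 0) \<and>
     x 0 = x0 \<and> v 0 = v0"

end

theory Submission
  imports Defs
begin

text \<open>
  With \<open>y = x + \<beta> x'\<close>, the energy \<open>E = f y + |x'|^2 / 2\<close> satisfies
  \<open>E' \<le> - \<delta> (|x'|^2 + |\<nabla>f y|^2)\<close>; the mixed term is absorbed because \<open>\<beta> C < 2\<close>. This bounds
  the velocity, hence gives global existence for a truncated, globally Lipschitz system that has the same
  solution, and the square integrability statements. For bounded \<open>x\<close> the velocity and the gradient are
  Lipschitz in time, so Barbalat's argument makes them vanish at infinity.

  For definable \<open>f\<close> we use Kurdyka's inequality in a derivative-free form. On each level set (inside a
  cube) of a definable \<open>C^1\<close> function \<open>F\<close>, pick the lexicographically least among the points minimizing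
  \<open>|\<nabla>F|\<close>. The resulting curve \<open>r \<mapsto> \<xi> r\<close> with \<open>F (\<xi> r) = l + r\<close> is definable, so by o-minimality its
  coordinates are continuous and monotone near \<open>0\<close>. Hence \<open>\<psi> r\<close>, the sum of these coordinates with suitable
  signs, is monotone and bounded, and \<open>|s - r| = |F (\<xi> s) - F (\<xi> r)|\<close> is at most about
  \<open>|\<nabla>F (\<xi> r)| |\<psi> s - \<psi> r|\<close>, where \<open>|\<nabla>F (\<xi> r)| \<le> |\<nabla>F z|\<close> for every other \<open>z\<close> on the same level.
  Neither differentiability of \<open>\<psi>\<close> nor a Sard theorem is needed. Applied to
  \<open>F = f y + |v|^2 / 2\<close>, this bounds the length of the trajectory.
\<close>

section \<open>Definability in an o-minimal structure\<close>

text \<open>Kurdyka's inequality is applied to the energy, since \<open>f\<close> need not decrease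
  along the trajectory. Writing \<open>F\<close> for the energy as a function of \<open>y\<close>
  and the speed, \<open>|\<nabla>F|^2\<close> is \<open>|v|^2 + |\<nabla>f y|^2\<close>, so the
  energy decays at rate at least \<open>\<delta> |\<nabla>F|^2\<close>. Dividing by a multiple of
  \<open>|\<nabla>F|\<close> leaves a multiple of \<open>|\<nabla>F|\<close>, which dominates the
  speed. The division is carried out on difference quotients, and a Dini-type criterion takes the
  place of the chain rule for \<open>\<psi>\<close>. From o-minimality in one variable the proof
  extracts a dichotomy: on either side of a point, a definable predicate is eventually true or
  eventually false. That a relation holds on the germ of a function at \<open>r\<close> is again a
  definable predicate of \<open>r\<close>, so the dichotomy can be iterated; the bad cases would
  give an uncountable set of strict local extrema or of jumps. Lexicographic minimization serves as
  definable choice because it is expressible with quantifiers; the cube supplies the compactness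
  that makes the minima exist.\<close>

text \<open>Formulas are modelled semantically, as predicates on assignments \<open>\<rho> :: nat \<Rightarrow> real\<close>.
  In \<open>def_pred n P\<close> the free variables are \<open>\<rho> 0, \<dots>, \<rho> (n - 1)\<close>; a quantifier introduces the variable \<open>\<rho> n\<close>.\<close>

definition supported :: "nat \<Rightarrow> ((nat \<Rightarrow> real) \<Rightarrow> 'b) \<Rightarrow> bool" where
  "supported n t \<longleftrightarrow> (\<forall>\<rho> \<sigma>. (\<forall>i<n. \<rho> i = \<sigma> i) \<longrightarrow> t \<rho> = t \<sigma>)"

lemma supportedD: "supported n t \<Longrightarrow> (\<And>i. i < n \<Longrightarrow> \<rho> i = \<sigma> i) \<Longrightarrow> t \<rho> = t \<sigma>"
  by (auto simp: supported_def)

lemma supported_mono: "supported n t \<Longrightarrow> n \<le> m \<Longrightarrow> supported m t"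
  unfolding supported_def by (metis order_less_le_trans)

lemma supported_const: "supported n (\<lambda>\<rho>. c)"
  by (simp add: supported_def)

lemma supported_var: "i < n \<Longrightarrow> supported n (\<lambda>\<rho>. \<rho> i)"
  by (simp add: supported_def)

lemma supported_comp: "supported n s \<Longrightarrow> supported n (\<lambda>\<rho>. h (s \<rho>))"
  by (auto simp: supported_def intro!: arg_cong[where f = h])

lemma supported_comp2: "supported n s \<Longrightarrow> supported n t \<Longrightarrow> supported n (\<lambda>\<rho>. h (s \<rho>) (t \<rho>))"
  by (auto simp: supported_def intro!: arg_cong2[where f = h])

lemma supported_fun: "(\<And>y. supported n (\<lambda>\<rho>. P \<rho> y)) \<Longrightarrow> supported n P"
  by (auto simp: supported_def)

lemma supported_ex: "(\<And>y. supported n (\<lambda>\<rho>. P \<rho> y)) \<Longrightarrow> supported n (\<lambda>\<rho>. \<exists>y. P \<rho> y)"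
  by (rule supported_comp[OF supported_fun, where h = Ex])

lemma supported_all: "(\<And>y. supported n (\<lambda>\<rho>. P \<rho> y)) \<Longrightarrow> supported n (\<lambda>\<rho>. \<forall>y. P \<rho> y)"
  by (rule supported_comp[OF supported_fun, where h = All])

lemma supported_vec: "(\<And>j. supported n (\<lambda>\<rho>. t j \<rho>)) \<Longrightarrow> supported n (\<lambda>\<rho>. \<chi> j. t j \<rho>)"
  by (rule supported_comp[OF supported_fun, where h = vec_lambda])

lemmas supported_intros = supported_const supported_var supported_ex supported_all supported_vec
  supported_comp[where h = Not] supported_comp2[where h = conj] supported_comp2[where h = disj]
  supported_comp2[where h = implies] supported_comp2[where h = "less :: real \<Rightarrow> _"]
  supported_comp2[where h = "less_eq :: real \<Rightarrow> _"]
  supported_comp2[where h = "(=) :: real \<Rightarrow> _"] supported_comp2[where h = "plus :: real \<Rightarrow> _"]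
  supported_comp2[where h = "times :: real \<Rightarrow> _"] supported_comp2[where h = "minus :: real \<Rightarrow> _"]
  supported_comp[where h = "abs :: real \<Rightarrow> _"]

locale o_minimal =
  fixes S :: "nat \<Rightarrow> real list set set"
  assumes o_minimal: "o_minimal_structure S"
begin

lemma S_subset: "A \<in> S n \<Longrightarrow> A \<subseteq> rlists n"
  and S_empty: "{} \<in> S n"
  and S_compl: "A \<in> S n \<Longrightarrow> rlists n - A \<in> S n"
  and S_Un: "A \<in> S n \<Longrightarrow> B \<in> S n \<Longrightarrow> A \<union> B \<in> S n"
  and S_Cons: "A \<in> S n \<Longrightarrow> {y # xs | xs y. xs \<in> A} \<in> S (Suc n)"
  and S_diag: "i < n \<Longrightarrow> j < n \<Longrightarrow> {xs \<in> rlists n. xs ! i = xs ! j} \<in> S n"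
  and S_butlast: "A \<in> S (Suc n) \<Longrightarrow> butlast ` A \<in> S n"
  and S_single: "{[c]} \<in> S 1"
  and S_less: "{[x, y] | x y. x < y} \<in> S 2"
  and S_add: "{[x, y, x + y] | x y. True} \<in> S 3"
  and S_mult: "{[x, y, x * y] | x y. True} \<in> S 3"
  and S_tame: "A \<in> S 1 \<Longrightarrow> finite_union_points_intervals {x. [x] \<in> A}"
proof -
  note ax = o_minimal[unfolded o_minimal_structure_def]
  show "A \<in> S n \<Longrightarrow> A \<subseteq> rlists n" using ax by (elim conjE) meson
  show "{} \<in> S n" using ax by (elim conjE) meson
  show "A \<in> S n \<Longrightarrow> rlists n - A \<in> S n" using ax by (elim conjE) meson
  show "A \<in> S n \<Longrightarrow> B \<in> S n \<Longrightarrow> A \<union> B \<in> S n" using ax by (elim conjE) meson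
  have "\<forall>n. \<forall>A\<in>S n. {y # xs | xs y. xs \<in> A} \<in> S (Suc n)" using ax by (elim conjE) assumption
  then show "A \<in> S n \<Longrightarrow> {y # xs | xs y. xs \<in> A} \<in> S (Suc n)" by simp
  show "i < n \<Longrightarrow> j < n \<Longrightarrow> {xs \<in> rlists n. xs ! i = xs ! j} \<in> S n" using ax by (elim conjE) meson
  show "A \<in> S (Suc n) \<Longrightarrow> butlast ` A \<in> S n" using ax by (elim conjE) meson
  show "{[c]} \<in> S 1" using ax by (elim conjE) meson
  show "A \<in> S 1 \<Longrightarrow> finite_union_points_intervals {x. [x] \<in> A}" using ax by (elim conjE) meson
  show "{[x, y] | x y. x < y} \<in> S 2" using ax by (elim conjE) assumption
  show "{[x, y, x + y] | x y. True} \<in> S 3" using ax by (elim conjE) assumption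
  show "{[x, y, x * y] | x y. True} \<in> S 3" using ax by (elim conjE) assumption
qed

section \<open>Products, projections and coordinate substitution in the structure\<close>

lemma S_Int: assumes "A \<in> S n" "B \<in> S n" shows "A \<inter> B \<in> S n"
proof -
  have "A \<inter> B = rlists n - ((rlists n - A) \<union> (rlists n - B))"
    using S_subset[OF assms(1)] by blast
  then show ?thesis using assms by (simp add: S_compl S_Un)
qed

lemma S_INT: fixes k :: nat shows "A \<in> S n \<Longrightarrow> (\<And>j. j < k \<Longrightarrow> B j \<in> S n) \<Longrightarrow> A \<inter> {xs. \<forall>j<k. xs \<in> B j} \<in> S n"
proof (induction k)
  case (Suc k)
  have "A \<inter> {xs. \<forall>j<Suc k. xs \<in> B j} = (A \<inter> {xs. \<forall>j<k. xs \<in> B j}) \<inter> B k"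
    by (auto simp: less_Suc_eq)
  with Suc show ?case by (simp add: S_Int)
qed simp

lemma S_prepend: "A \<in> S k \<Longrightarrow> {xs @ ys | xs ys. length xs = n \<and> ys \<in> A} \<in> S (n + k)"
proof (induction n)
  case (Suc n)
  have "{xs @ ys | xs ys. length xs = Suc n \<and> ys \<in> A} =
      {y # zs | zs y. zs \<in> {xs @ ys | xs ys. length xs = n \<and> ys \<in> A}}"
    (is "?L = ?R")
  proof
    show "?L \<subseteq> ?R"
    proof
      fix zs assume "zs \<in> ?L"
      then obtain xs ys where "zs = xs @ ys" "length xs = Suc n" "ys \<in> A" by blast
      then show "zs \<in> ?R" by (cases xs) auto
    qed
    show "?R \<subseteq> ?L"
    proof
      fix zs assume "zs \<in> ?R"
      then obtain y xs ys where "zs = (y # xs) @ ys" "length xs = n" "ys \<in> A" by auto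
      then show "zs \<in> ?L" by (intro CollectI exI[of _ "y # xs"] exI[of _ ys]) simp
    qed
  qed
  with S_Cons[OF Suc.IH[OF Suc.prems]] show ?case by simp
qed simp

lemma S_take: "A \<in> S (n + k) \<Longrightarrow> take n ` A \<in> S n"
proof (induction k arbitrary: A)
  case 0
  have "take n ` A = (\<lambda>x. x) ` A"
    using S_subset[OF 0] by (intro image_cong) (auto simp: rlists_def)
  with 0 show ?case by simp
next
  case (Suc k)
  have "take n ` A = take n ` butlast ` A"
    using S_subset[OF Suc.prems] unfolding image_image
    by (intro image_cong) (auto simp: rlists_def butlast_conv_take subset_iff min_def)
  with Suc.IH[OF S_butlast] Suc.prems show ?case by simp
qed

text \<open>The set is the projection of the product of R^n with \<open>A\<close>, cut down by the
  diagonals that identify the appended entry \<open>n + j\<close> with entry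
  \<open>\<sigma> j\<close>. As \<open>\<sigma>\<close> may be any map into the first
  \<open>n\<close> indices, this covers permuting, repeating and adding variables at once.\<close>

lemma S_reindex:
  assumes A: "A \<in> S k" and \<sigma>: "\<And>j. j < k \<Longrightarrow> \<sigma> j < n"
  shows "{xs \<in> rlists n. map (\<lambda>j. xs ! \<sigma> j) [0..<k] \<in> A} \<in> S n"
proof -
  let ?B = "{xs @ ys | xs ys. length xs = n \<and> ys \<in> A}"
  let ?D = "\<lambda>j. {zs \<in> rlists (n + k). zs ! \<sigma> j = zs ! (n + j)}"
  have "?B \<inter> {zs. \<forall>j<k. zs \<in> ?D j} \<in> S (n + k)"
    using \<sigma> by (intro S_INT S_prepend A S_diag) (auto simp: trans_less_add1)
  then have "take n ` (?B \<inter> {zs. \<forall>j<k. zs \<in> ?D j}) \<in> S n" by (rule S_take)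
  also have "take n ` (?B \<inter> {zs. \<forall>j<k. zs \<in> ?D j}) =
      {xs \<in> rlists n. map (\<lambda>j. xs ! \<sigma> j) [0..<k] \<in> A}" (is "?L = ?R")
  proof
    have *: "map (\<lambda>j. xs ! \<sigma> j) [0..<k] = ys"
      if "length xs = n" "ys \<in> A" "\<forall>j<k. xs @ ys \<in> ?D j" for xs ys
    proof (rule nth_equalityI)
      have ly: "length ys = k" using that(2) S_subset[OF A] by (auto simp: rlists_def)
      then show "length (map (\<lambda>j. xs ! \<sigma> j) [0..<k]) = length ys" by simp
      fix i assume "i < length (map (\<lambda>j. xs ! \<sigma> j) [0..<k])"
      with that \<sigma>[of i] ly show "map (\<lambda>j. xs ! \<sigma> j) [0..<k] ! i = ys ! i"
        by (auto simp: nth_append)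
    qed
    show "?L \<subseteq> ?R" using * by (auto simp: rlists_def)
    show "?R \<subseteq> ?L"
    proof
      fix xs assume "xs \<in> ?R"
      then have xs: "length xs = n" "map (\<lambda>j. xs ! \<sigma> j) [0..<k] \<in> A" by (auto simp: rlists_def)
      let ?z = "xs @ map (\<lambda>j. xs ! \<sigma> j) [0..<k]"
      have "?z \<in> ?B \<inter> {zs. \<forall>j<k. zs \<in> ?D j}"
        using xs \<sigma> by (auto simp: rlists_def nth_append)
      moreover have "xs = take n ?z" using xs by simp
      ultimately show "xs \<in> ?L" by blast
    qed
  qed
  finally show ?thesis .
qed

text \<open>\<open>(!) xs\<close> is unspecified beyond the length of \<open>xs\<close>; the
  conjunct \<open>supported n\<close> keeps \<open>P\<close> from looking there.\<close>

definition def_pred :: "nat \<Rightarrow> ((nat \<Rightarrow> real) \<Rightarrow> bool) \<Rightarrow> bool" where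
  "def_pred n P \<longleftrightarrow> supported n P \<and> {xs \<in> rlists n. P ((!) xs)} \<in> S n"

definition def_term :: "nat \<Rightarrow> ((nat \<Rightarrow> real) \<Rightarrow> real) \<Rightarrow> bool" where
  "def_term n t \<longleftrightarrow> supported n t \<and> def_pred (Suc n) (\<lambda>\<rho>. \<rho> n = t \<rho>)"

lemma def_pred_supported: "def_pred n P \<Longrightarrow> supported n P"
  by (simp add: def_pred_def)

lemma def_term_supported: "def_term n P \<Longrightarrow> supported n P"
  by (simp add: def_term_def)

lemma def_pred_not: assumes "def_pred n P" shows "def_pred n (\<lambda>\<rho>. \<not> P \<rho>)"
proof -
  have "{xs \<in> rlists n. \<not> P ((!) xs)} = rlists n - {xs \<in> rlists n. P ((!) xs)}" by blast
  with assms S_compl show ?thesis by (simp add: def_pred_def supported_def) 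
qed

lemma def_pred_conj: assumes "def_pred n P" "def_pred n Q" shows "def_pred n (\<lambda>\<rho>. P \<rho> \<and> Q \<rho>)"
proof -
  have "{xs \<in> rlists n. P ((!) xs) \<and> Q ((!) xs)} =
      {xs \<in> rlists n. P ((!) xs)} \<inter> {xs \<in> rlists n. Q ((!) xs)}" by blast
  with assms S_Int show ?thesis by (simp add: def_pred_def supported_comp2)
qed

lemma def_pred_disj: assumes "def_pred n P" "def_pred n Q" shows "def_pred n (\<lambda>\<rho>. P \<rho> \<or> Q \<rho>)"
  using def_pred_not[OF def_pred_conj[OF def_pred_not def_pred_not, OF assms]] by simp

lemma def_pred_imp: assumes "def_pred n P" "def_pred n Q" shows "def_pred n (\<lambda>\<rho>. P \<rho> \<longrightarrow> Q \<rho>)"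
  using def_pred_disj[OF def_pred_not, OF assms] by (simp only: imp_conv_disj)

lemma def_pred_reindex:
  assumes P: "def_pred k P" and \<sigma>: "\<And>j. j < k \<Longrightarrow> \<sigma> j < n"
  shows "def_pred n (\<lambda>\<rho>. P (\<lambda>j. \<rho> (\<sigma> j)))"
proof -
  let ?A = "{xs \<in> rlists k. P ((!) xs)}"
  have "{xs \<in> rlists n. map (\<lambda>j. xs ! \<sigma> j) [0..<k] \<in> ?A} = {xs \<in> rlists n. P (\<lambda>j. xs ! \<sigma> j)}"
  proof -
    have "P ((!) (map (\<lambda>j. xs ! \<sigma> j) [0..<k])) = P (\<lambda>j. xs ! \<sigma> j)" for xs :: "real list"
      by (rule supportedD[OF def_pred_supported[OF P]]) simp
    then show ?thesis by (simp add: rlists_def)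
  qed
  moreover have "supported n (\<lambda>\<rho>. P (\<lambda>j. \<rho> (\<sigma> j)))"
  proof (unfold supported_def, intro allI impI)
    fix \<rho> \<tau> :: "nat \<Rightarrow> real" assume "\<forall>i<n. \<rho> i = \<tau> i"
    with \<sigma> show "P (\<lambda>j. \<rho> (\<sigma> j)) = P (\<lambda>j. \<tau> (\<sigma> j))"
      by (intro supportedD[OF def_pred_supported[OF P]]) auto
  qed
  moreover have "{xs \<in> rlists n. map (\<lambda>j. xs ! \<sigma> j) [0..<k] \<in> ?A} \<in> S n"
    using P \<sigma> by (intro S_reindex) (auto simp: def_pred_def)
  ultimately show ?thesis by (simp add: def_pred_def)
qed

text \<open>A quantifier is a projection along the last coordinate. The bound value is a separate
  argument of \<open>P\<close>, so that \<open>s\<close> can express that \<open>P\<close> depends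
  on variable \<open>n\<close> through this argument alone.\<close>

lemma def_pred_ex:
  assumes P: "def_pred (Suc n) (\<lambda>\<rho>. P \<rho> (\<rho> n))" and s: "\<And>y. supported n (\<lambda>\<rho>. P \<rho> y)"
  shows "def_pred n (\<lambda>\<rho>. \<exists>y. P \<rho> y)"
proof -
  let ?A = "{xs \<in> rlists (Suc n). P ((!) xs) (xs ! n)}"
  have "butlast ` ?A = {xs \<in> rlists n. \<exists>y. P ((!) xs) y}" (is "?L = ?R")
  proof
    show "?L \<subseteq> ?R"
    proof
      fix zs assume "zs \<in> ?L"
      then obtain xs where xs: "length xs = Suc n" "P ((!) xs) (xs ! n)" "zs = butlast xs"
        by (auto simp: rlists_def)
      have "P ((!) zs) (xs ! n) = P ((!) xs) (xs ! n)"
        using xs by (intro supportedD[OF s]) (auto simp: nth_butlast)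
      with xs show "zs \<in> ?R" by (auto simp: rlists_def)
    qed
    show "?R \<subseteq> ?L"
    proof
      fix zs assume "zs \<in> ?R"
      then obtain y where y: "length zs = n" "P ((!) zs) y" by (auto simp: rlists_def)
      have "P ((!) zs) y = P ((!) (zs @ [y])) y"
        using y by (intro supportedD[OF s]) (auto simp: nth_append)
      then have "zs @ [y] \<in> ?A" using y by (auto simp: rlists_def nth_append)
      then show "zs \<in> ?L" by force
    qed
  qed
  moreover have "butlast ` ?A \<in> S n" using P by (intro S_butlast) (simp add: def_pred_def)
  ultimately show ?thesis using s by (simp add: def_pred_def supported_ex)
qed

lemma def_pred_all:
  assumes P: "def_pred (Suc n) (\<lambda>\<rho>. P \<rho> (\<rho> n))" and s: "\<And>y. supported n (\<lambda>\<rho>. P \<rho> y)"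
  shows "def_pred n (\<lambda>\<rho>. \<forall>y. P \<rho> y)"
  using def_pred_not[OF def_pred_ex[where P = "\<lambda>\<rho> y. \<not> P \<rho> y", OF def_pred_not[OF P]
      supported_comp[OF s]]] by simp

lemma def_pred_const: "def_pred n (\<lambda>\<rho>. b)"
proof -
  have "rlists n \<in> S n" using S_compl[OF S_empty, of n] by simp
  then show ?thesis by (cases b) (simp_all add: def_pred_def supported_const S_empty)
qed

lemma def_pred_eq_var: "i < n \<Longrightarrow> j < n \<Longrightarrow> def_pred n (\<lambda>\<rho>. \<rho> i = \<rho> j)"
  using S_diag by (auto simp: def_pred_def intro!: supported_intros)

lemma def_term_var: "i < n \<Longrightarrow> def_term n (\<lambda>\<rho>. \<rho> i)"
  by (auto simp: def_term_def intro!: supported_var def_pred_eq_var)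

text \<open>Weakening has to move the value of the term, in its graph, from variable
  \<open>k\<close> to variable \<open>n\<close>; this is what \<open>?\<sigma>\<close> does.\<close>

lemma def_term_mono:
  assumes t: "def_term k t" and kn: "k \<le> n" shows "def_term n t"
proof -
  let ?\<sigma> = "\<lambda>j. if j < k then j else n"
  have "def_pred (Suc n) (\<lambda>\<rho>. \<rho> (?\<sigma> k) = t (\<lambda>j. \<rho> (?\<sigma> j)))"
    using t kn by (intro def_pred_reindex[where k = "Suc k" and P = "\<lambda>\<rho>. \<rho> k = t \<rho>" and \<sigma> = ?\<sigma>])
      (auto simp: def_term_def)
  moreover have "(\<lambda>\<rho>. \<rho> (?\<sigma> k) = t (\<lambda>j. \<rho> (?\<sigma> j))) = (\<lambda>\<rho>. \<rho> n = t \<rho>)"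
  proof
    fix \<rho>
    have "t (\<lambda>j. \<rho> (?\<sigma> j)) = t \<rho>" by (rule supportedD[OF def_term_supported[OF t]]) simp
    then show "(\<rho> (?\<sigma> k) = t (\<lambda>j. \<rho> (?\<sigma> j))) = (\<rho> n = t \<rho>)" by simp
  qed
  ultimately show ?thesis unfolding def_term_def using supported_mono[OF def_term_supported[OF t] kn] by argo
qed

lemma def_pred_let:
  assumes t: "def_term n t" and P: "def_pred (Suc n) (\<lambda>\<rho>. P \<rho> (\<rho> n))" and s: "\<And>y. supported n (\<lambda>\<rho>. P \<rho> y)"
  shows "def_pred n (\<lambda>\<rho>. P \<rho> (t \<rho>))"
proof -
  have "def_pred n (\<lambda>\<rho>. \<exists>y. y = t \<rho> \<and> P \<rho> y)"
    using t P s by (intro def_pred_ex def_pred_conj supported_intros def_term_supported) (auto simp: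
        def_term_def)
  then show ?thesis by simp
qed

text \<open>Coordinate substitution inserts only variables into \<open>A\<close>. Terms enter one
  position at a time, each through a fresh variable that \<open>def_pred_let\<close> then replaces
  by the term.\<close>

lemma def_pred_relation:
  assumes A: "A \<in> S k" and t: "\<And>i. i < k \<Longrightarrow> def_term n (t i)"
  shows "def_pred n (\<lambda>\<rho>. map (\<lambda>i. t i \<rho>) [0..<k] \<in> A)"
proof -
  \<comment> \<open>Positions from \<open>m\<close> on already hold variables. The induction step
    puts the fresh variable \<open>n\<close> at position \<open>m\<close>, which raises the number
    of variables; hence \<open>n\<close> and \<open>t\<close> are arbitrary.\<close>
  have "def_pred n (\<lambda>\<rho>. map (\<lambda>i. t i \<rho>) [0..<k] \<in> A)"
    if "\<And>i. i < k \<Longrightarrow> def_term n (t i)" "\<And>i. m \<le> i \<Longrightarrow> i < k \<Longrightarrow> \<exists>a<n. t i = (\<lambda>\<rho>. \<rho> a)" for m n t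
    using that
  proof (induction m arbitrary: n t)
    case 0
    then obtain \<sigma> where \<sigma>: "\<And>i. i < k \<Longrightarrow> \<sigma> i < n \<and> t i = (\<lambda>\<rho>. \<rho> (\<sigma> i))" by (metis zero_le)
    then have *: "map (\<lambda>i. t i \<rho>) [0..<k] = map (\<lambda>i. \<rho> (\<sigma> i)) [0..<k]" for \<rho> by simp
    have "{xs \<in> rlists n. map (\<lambda>j. xs ! \<sigma> j) [0..<k] \<in> A} \<in> S n"
      using \<sigma> by (intro S_reindex A) auto
    moreover have "supported n (\<lambda>\<rho>. map (\<lambda>i. \<rho> (\<sigma> i)) [0..<k] \<in> A)"
      using \<sigma> by (intro supported_comp[where h = "\<lambda>xs. xs \<in> A"]) (auto simp: supported_def)
    ultimately show ?case unfolding * by (simp add: def_pred_def)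
  next
    case (Suc m)
    show ?case
    proof (cases "m < k")
      case False
      with Suc show ?thesis by (intro Suc.IH) auto
    next
      case True
      let ?P = "\<lambda>\<rho> y. map (\<lambda>i. if i = m then y else t i \<rho>) [0..<k] \<in> A"
      have "def_pred (Suc n) (\<lambda>\<rho>. map (\<lambda>i. (\<lambda>i \<rho>. if i = m then \<rho> n else t i \<rho>) i \<rho>) [0..<k] \<in> A)"
      proof (rule Suc.IH)
        fix i assume i: "i < k"
        show "def_term (Suc n) (\<lambda>\<rho>. if i = m then \<rho> n else t i \<rho>)"
          using Suc.prems(1)[OF i] by (cases "i = m") (auto intro: def_term_var def_term_mono)
        assume "m \<le> i"
        then show "\<exists>a<Suc n. (\<lambda>\<rho>. if i = m then \<rho> n else t i \<rho>) = (\<lambda>\<rho>. \<rho> a)"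
          using Suc.prems(2)[of i] i by (cases "i = m") (auto simp: less_Suc_eq)
      qed
      then have D: "def_pred (Suc n) (\<lambda>\<rho>. ?P \<rho> (\<rho> n))" by simp
      have "def_pred n (\<lambda>\<rho>. ?P \<rho> (t m \<rho>))"
      proof (rule def_pred_let[where P = ?P, OF _ D])
        show "def_term n (t m)" using Suc.prems(1) True by blast
        fix y
        have "map (\<lambda>i. if i = m then y else t i \<rho>) [0..<k] = map (\<lambda>i. if i = m then y else t i \<sigma>) [0..<k]"
          if "\<forall>i<n. \<rho> i = \<sigma> i" for \<rho> \<sigma>
        proof (rule map_cong[OF refl])
          fix i assume "i \<in> set [0..<k]"
          then have "t i \<rho> = t i \<sigma>" using that by (intro supportedD[OF def_term_supported[OF
              Suc.prems(1)[of i]]]) auto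
          then show "(if i = m then y else t i \<rho>) = (if i = m then y else t i \<sigma>)" by simp
        qed
        then show "supported n (\<lambda>\<rho>. ?P \<rho> y)" unfolding supported_def by (metis (no_types, lifting))
      qed
      moreover have "(\<lambda>i. if i = m then t m \<rho> else t i \<rho>) = (\<lambda>i. t i \<rho>)" for \<rho> by auto
      ultimately show ?thesis by simp
    qed
  qed
  from this[of n t k] t show ?thesis by auto
qed

section \<open>Order and field operations\<close>

lemma def_pred_less: assumes "def_term n s" "def_term n t" shows "def_pred n (\<lambda>\<rho>. s \<rho> < t \<rho>)"
proof -
  have "def_pred n (\<lambda>\<rho>. map (\<lambda>i. ([s, t] ! i) \<rho>) [0..<2] \<in> {[x, y] | x y. x < y})"
    using assms by (intro def_pred_relation S_less) (auto simp: less_2_cases_iff)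
  then show ?thesis by (simp add: upt_rec)
qed

lemma def_pred_le: "def_term n s \<Longrightarrow> def_term n t \<Longrightarrow> def_pred n (\<lambda>\<rho>. s \<rho> \<le> t \<rho>)"
  using def_pred_not[OF def_pred_less, of n t s] by (simp add: not_less)

lemma def_pred_eq: "def_term n s \<Longrightarrow> def_term n t \<Longrightarrow> def_pred n (\<lambda>\<rho>. s \<rho> = t \<rho>)"
  using def_pred_conj[OF def_pred_le def_pred_le, of n s t t s] by (simp add: order_eq_iff)

lemma def_term_add: assumes "def_term n s" "def_term n t" shows "def_term n (\<lambda>\<rho>. s \<rho> + t \<rho>)"
proof -
  have "def_pred (Suc n) (\<lambda>\<rho>. map (\<lambda>i. ([s, t, \<lambda>\<rho>. \<rho> n] ! i) \<rho>) [0..<3] \<in> {[x, y, x + y] | x y. True})"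
    using assms by (intro def_pred_relation S_add)
      (auto simp: less_Suc_eq numeral_3_eq_3 intro: def_term_mono def_term_var)
  with assms show ?thesis by (auto simp: upt_rec def_term_def intro: supported_intros)
qed

lemma def_term_mult: assumes "def_term n s" "def_term n t" shows "def_term n (\<lambda>\<rho>. s \<rho> * t \<rho>)"
proof -
  have "def_pred (Suc n) (\<lambda>\<rho>. map (\<lambda>i. ([s, t, \<lambda>\<rho>. \<rho> n] ! i) \<rho>) [0..<3] \<in> {[x, y, x * y] | x y. True})"
    using assms by (intro def_pred_relation S_mult)
      (auto simp: less_Suc_eq numeral_3_eq_3 intro: def_term_mono def_term_var)
  with assms show ?thesis by (auto simp: upt_rec def_term_def intro: supported_intros)
qed

lemma def_term_const: "def_term n (\<lambda>\<rho>. c)"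
proof -
  have "def_pred (Suc n) (\<lambda>\<rho>. map (\<lambda>i. (\<lambda>\<rho>. \<rho> n) \<rho>) [0..<1] \<in> {[c]})"
    by (intro def_pred_relation S_single def_term_var) auto
  then show ?thesis by (auto simp: def_term_def supported_const)
qed

lemma def_term_diff: assumes "def_term n s" "def_term n t" shows "def_term n (\<lambda>\<rho>. s \<rho> - t \<rho>)"
  using def_term_add[OF assms(1) def_term_mult[OF def_term_const[of n "-1"] assms(2)]] by simp

lemma def_term_abs: assumes "def_term n t" shows "def_term n (\<lambda>\<rho>. \<bar>t \<rho>\<bar>)"
proof -
  have "def_pred (Suc n) (\<lambda>\<rho>. (0 \<le> t \<rho> \<and> \<rho> n = t \<rho>) \<or> (t \<rho> < 0 \<and> \<rho> n = 0 - t \<rho>))"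
    using assms by (intro def_pred_disj def_pred_conj def_pred_le def_pred_less def_pred_eq
        def_term_diff def_term_const def_term_var)
      (auto intro: def_term_mono)
  moreover have "((0 \<le> t \<rho> \<and> \<rho> n = t \<rho>) \<or> (t \<rho> < 0 \<and> \<rho> n = 0 - t \<rho>)) = (\<rho> n = \<bar>t \<rho>\<bar>)" for \<rho>
    by auto
  ultimately show ?thesis using assms by (simp add: def_term_def supported_intros)
qed

lemma def_term_sum: "finite I \<Longrightarrow> (\<And>i. i \<in> I \<Longrightarrow> def_term n (t i)) \<Longrightarrow> def_term n (\<lambda>\<rho>. \<Sum>i\<in>I. t i \<rho>)"
  by (induction I rule: finite_induct) (auto intro: def_term_const def_term_add)

lemmas def_pred_intros = def_pred_not def_pred_conj def_pred_disj def_pred_imp def_pred_ex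
    def_pred_all def_pred_less def_pred_le def_pred_eq

lemma def_pred_ball: "finite I \<Longrightarrow> (\<And>i. i \<in> I \<Longrightarrow> def_pred n (P i)) \<Longrightarrow> def_pred n (\<lambda>\<rho>. \<forall>i\<in>I. P i \<rho>)"
  by (induction I rule: finite_induct) (auto intro: def_pred_const def_pred_conj)

end

section \<open>Monotonicity of definable functions of one variable\<close>

text \<open>Let \<open>s0\<close> be the infimum of the points right of \<open>x\<close> at which
  the relation to \<open>x\<close> fails. The left germ at \<open>s0\<close> and transitivity give
  \<open>R (\<phi> x) (\<phi> s0)\<close>, and the right germ at \<open>s0\<close> then carries the
  relation past \<open>s0\<close>, a contradiction. The form with a transitive \<open>R\<close>
  treats increasing, constant and decreasing functions together.\<close>

lemma transp_local_imp_global: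
  fixes \<phi> :: "real \<Rightarrow> real"
  assumes R: "transp R"
    and right: "\<And>r. a < r \<Longrightarrow> r < b \<Longrightarrow> \<forall>\<^sub>F s in at_right r. R (\<phi> r) (\<phi> s)"
    and left: "\<And>r. a < r \<Longrightarrow> r < b \<Longrightarrow> \<forall>\<^sub>F s in at_left r. R (\<phi> s) (\<phi> r)"
    and xy: "a < x" "x < y" "y < b"
  shows "R (\<phi> x) (\<phi> y)"
proof (rule ccontr)
  assume *: "\<not> R (\<phi> x) (\<phi> y)"
  define A where "A = {s. x < s \<and> s \<le> y \<and> \<not> R (\<phi> x) (\<phi> s)}"
  have yA: "y \<in> A" using xy * by (simp add: A_def)
  have bdd: "bdd_below A" unfolding A_def by (auto intro!: bdd_belowI[of _ x])
  define s0 where "s0 = Inf A"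
  have s0y: "s0 \<le> y" unfolding s0_def by (rule cInf_lower[OF yA bdd])
  obtain d where d: "d > x" "\<And>s. x < s \<Longrightarrow> s < d \<Longrightarrow> R (\<phi> x) (\<phi> s)"
    using right[of x] xy by (auto simp: eventually_at_right_field)
  have "d \<le> s0" unfolding s0_def
    by (rule cInf_greatest) (use yA d in \<open>auto simp: A_def not_less[symmetric]\<close>)
  with d have xs0: "x < s0" by simp
  have below: "R (\<phi> x) (\<phi> s)" if "x < s" "s < s0" for s
    using cInf_lower[OF _ bdd, of s] that s0y unfolding s0_def A_def by fastforce
  obtain l where l: "l < s0" "\<And>s. l < s \<Longrightarrow> s < s0 \<Longrightarrow> R (\<phi> s) (\<phi> s0)"
    using left[of s0] xy xs0 s0y by (auto simp: eventually_at_left_field)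
  obtain m where m: "max l x < m" "m < s0" using l xs0 dense[of "max l x" s0] by auto
  have s0: "R (\<phi> x) (\<phi> s0)" using transpD[OF R below l(2)] m by auto
  obtain u where u: "u > s0" "\<And>s. s0 < s \<Longrightarrow> s < u \<Longrightarrow> R (\<phi> s0) (\<phi> s)"
    using right[of s0] xy xs0 s0y by (auto simp: eventually_at_right_field)
  have "u \<le> s0" unfolding s0_def
  proof (rule cInf_greatest)
    show "A \<noteq> {}" using yA by auto
    fix s assume s: "s \<in> A"
    then have "s0 \<le> s" unfolding s0_def by (rule cInf_lower[OF _ bdd])
    then show "u \<le> s" using s s0 u(2)[of s] transpD[OF R s0] unfolding A_def by force
  qed
  with u show False by simp
qed

text \<open>Assign to each such point an interval with rational endpoints on which it is the strict
  extremum. Two points with the same interval would each be strictly beyond the other, so the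
  assignment is injective.\<close>

lemma countable_strict_local_extrema:
  fixes \<phi> :: "real \<Rightarrow> real"
  assumes R: "asymp R"
  shows "countable {r. (\<forall>\<^sub>F s in at_right r. R (\<phi> s) (\<phi> r)) \<and> (\<forall>\<^sub>F s in at_left r. R (\<phi> s) (\<phi> r))}"
    (is "countable ?M")
proof -
  let ?B = "\<lambda>(p, q). {r. p < r \<and> r < q \<and> (\<forall>s. p < s \<longrightarrow> s < q \<longrightarrow> s \<noteq> r \<longrightarrow> R (\<phi> s) (\<phi> r))}"
  have "?M \<subseteq> (\<Union>pq \<in> \<rat> \<times> \<rat>. ?B pq)"
  proof
    fix r assume "r \<in> ?M"
    then obtain u l where u: "u > r" "\<And>s. r < s \<Longrightarrow> s < u \<Longrightarrow> R (\<phi> s) (\<phi> r)"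
      and l: "l < r" "\<And>s. l < s \<Longrightarrow> s < r \<Longrightarrow> R (\<phi> s) (\<phi> r)"
      by (auto simp: eventually_at_right_field eventually_at_left_field)
    obtain p where p: "p \<in> \<rat>" "l < p" "p < r" using Rats_dense_in_real[OF l(1)] by blast
    obtain q where q: "q \<in> \<rat>" "r < q" "q < u" using Rats_dense_in_real[OF u(1)] by blast
    have "r \<in> ?B (p, q)" using p q u(2) l(2) by (auto simp: neq_iff)
    then show "r \<in> (\<Union>pq \<in> \<rat> \<times> \<rat>. ?B pq)" using p q by blast
  qed
  moreover have "countable (\<Union>pq \<in> \<rat> \<times> \<rat>. ?B pq)"
  proof (intro countable_UN countable_SIGMA countable_rat)
    fix pq :: "real \<times> real"
    obtain p q where pq: "pq = (p, q)" by fastforce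
    have "r = r'" if "r \<in> ?B pq" "r' \<in> ?B pq" for r r'
      using that asympD[OF R] unfolding pq by (metis (mono_tags, lifting) case_prod_conv mem_Collect_eq)
    then have sing: "?B pq \<subseteq> {r}" if "r \<in> ?B pq" for r using that by blast
    show "countable (?B pq)"
    proof (cases "?B pq = {}")
      case False
      then obtain r where "r \<in> ?B pq" by blast
      from sing[OF this] show ?thesis by (rule countable_subset) simp
    qed (simp only: countable_empty)
  qed
  ultimately show ?thesis by (rule countable_subset)
qed

lemma interval_germ:
  fixes I :: "real set"
  assumes I: "is_interval I"
  shows "(\<forall>\<^sub>F r in at_right a. r \<in> I) \<or> (\<forall>\<^sub>F r in at_right a. r \<notin> I)"
    and "(\<forall>\<^sub>F r in at_left a. r \<in> I) \<or> (\<forall>\<^sub>F r in at_left a. r \<notin> I)"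
proof -
  note conv = I[unfolded is_interval_1, rule_format]
  show "(\<forall>\<^sub>F r in at_right a. r \<in> I) \<or> (\<forall>\<^sub>F r in at_right a. r \<notin> I)"
  proof (rule disjCI)
    assume "\<not> (\<forall>\<^sub>F r in at_right a. r \<notin> I)"
    then have fr: "\<exists>s>a. s < r \<and> s \<in> I" if "r > a" for r
      using that unfolding eventually_at_right_field by blast
    obtain r0 where r0: "r0 > a" "r0 \<in> I" using fr[of "a + 1"] by auto
    have "r \<in> I" if "a < r" "r < r0" for r
      using fr[OF that(1)] conv[of _ r0 r] that r0 by force
    with r0 show "\<forall>\<^sub>F r in at_right a. r \<in> I" unfolding eventually_at_right_field by blast
  qed
  show "(\<forall>\<^sub>F r in at_left a. r \<in> I) \<or> (\<forall>\<^sub>F r in at_left a. r \<notin> I)"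
  proof (rule disjCI)
    assume "\<not> (\<forall>\<^sub>F r in at_left a. r \<notin> I)"
    then have fr: "\<exists>s<a. r < s \<and> s \<in> I" if "r < a" for r
      using that unfolding eventually_at_left_field by blast
    obtain r0 where r0: "r0 < a" "r0 \<in> I" using fr[of "a - 1"] by auto
    have "r \<in> I" if "r0 < r" "r < a" for r
      using fr[OF that(2)] conv[of r0 _ r] that r0 by force
    with r0 show "\<forall>\<^sub>F r in at_left a. r \<in> I" unfolding eventually_at_left_field by blast
  qed
qed

text \<open>Each piece is an interval and hence has a constant germ. If one piece is eventually
  everything, so is the union; otherwise finitely many eventual absences combine.\<close>

lemma finite_union_points_intervals_germ:
  assumes A: "finite_union_points_intervals A"
    and F: "F = at_right a \<or> F = at_left a"
  shows "(\<forall>\<^sub>F r in F. r \<in> A) \<or> (\<forall>\<^sub>F r in F. r \<notin> A)"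
proof -
  obtain P where P: "finite P" "A = \<Union>P"
    "\<And>I. I \<in> P \<Longrightarrow> (\<exists>a. I = {a}) \<or> (\<exists>a b :: ereal. I = {x. a < ereal x \<and> ereal x < b})"
    using A unfolding finite_union_points_intervals_def by blast
  have int: "is_interval I" if "I \<in> P" for I
    using P(3)[OF that] unfolding is_interval_1
    by (auto, (metis ereal_less_eq(3) order_less_le_trans order_le_less_trans)+)
  have "(\<forall>\<^sub>F r in F. r \<in> I) \<or> (\<forall>\<^sub>F r in F. r \<notin> I)" if "I \<in> P" for I
    using interval_germ[OF int[OF that]] F by blast
  with P(1) have "(\<forall>\<^sub>F r in F. r \<in> \<Union>P) \<or> (\<forall>\<^sub>F r in F. r \<notin> \<Union>P)"
  proof (induction P rule: finite_induct)
    case (insert I P)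
    then have "(\<forall>\<^sub>F r in F. r \<in> I) \<or> (\<forall>\<^sub>F r in F. r \<notin> I)"
      and "(\<forall>\<^sub>F r in F. r \<in> \<Union>P) \<or> (\<forall>\<^sub>F r in F. r \<notin> \<Union>P)" by auto
    moreover have "\<forall>\<^sub>F r in F. r \<in> \<Union>(insert I P)" if "\<forall>\<^sub>F r in F. r \<in> I"
      using that by eventually_elim simp
    moreover have "\<forall>\<^sub>F r in F. r \<in> \<Union>(insert I P)" if "\<forall>\<^sub>F r in F. r \<in> \<Union>P"
      using that by eventually_elim simp
    moreover have "\<forall>\<^sub>F r in F. r \<notin> \<Union>(insert I P)"
      if "\<forall>\<^sub>F r in F. r \<notin> I" "\<forall>\<^sub>F r in F. r \<notin> \<Union>P"
      using that by eventually_elim simp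
    ultimately show ?case by blast
  qed simp
  with P(2) show ?thesis by simp
qed

text \<open>A numbering of the coordinates, by which a vector variable occupies the block of
  \<open>CARD('n)\<close> consecutive real variables from \<open>n\<close> on.\<close>

definition idx :: "'n::finite \<Rightarrow> nat" where
  "idx = (SOME h. bij_betw h UNIV {..<CARD('n)})"

lemma bij_betw_idx: "bij_betw (idx :: 'n::finite \<Rightarrow> nat) UNIV {..<CARD('n)}"
proof -
  have "\<exists>h. bij_betw h (UNIV :: 'n set) {..<CARD('n)}"
    using ex_bij_betw_finite_nat[of "UNIV :: 'n set"] by (auto simp: atLeast0LessThan)
  then show ?thesis unfolding idx_def by (rule someI_ex)
qed

lemma idx_less: "idx (j :: 'n::finite) < CARD('n)"
  using bij_betw_idx[where 'n = 'n] by (auto simp: bij_betw_def)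

section \<open>Quantifiers over vectors, definable maps and their gradients\<close>

context o_minimal
begin

text \<open>\<open>\<eta>\<close> is quantified as a whole assignment, but only its values at
  \<open>n\<close>, ..., \<open>n + k - 1\<close> matter; the induction splits off the last of
  them.\<close>

lemma def_pred_ex_many:
  assumes Q: "def_pred (n + k) Q"
  shows "def_pred n (\<lambda>\<rho>. \<exists>\<eta>. Q (\<lambda>i. if i < n then \<rho> i else \<eta> i))"
  using Q
proof (induction k arbitrary: Q)
  case 0
  have "Q (\<lambda>i. if i < n then \<rho> i else \<eta> i) = Q \<rho>" for \<rho> \<eta>
    using supportedD[OF def_pred_supported[OF 0], of "\<lambda>i. if i < n then \<rho> i else \<eta> i" \<rho>] by simp
  then have "(\<lambda>\<rho>. \<exists>\<eta>. Q (\<lambda>i. if i < n then \<rho> i else \<eta> i)) = Q" by auto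
  with 0 show ?case by simp
next
  case (Suc k)
  have "supported (n + k) (\<lambda>\<rho>. Q (\<rho>(n + k := y)))" for y
    unfolding supported_def
    by (intro allI impI supportedD[OF def_pred_supported[OF Suc.prems]]) (auto simp: less_Suc_eq)
  then have "def_pred (n + k) (\<lambda>\<rho>. \<exists>y. Q (\<rho>(n + k := y)))"
    using Suc.prems by (intro def_pred_ex) auto
  then have "def_pred n (\<lambda>\<rho>. \<exists>\<eta> y. Q ((\<lambda>i. if i < n then \<rho> i else \<eta> i)(n + k := y)))"
    by (rule Suc.IH)
  moreover have "(\<exists>\<eta> y. Q ((\<lambda>i. if i < n then \<rho> i else \<eta> i)(n + k := y))) =
      (\<exists>\<eta>. Q (\<lambda>i. if i < n then \<rho> i else \<eta> i))" (is "?L = ?R") for \<rho>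
  proof
    assume ?L
    then obtain \<eta> y where "Q ((\<lambda>i. if i < n then \<rho> i else \<eta> i)(n + k := y))" by blast
    moreover have "(\<lambda>i. if i < n then \<rho> i else \<eta> i)(n + k := y) =
        (\<lambda>i. if i < n then \<rho> i else (\<eta>(n + k := y)) i)" by auto
    ultimately show ?R by metis
  next
    assume ?R
    then obtain \<eta> where "Q (\<lambda>i. if i < n then \<rho> i else \<eta> i)" by blast
    moreover have "(\<lambda>i. if i < n then \<rho> i else \<eta> i)(n + k := \<eta> (n + k)) =
        (\<lambda>i. if i < n then \<rho> i else \<eta> i)" by auto
    ultimately show ?L by metis
  qed
  ultimately show ?case by simp
qed

lemma def_pred_ex_vec:
  fixes P :: "(nat \<Rightarrow> real) \<Rightarrow> real^'n \<Rightarrow> bool"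
  assumes P: "def_pred (n + CARD('n)) (\<lambda>\<rho>. P \<rho> (\<chi> j. \<rho> (n + idx j)))"
    and s: "\<And>y. supported n (\<lambda>\<rho>. P \<rho> y)"
  shows "def_pred n (\<lambda>\<rho>. \<exists>y. P \<rho> y)"
proof -
  let ?e = "\<lambda>\<rho> \<eta> i. if i < n then \<rho> i else \<eta> i"
  have "(\<exists>\<eta>. P (?e \<rho> \<eta>) (\<chi> j. ?e \<rho> \<eta> (n + idx j))) = (\<exists>y. P \<rho> y)" (is "?L = ?R") for \<rho>
  proof -
    have *: "P (?e \<rho> \<eta>) y = P \<rho> y" for \<eta> y
      by (rule supportedD[OF s]) simp
    have "\<exists>\<eta>. y = (\<chi> j. \<eta> (n + idx j))" for y :: "real^'n"
    proof -
      have "y = (\<chi> j. (\<lambda>i. y $ (inv idx (i - n))) (n + idx j))"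
        using bij_betw_idx[where 'n = 'n] by (simp add: vec_eq_iff bij_betw_def)
      then show ?thesis by (intro exI[of _ "\<lambda>i. y $ (inv idx (i - n))"])
    qed
    then show ?thesis unfolding * by simp metis
  qed
  with def_pred_ex_many[OF P] show ?thesis by simp
qed

lemma def_pred_all_vec:
  fixes P :: "(nat \<Rightarrow> real) \<Rightarrow> real^'n \<Rightarrow> bool"
  assumes P: "def_pred (n + CARD('n)) (\<lambda>\<rho>. P \<rho> (\<chi> j. \<rho> (n + idx j)))"
    and s: "\<And>y. supported n (\<lambda>\<rho>. P \<rho> y)"
  shows "def_pred n (\<lambda>\<rho>. \<forall>y. P \<rho> y)"
  using def_pred_not[OF def_pred_ex_vec[where P = "\<lambda>\<rho> y. \<not> P \<rho> y", OF def_pred_not[OF P]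
      supported_comp[OF s]]] by simp

text \<open>Definability is stated as closure under substitution of definable terms, so that no
  coordinate ordering has to be fixed.\<close>
definition def_map :: "(real^'n \<Rightarrow> real) \<Rightarrow> bool" where
  "def_map F \<longleftrightarrow> (\<forall>n t. (\<forall>j. def_term n (t j)) \<longrightarrow> def_term n (\<lambda>\<rho>. F (\<chi> j. t j \<rho>)))"

lemma def_mapD: "def_map F \<Longrightarrow> (\<And>j. def_term n (t j)) \<Longrightarrow> def_term n (\<lambda>\<rho>. F (\<chi> j. t j \<rho>))"
  by (simp add: def_map_def)

lemma def_map_nth: "def_map (\<lambda>z. z $ j)"
  by (simp add: def_map_def)

lemma definable_fun_def_map:
  fixes f :: "real^'d \<Rightarrow> real"
  assumes "definable_fun S f" shows "def_map f"
  unfolding def_map_def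
proof (intro allI impI)
  fix n and t :: "'d \<Rightarrow> (nat \<Rightarrow> real) \<Rightarrow> real" assume t: "\<forall>j. def_term n (t j)"
  obtain e where e: "bij_betw e {..<CARD('d)} (UNIV :: 'd set)"
    and A: "{coords e x @ [f x] | x. True} \<in> S (Suc CARD('d))"
    using assms unfolding definable_fun_def by blast
  \<comment> \<open>Since \<open>e\<close> reaches every coordinate, the list determines the point,
    so membership in the graph determines the last entry.\<close>
  have coords_eqD: "x = y" if "coords e x = coords e y" for x y :: "real^'d"
  proof -
    have "x $ j = y $ j" for j
    proof -
      obtain i where "i < CARD('d)" "j = e i"
        using e by (metis UNIV_I bij_betw_iff_bijections lessThan_iff)
      with that show ?thesis by (auto simp: coords_def)
    qed
    then show ?thesis by (simp add: vec_eq_iff)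
  qed
  have "def_pred (Suc n) (\<lambda>\<rho>. map (\<lambda>i. (\<lambda>i \<rho>. if i < CARD('d) then t (e i) \<rho> else \<rho> n) i \<rho>) [0..<Suc CARD('d)]
      \<in> {coords e x @ [f x] | x. True})"
  proof (rule def_pred_relation[OF A])
    fix i
    show "def_term (Suc n) (\<lambda>\<rho>. if i < CARD('d) then t (e i) \<rho> else \<rho> n)"
      using t by (cases "i < CARD('d)") (auto intro: def_term_mono def_term_var)
  qed
  moreover have "map (\<lambda>i. if i < CARD('d) then t (e i) \<rho> else \<rho> n) [0..<Suc CARD('d)] =
      coords e (\<chi> j. t j \<rho>) @ [\<rho> n]" for \<rho>
    by (simp add: coords_def)
  moreover have "coords e (\<chi> j. t j \<rho>) @ [\<rho> n] \<in> {coords e x @ [f x] | x. True} \<longleftrightarrow>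
      \<rho> n = f (\<chi> j. t j \<rho>)" for \<rho>
    by (auto dest: coords_eqD)
  ultimately show "def_term n (\<lambda>\<rho>. f (\<chi> j. t j \<rho>))"
    using t unfolding def_term_def by (simp add: supported_comp[where h = f] supported_vec)
qed

text \<open>Being the partial derivative is an epsilon-delta formula in a candidate value, held in
  variable \<open>n\<close>. Uniqueness of derivatives turns this formula into the graph of the
  gradient component.\<close>

lemma def_map_gderiv:
  fixes F :: "real^'n \<Rightarrow> real"
  assumes F: "def_map F" and G: "\<And>z. GDERIV F z :> G z"
  shows "def_map (\<lambda>z. G z $ j)"
  unfolding def_map_def
proof (intro allI impI)
  fix n and t :: "'n \<Rightarrow> (nat \<Rightarrow> real) \<Rightarrow> real" assume t: "\<forall>j. def_term n (t j)"
  let ?z = "\<lambda>\<rho>. \<chi> i. t i \<rho>"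
  \<comment> \<open>The shift along axis \<open>j\<close> uses a constant factor 0 or 1, so that
    every component is built from definable terms.\<close>
  let ?w = "\<lambda>\<rho> h. \<chi> i. t i \<rho> + (if i = j then 1 else 0) * h"
  have tm: "n \<le> m \<Longrightarrow> def_term m (t i)" for i m using t def_term_mono by blast
  have ts: "n \<le> m \<Longrightarrow> supported m (t i)" for i m using def_term_supported[OF tm] .
  have "def_pred (Suc n) (\<lambda>\<rho>. \<forall>e. 0 < e \<longrightarrow> (\<exists>d. 0 < d \<and> (\<forall>h. \<bar>h\<bar> < d \<longrightarrow>
      \<bar>F (?w \<rho> h) - F (?z \<rho>) - \<rho> n * h\<bar> \<le> e * \<bar>h\<bar>)))"
    by (intro def_pred_intros def_mapD[OF F] def_term_const def_term_var def_term_abs def_term_diff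
        def_term_mult def_term_add tm
        supported_intros supported_comp[where h = F] ts) auto
  moreover have "(\<forall>e. 0 < e \<longrightarrow> (\<exists>d. 0 < d \<and> (\<forall>h. \<bar>h\<bar> < d \<longrightarrow>
      \<bar>F (?w \<rho> h) - F (?z \<rho>) - p * h\<bar> \<le> e * \<bar>h\<bar>))) \<longleftrightarrow> p = G (?z \<rho>) $ j" for \<rho> p
  proof -
    let ?u = "\<lambda>h. ?z \<rho> + h *\<^sub>R axis j (1::real)"
    have w: "?w \<rho> h = ?u h" for h by (simp add: vec_eq_iff axis_def)
    have dF: "(F has_derivative (\<lambda>h. h \<bullet> G (?z \<rho>))) (at (?u 0))"
      using G[of "?z \<rho>"] by (simp add: gderiv_def)
    have du: "(?u has_derivative (\<lambda>h. h *\<^sub>R axis j 1)) (at 0)"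
      by (auto intro!: derivative_eq_intros)
    have "((\<lambda>h. F (?u h)) has_derivative (\<lambda>h. (h *\<^sub>R axis j 1) \<bullet> G (?z \<rho>))) (at 0)"
      using has_derivative_compose[OF du dF] .
    moreover have "(\<lambda>h. (h *\<^sub>R axis j 1) \<bullet> G (?z \<rho>)) = (*) (G (?z \<rho>) $ j)"
      by (auto simp: fun_eq_iff inner_axis')
    ultimately have D: "((\<lambda>h. F (?u h)) has_real_derivative G (?z \<rho>) $ j) (at 0)"
      by (simp add: has_field_derivative_def)
    have "(\<forall>e. 0 < e \<longrightarrow> (\<exists>d. 0 < d \<and> (\<forall>h. \<bar>h\<bar> < d \<longrightarrow>
      \<bar>F (?w \<rho> h) - F (?z \<rho>) - p * h\<bar> \<le> e * \<bar>h\<bar>))) \<longleftrightarrow> ((\<lambda>h. F (?u h)) has_real_derivative p) (at 0)"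
      unfolding w has_field_derivative_def
      by (simp add: has_derivative_at_alt bounded_linear_mult_right)
    also have "\<dots> \<longleftrightarrow> p = G (?z \<rho>) $ j" using D DERIV_unique by blast
    finally show ?thesis .
  qed
  ultimately show "def_term n (\<lambda>\<rho>. G (?z \<rho>) $ j)"
    unfolding def_term_def using ts
    by (auto intro!: supported_comp[where h = "\<lambda>z. G z $ j"] supported_vec)
qed

section \<open>Germs of definable functions of one variable\<close>

lemma def_pred_germ:
  assumes P: "def_pred 1 (\<lambda>\<rho>. P (\<rho> 0))" and F: "F = at_right a \<or> F = at_left a"
  shows "(\<forall>\<^sub>F r in F. P r) \<or> (\<forall>\<^sub>F r in F. \<not> P r)"
proof -
  have "{xs \<in> rlists 1. P (xs ! 0)} \<in> S 1" using P by (simp add: def_pred_def)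
  from finite_union_points_intervals_germ[OF S_tame[OF this] F] show ?thesis
    by (simp add: rlists_def)
qed

lemma def_term_comp1:
  assumes \<phi>: "def_term 1 (\<lambda>\<rho>. \<phi> (\<rho> 0))" and i: "i < n"
  shows "def_term n (\<lambda>\<rho>. \<phi> (\<rho> i))"
proof -
  have "def_pred 2 (\<lambda>\<rho>. \<rho> 1 = \<phi> (\<rho> 0))" using \<phi> by (simp add: def_term_def numeral_2_eq_2)
  then have "def_pred (Suc n) (\<lambda>\<rho>. \<rho> ((\<lambda>j::nat. if j = 0 then i else n) 1) = \<phi> (\<rho> ((\<lambda>j::nat. if j =
      0 then i else n) 0)))"
    by (rule def_pred_reindex) (use i in auto)
  then show ?thesis using i by (simp add: def_term_def supported_comp[where h = \<phi>] supported_var)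
qed

lemma def_pred_order_relation:
  assumes "R \<in> {(<), (=), (>)}" "def_term n s" "def_term n t" shows "def_pred n (\<lambda>\<rho>. R (s \<rho>) (t \<rho>))"
  using assms def_pred_less def_pred_eq by auto

text \<open>The dichotomy is used twice: at fixed \<open>r\<close> it singles out one of the three
  relations between \<open>\<phi> r\<close> and the nearby values, and then, with \<open>r\<close>
  as the variable, it shows that the same relation occurs for all small \<open>r\<close>.\<close>

lemma germ_order_relation:
  assumes \<phi>: "def_term 1 (\<lambda>\<rho>. \<phi> (\<rho> 0))" and F: "F = at_right \<or> F = at_left"
  obtains R where "R \<in> {(<), (=), (>)}" "\<forall>\<^sub>F r in at_right 0. \<forall>\<^sub>F s in F r. R (\<phi> r) (\<phi> s)"
proof -
  have pointwise: "\<exists>R \<in> {(<), (=), (>)}. \<forall>\<^sub>F s in F r. R (\<phi> r) (\<phi> s)" for r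
  proof -
    have *: "(\<forall>\<^sub>F s in F r. R (\<phi> r) (\<phi> s)) \<or> (\<forall>\<^sub>F s in F r. \<not> R (\<phi> r) (\<phi> s))"
      if "R \<in> {(<), (=), (>)}" for R
      using F by (intro def_pred_germ[of _ _ r] def_pred_order_relation[OF that] \<phi> def_term_const) auto
    have "\<forall>\<^sub>F s in F r. \<phi> r > \<phi> s"
      if "\<forall>\<^sub>F s in F r. \<not> \<phi> r < \<phi> s" "\<forall>\<^sub>F s in F r. \<phi> r \<noteq> \<phi> s"
      using that by eventually_elim auto
    with *[of "(<)"] *[of "(=)"] show ?thesis by auto
  qed
  have germ: "(\<forall>\<^sub>F r in at_right 0. \<forall>\<^sub>F s in F r. R (\<phi> r) (\<phi> s)) \<or>
      (\<forall>\<^sub>F r in at_right 0. \<not> (\<forall>\<^sub>F s in F r. R (\<phi> r) (\<phi> s)))" if R: "R \<in> {(<), (=), (>)}" for R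
  proof (rule def_pred_germ[where a = 0])
    have sR: "supported n (\<lambda>\<rho>. R (s \<rho>) (t \<rho>))" if "supported n s" "supported n t" for n s t
      using that by (rule supported_comp2)
    \<comment> \<open>Written with an endpoint \<open>b\<close>, the statement about the one-sided
      germ becomes first-order in \<open>r\<close>.\<close>
    have "def_pred 1 (\<lambda>\<rho>. \<exists>b. \<rho> 0 < b \<and> (\<forall>s. \<rho> 0 < s \<longrightarrow> s < b \<longrightarrow> R (\<phi> (\<rho> 0)) (\<phi> s)))"
      by (intro def_pred_intros def_pred_order_relation[OF R] def_term_comp1[OF \<phi>] def_term_var
          supported_intros sR supported_comp[where h = \<phi>]) auto
    moreover have "def_pred 1 (\<lambda>\<rho>. \<exists>b. b < \<rho> 0 \<and> (\<forall>s. b < s \<longrightarrow> s < \<rho> 0 \<longrightarrow> R (\<phi> (\<rho> 0)) (\<phi> s)))"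
      by (intro def_pred_intros def_pred_order_relation[OF R] def_term_comp1[OF \<phi>] def_term_var
          supported_intros sR supported_comp[where h = \<phi>]) auto
    ultimately show "def_pred 1 (\<lambda>\<rho>. \<forall>\<^sub>F s in F (\<rho> 0). R (\<phi> (\<rho> 0)) (\<phi> s))"
      using F by (auto simp: eventually_at_right_field eventually_at_left_field)
  qed auto
  have "\<exists>R \<in> {(<), (=), (>)}. \<forall>\<^sub>F r in at_right 0. \<forall>\<^sub>F s in F r. R (\<phi> r) (\<phi> s)"
  proof (rule ccontr)
    assume "\<not> ?thesis"
    then have "\<forall>\<^sub>F r in at_right 0. \<not> (\<forall>\<^sub>F s in F r. \<phi> r < \<phi> s)"
      "\<forall>\<^sub>F r in at_right 0. \<not> (\<forall>\<^sub>F s in F r. \<phi> r = \<phi> s)"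
      "\<forall>\<^sub>F r in at_right 0. \<not> (\<forall>\<^sub>F s in F r. \<phi> r > \<phi> s)"
      using germ[of "(<)"] germ[of "(=)"] germ[of "(>)"] by auto
    then have "\<forall>\<^sub>F r in at_right (0::real). False"
      by eventually_elim (use pointwise in auto)
    then show False by simp
  qed
  with that show thesis by blast
qed

text \<open>Near \<open>0\<close>, the one-sided behaviour of \<open>\<phi>\<close> at \<open>r\<close> (smaller, equal or larger than \<open>\<phi> r\<close>) does not depend
  on \<open>r\<close>. Of the nine combinations, strict local extrema occur only countably often, and a function
      that is locally
  constant on exactly one side cannot have this behaviour at all points of an interval.\<close>
lemma germ_strict_monotone:
  assumes \<phi>: "def_term 1 (\<lambda>\<rho>. \<phi> (\<rho> 0))"
  obtains R \<epsilon> where "R \<in> {(<), (=), (>)}" "0 < \<epsilon>"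
    "\<And>x y. 0 < x \<Longrightarrow> x < y \<Longrightarrow> y < \<epsilon> \<Longrightarrow> R (\<phi> x) (\<phi> y)"
proof -
  obtain R where R: "R \<in> {(<), (=), (>)}" "\<forall>\<^sub>F r in at_right 0. \<forall>\<^sub>F s in at_right r. R (\<phi> r) (\<phi> s)"
    using germ_order_relation[OF \<phi>, of at_right] by blast
  obtain L where L: "L \<in> {(<), (=), (>)}" "\<forall>\<^sub>F r in at_right 0. \<forall>\<^sub>F s in at_left r. L (\<phi> r) (\<phi> s)"
    using germ_order_relation[OF \<phi>, of at_left] by blast
  obtain \<epsilon> where \<epsilon>: "\<epsilon> > 0"
    "\<And>r. 0 < r \<Longrightarrow> r < \<epsilon> \<Longrightarrow> (\<forall>\<^sub>F s in at_right r. R (\<phi> r) (\<phi> s)) \<and> (\<forall>\<^sub>F s in at_left r. L (\<phi> r) (\<phi> s))"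
    using eventually_conj[OF R(2) L(2)] unfolding eventually_at_right_field by auto
  have right: "\<forall>\<^sub>F s in at_right r. R (\<phi> r) (\<phi> s)" and left: "\<forall>\<^sub>F s in at_left r. L (\<phi> r) (\<phi> s)"
    if "0 < r" "r < \<epsilon>" for r using \<epsilon>(2)[OF that] by auto
  have half: "0 < \<epsilon> / 2" "\<epsilon> / 2 < \<epsilon>" using \<epsilon>(1) by auto
  have not_extremum: False if RL: "R = L" and as: "asymp R" and conv: "asymp (\<lambda>x y. R y x)"
  proof -
    have "{0<..<\<epsilon>} \<subseteq> {r. (\<forall>\<^sub>F s in at_right r. R (\<phi> r) (\<phi> s)) \<and> (\<forall>\<^sub>F s in at_left r. R (\<phi> r) (\<phi> s))}"
      using right left RL by auto
    then have "countable {0<..<\<epsilon>}"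
      using countable_strict_local_extrema[OF conv] by (rule countable_subset)
    with \<epsilon>(1) show False using uncountable_open_interval[of 0 \<epsilon>] by blast
  qed
  have left_const: False if eq: "L = (=)" "R \<noteq> (=)"
  proof -
    \<comment> \<open>\<open>\<phi>\<close> is constant just left of \<open>\<epsilon> / 2\<close>,
      hence also just right of any \<open>m\<close> in that stretch, against the right-hand
      behaviour at \<open>m\<close>.\<close>
    obtain b where b: "b < \<epsilon> / 2" "\<And>s. b < s \<Longrightarrow> s < \<epsilon> / 2 \<Longrightarrow> \<phi> (\<epsilon> / 2) = \<phi> s"
      using left[OF half] eq by (auto simp: eventually_at_left_field)
    have "max b 0 < \<epsilon> / 2" using b(1) half by (simp only: max_less_iff_conj)
    then obtain m where m: "max b 0 < m" "m < \<epsilon> / 2" using dense by blast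
    then have "\<forall>\<^sub>F s in at_right m. R (\<phi> m) (\<phi> s)" using right half by auto
    moreover have "\<phi> m = \<phi> s" if "m < s" "s < \<epsilon> / 2" for s
      using that m b(2)[of m] b(2)[of s] by simp
    then have "\<forall>\<^sub>F s in at_right m. \<phi> m = \<phi> s"
      unfolding eventually_at_right_field using m by (intro exI[of _ "\<epsilon> / 2"]) blast
    ultimately have "\<forall>\<^sub>F s in at_right m. False"
      by eventually_elim (use R(1) eq in auto)
    then show False by simp
  qed
  have right_const: False if eq: "R = (=)" "L \<noteq> (=)"
  proof -
    obtain b where b: "b > \<epsilon> / 2" "\<And>s. \<epsilon> / 2 < s \<Longrightarrow> s < b \<Longrightarrow> \<phi> (\<epsilon> / 2) = \<phi> s"
      using right[OF half] eq by (auto simp: eventually_at_right_field)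
    have "\<epsilon> / 2 < min b \<epsilon>" using b(1) half by (simp only: min_less_iff_conj)
    then obtain m where m: "\<epsilon> / 2 < m" "m < min b \<epsilon>" using dense by blast
    then have "\<forall>\<^sub>F s in at_left m. L (\<phi> m) (\<phi> s)" using left half by auto
    moreover have "\<phi> m = \<phi> s" if "\<epsilon> / 2 < s" "s < m" for s
      using that m b(2)[of m] b(2)[of s] by simp
    then have "\<forall>\<^sub>F s in at_left m. \<phi> m = \<phi> s"
      unfolding eventually_at_left_field using m by (intro exI[of _ "\<epsilon> / 2"]) blast
    ultimately have "\<forall>\<^sub>F s in at_left m. False"
      by eventually_elim (use L(1) eq in auto)
    then show False by simp
  qed
  have ne: "(<) \<noteq> ((=) :: real \<Rightarrow> _)" "(>) \<noteq> ((=) :: real \<Rightarrow> _)"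
    by (auto dest!: fun_cong[where x = 0 and f = "(<)"] fun_cong[where x = 0 and f = "(>)"]
        fun_cong[where x = 0 and f = "(<) 0"] fun_cong[where x = 0 and f = "\<lambda>y. y < 0"])
  have "\<not> (R = L \<and> R \<noteq> (=))" using not_extremum R(1) by (auto simp: asymp_on_def)
  \<comment> \<open>Of the nine pairs, those remain in which \<open>L\<close> is the converse of
    \<open>R\<close>; equality is paired with itself.\<close>
  then have "L = (\<lambda>x y. R y x)"
    using R(1) L(1) left_const right_const ne by (elim insertE emptyE) (simp_all add: eq_commute)
  with left have left': "\<forall>\<^sub>F s in at_left r. R (\<phi> s) (\<phi> r)" if "0 < r" "r < \<epsilon>" for r
    using that by auto
  have "transp R" using R(1) by (auto simp: transp_on_def)
  from that[OF R(1) \<epsilon>(1)] transp_local_imp_global[OF this right left'] show thesis by blast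
qed

text \<open>Continuity at \<open>r\<close> is definable in \<open>r\<close>, so failure would mean
  discontinuity on a whole interval. On a smaller interval \<open>\<phi>\<close> is monotone and has
  only countably many discontinuities.\<close>

lemma germ_continuous:
  assumes \<phi>: "def_term 1 (\<lambda>\<rho>. \<phi> (\<rho> 0))"
  shows "\<forall>\<^sub>F r in at_right 0. isCont \<phi> r"
proof -
  have "def_pred 1 (\<lambda>\<rho>. \<forall>e. 0 < e \<longrightarrow> (\<exists>d. 0 < d \<and> (\<forall>s. \<bar>s - \<rho> 0\<bar> < d \<longrightarrow> \<bar>\<phi> s - \<phi> (\<rho> 0)\<bar> < e)))"
    by (intro def_pred_intros def_term_comp1[OF \<phi>] def_term_var def_term_abs def_term_diff
        def_term_const supported_intros supported_comp[where h = \<phi>]) auto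
  then have "def_pred 1 (\<lambda>\<rho>. isCont \<phi> (\<rho> 0))"
    by (simp add: continuous_at_eps_delta dist_real_def)
  then have "(\<forall>\<^sub>F r in at_right 0. isCont \<phi> r) \<or> (\<forall>\<^sub>F r in at_right 0. \<not> isCont \<phi> r)"
    by (rule def_pred_germ[where a = 0]) simp
  moreover have False if disc: "\<forall>\<^sub>F r in at_right 0. \<not> isCont \<phi> r"
  proof -
    obtain R \<epsilon> where R: "R \<in> {(<), (=), (>)}" "0 < \<epsilon>"
      "\<And>x y. 0 < x \<Longrightarrow> x < y \<Longrightarrow> y < \<epsilon> \<Longrightarrow> R (\<phi> x) (\<phi> y)"
      using germ_strict_monotone[OF \<phi>] by blast
    obtain b where b: "b > 0" "\<And>r. 0 < r \<Longrightarrow> r < b \<Longrightarrow> \<not> isCont \<phi> r"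
      using disc by (auto simp: eventually_at_right_field)
    let ?U = "{0<..<min b \<epsilon>}"
    have "mono_on ?U \<phi> \<or> mono_on ?U (\<lambda>x. - \<phi> x)"
    proof (cases "R = (>)")
      case True
      then have "mono_on ?U (\<lambda>x. - \<phi> x)" using R(3)
        by (auto intro!: mono_onI simp: le_less)
      then show ?thesis ..
    next
      case False
      then have "mono_on ?U \<phi>" using R(1,3)
        by (auto intro!: mono_onI simp: le_less)
      then show ?thesis ..
    qed
    then obtain g where g: "g = \<phi> \<or> g = (\<lambda>x. - \<phi> x)" "mono_on ?U g" by blast
    have "?U \<subseteq> {a \<in> ?U. \<not> continuous (at a within ?U) g}"
    proof
      fix r assume r: "r \<in> ?U"
      have "\<not> isCont g r"
      proof
        assume "isCont g r"
        then have "isCont \<phi> r" using g(1) continuous_minus[of "at r" "\<lambda>x. - \<phi> x"] by auto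
        with b r show False by auto
      qed
      moreover have "at r within ?U = at r" using r by (intro at_within_open) auto
      ultimately show "r \<in> {a \<in> ?U. \<not> continuous (at a within ?U) g}" using r by simp
    qed
    then have "countable ?U" using mono_on_ctble_discont[OF g(2)] by (rule countable_subset)
    with b R show False using uncountable_open_interval[of 0 "min b \<epsilon>"] by simp
  qed
  ultimately show ?thesis by blast
qed

end

section \<open>Definable selection and Kurdyka's inequality\<close>

definition minimizers :: "('a \<Rightarrow> real) \<Rightarrow> 'a set \<Rightarrow> 'a set" where
  "minimizers c A = {z \<in> A. \<forall>w\<in>A. c z \<le> c w}"

lemma minimizers_nonempty:
  assumes "compact A" "A \<noteq> {}" "continuous_on UNIV c"
  shows "minimizers c A \<noteq> {}"
  using continuous_attains_inf[OF assms(1,2) continuous_on_subset[OF assms(3)]]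
  by (auto simp: minimizers_def)

lemma compact_minimizers:
  fixes A :: "'a::t2_space set"
  assumes A: "compact A" and c: "continuous_on UNIV c"
  shows "compact (minimizers c A)"
proof -
  have "minimizers c A = A \<inter> (\<Inter>w\<in>A. {z. c z \<le> c w})" by (auto simp: minimizers_def)
  moreover have "closed (\<Inter>w\<in>A. {z. c z \<le> c w})"
    using c by (intro closed_INT ballI closed_Collect_le continuous_on_const)
  ultimately show ?thesis using A by (simp add: compact_Int_closed)
qed

context o_minimal
begin

definition def_family :: "(real \<Rightarrow> (real^'n) set) \<Rightarrow> bool" where
  "def_family A \<longleftrightarrow> (\<forall>n s t. def_term n s \<longrightarrow> (\<forall>j. def_term n (t j)) \<longrightarrow> def_pred n (\<lambda>\<rho>. (\<chi> j. t j \<rho>) \<in> A (s \<rho>)))"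

lemma def_familyD: "def_family A \<Longrightarrow> def_term n s \<Longrightarrow> (\<And>j. def_term n (t j)) \<Longrightarrow> def_pred n (\<lambda>\<rho>. (\<chi> j. t j
    \<rho>) \<in> A (s \<rho>))"
  by (simp add: def_family_def)

lemma supported_mem: "supported n s \<Longrightarrow> supported n (\<lambda>\<rho>. z \<in> A (s \<rho>))"
  by (rule supported_comp)

lemma def_family_minimizers:
  fixes A :: "real \<Rightarrow> (real^'n) set"
  assumes A: "def_family A" and c: "def_map c"
  shows "def_family (\<lambda>r. minimizers c (A r))"
  unfolding def_family_def
proof (intro allI impI)
  fix n s and t :: "'n \<Rightarrow> (nat \<Rightarrow> real) \<Rightarrow> real" assume s: "def_term n s" and t: "\<forall>j. def_term n (t j)"
  have "def_pred n (\<lambda>\<rho>. (\<chi> j. t j \<rho>) \<in> A (s \<rho>) \<and> (\<forall>w. w \<in> A (s \<rho>) \<longrightarrow> c (\<chi> j. t j \<rho>) \<le> c w))"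
  proof (intro def_pred_conj def_pred_all_vec def_pred_imp def_pred_le def_mapD[OF c] def_familyD[OF
      A] def_term_var)
    show "supported n (\<lambda>\<rho>. w \<in> A (s \<rho>) \<longrightarrow> c (\<chi> j. t j \<rho>) \<le> c w)" for w
      using s t by (intro supported_comp2[where h = implies] supported_comp2[where h = less_eq] supported_mem
          supported_const supported_comp[where h = c] supported_vec) (auto intro: def_term_supported)
  qed (use s t in \<open>auto simp: idx_less intro: def_term_mono\<close>)
  then show "def_pred n (\<lambda>\<rho>. (\<chi> j. t j \<rho>) \<in> minimizers c (A (s \<rho>)))"
    by (simp add: minimizers_def Ball_def)
qed

text \<open>This is lexicographic minimization, the head of the list being minimized last. Each
  round passes to a subset, on which the costs treated earlier remain constant; compactness keeps
  the sets nonempty.\<close>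

lemma iterated_minimizers:
  fixes A :: "real \<Rightarrow> (real^'n) set"
  assumes "def_family A" "\<And>r. compact (A r)"
    and "\<And>c. c \<in> set cs \<Longrightarrow> def_map c \<and> continuous_on UNIV c"
  shows "\<exists>B. def_family B \<and> (\<forall>r. compact (B r) \<and> B r \<subseteq> A r \<and> (A r \<noteq> {} \<longrightarrow> B r \<noteq> {}) \<and>
    (\<forall>c\<in>set cs. \<forall>z\<in>B r. \<forall>w\<in>B r. c z = c w))"
  using assms(3)
proof (induction cs)
  case Nil
  with assms show ?case by auto
next
  case (Cons c cs)
  then obtain B where B: "def_family B" "\<And>r. compact (B r)" "\<And>r. B r \<subseteq> A r" "\<And>r. A r \<noteq> {} \<Longrightarrow> B r \<noteq> {}"
    "\<And>r c z w. c \<in> set cs \<Longrightarrow> z \<in> B r \<Longrightarrow> w \<in> B r \<Longrightarrow> c z = c w" by auto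
  have c: "def_map c" "continuous_on UNIV c" using Cons.prems by auto
  let ?B = "\<lambda>r. minimizers c (B r)"
  have sub: "?B r \<subseteq> B r" for r by (auto simp: minimizers_def)
  have c_eq: "c z = c w" if "z \<in> ?B r" "w \<in> ?B r" for z w r
    using that by (auto simp: minimizers_def intro: antisym)
  have "\<forall>c'\<in>set (c # cs). \<forall>z\<in>?B r. \<forall>w\<in>?B r. c' z = c' w" for r
  proof (intro ballI)
    fix c' z w assume c': "c' \<in> set (c # cs)" and zw: "z \<in> ?B r" "w \<in> ?B r"
    show "c' z = c' w"
    proof (cases "c' = c")
      case True
      with c_eq[OF zw] show ?thesis by simp
    next
      case False
      with c' have "c' \<in> set cs" by simp
      then show ?thesis using zw sub by (intro B(5)[of c' z r w]) auto
    qed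
  qed
  moreover have "compact (?B r)" "?B r \<subseteq> A r" "A r \<noteq> {} \<longrightarrow> ?B r \<noteq> {}" for r
    using compact_minimizers[OF B(2) c(2)] sub[of r] B(3)[of r] minimizers_nonempty[OF B(2) B(4) c(2)]
    by auto
  ultimately show ?case
    by (intro exI[of _ ?B] conjI def_family_minimizers[OF B(1) c(1)] allI) assumption+
qed

text \<open>With all coordinates as costs, the minimization leaves at most one point on each level,
  and that point is definable in the level.\<close>

lemma definable_selection:
  fixes A :: "real \<Rightarrow> (real^'n) set"
  assumes A: "def_family A" "\<And>r. compact (A r)"
  obtains \<xi> where "\<And>j. def_term 1 (\<lambda>\<rho>. \<xi> (\<rho> 0) $ j)" "\<And>r. A r \<noteq> {} \<Longrightarrow> \<xi> r \<in> A r"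
proof -
  obtain js where js: "set js = (UNIV :: 'n set)" using finite_list[of "UNIV :: 'n set"] by auto
  let ?cs = "map (\<lambda>j z :: real^'n. z $ j) js"
  have "def_map c \<and> continuous_on UNIV c" if "c \<in> set ?cs" for c
    using that def_map_nth by (auto intro!: continuous_intros)
  then have "\<exists>B. def_family B \<and> (\<forall>r. compact (B r) \<and> B r \<subseteq> A r \<and> (A r \<noteq> {} \<longrightarrow> B r \<noteq> {}) \<and>
      (\<forall>c\<in>set ?cs. \<forall>z\<in>B r. \<forall>w\<in>B r. c z = c w))"
    (is "\<exists>B. def_family B \<and> (\<forall>r. ?Q B r)")
    by (rule iterated_minimizers[OF A])
  then obtain B where "def_family B \<and> (\<forall>r. ?Q B r)" by (rule exE)
  then have B: "def_family B" and Q: "?Q B r" for r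
    by (rule conjunct1, rule conjunct2[THEN spec])
  have B': "B r \<subseteq> A r \<and> (A r \<noteq> {} \<longrightarrow> B r \<noteq> {})" for r
    using Q[of r] by (elim conjE) (intro conjI)
  have B_eq: "z $ j = w $ j" if "z \<in> B r" "w \<in> B r" for r j z w
  proof -
    have "(\<lambda>z. z $ j) \<in> set ?cs" using js by simp
    from bspec[OF conjunct2[OF conjunct2[OF conjunct2[OF Q[of r]]]] this] that
    show ?thesis by blast
  qed
  \<comment> \<open>The value 0 on empty levels makes \<open>\<xi>\<close> total; the graph formula
    below needs a second disjunct for it.\<close>
  define \<xi> where "\<xi> r = (if B r = {} then 0 else SOME z. z \<in> B r)" for r
  have \<xi>: "\<xi> r \<in> B r" if "B r \<noteq> {}" for r
    using that by (auto simp: \<xi>_def intro: someI)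
  have "def_term 1 (\<lambda>\<rho>. \<xi> (\<rho> 0) $ j)" for j
  proof -
    have ex: "def_pred 2 (\<lambda>\<rho>. \<exists>z. z \<in> B (\<rho> 0))"
      by (intro def_pred_ex_vec def_familyD[OF B] def_term_var supported_mem supported_var) (auto
          simp: idx_less)
    have "def_pred 2 (\<lambda>\<rho>. \<exists>z. z \<in> B (\<rho> 0) \<and> z $ j = \<rho> 1)"
      by (intro def_pred_ex_vec def_pred_conj def_pred_eq def_familyD[OF B] def_mapD[OF def_map_nth]
          def_term_var supported_intros supported_mem)
        (auto simp: idx_less)
    with ex have "def_pred 2 (\<lambda>\<rho>. (\<exists>z. z \<in> B (\<rho> 0) \<and> z $ j = \<rho> 1) \<or> (\<not> (\<exists>z. z \<in> B (\<rho> 0)) \<and> \<rho> 1 = 0))"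
      by (intro def_pred_disj def_pred_conj def_pred_not def_pred_eq def_term_var def_term_const) auto
    moreover have "(\<exists>z. z \<in> B r \<and> z $ j = y) \<or> (\<not> (\<exists>z. z \<in> B r) \<and> y = 0) \<longleftrightarrow> y = \<xi> r $ j" for r y
    proof (cases "B r = {}")
      case True
      then show ?thesis by (simp add: \<xi>_def)
    next
      case False
      show ?thesis using \<xi>[OF False] B_eq[OF _ \<xi>[OF False], of _ j] by metis
    qed
    ultimately have "def_pred 2 (\<lambda>\<rho>. \<rho> 1 = \<xi> (\<rho> 0) $ j)" by simp
    then show ?thesis
      by (simp add: def_term_def numeral_2_eq_2 supported_comp[where h = "\<lambda>r. \<xi> r $ j"] supported_var)
  qed
  moreover have "\<xi> r \<in> A r" if "A r \<noteq> {}" for r using \<xi> B' that by blast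
  ultimately show thesis using that by blast
qed

text \<open>The sign is 1 for \<open><\<close> and \<open>=\<close>, and -1 for \<open>>\<close>.
  The bound is left as an eventual statement about \<open>\<epsilon>\<close>, so that finitely many
  coordinates can share one \<open>\<epsilon>\<close>.\<close>

lemma germ_monotone_sign:
  assumes "def_term 1 (\<lambda>\<rho>. \<phi> (\<rho> 0))"
  obtains \<sigma> where "\<bar>\<sigma>\<bar> = 1" "\<forall>\<^sub>F \<epsilon> in at_right 0. \<forall>x y. 0 < x \<longrightarrow> x \<le> y \<longrightarrow> y < \<epsilon> \<longrightarrow> \<sigma> * \<phi> x \<le> \<sigma> * \<phi> y"
proof -
  obtain R \<epsilon> where R: "R \<in> {(<), (=), (>)}" "0 < \<epsilon>"
    "\<And>x y. 0 < x \<Longrightarrow> x < y \<Longrightarrow> y < \<epsilon> \<Longrightarrow> R (\<phi> x) (\<phi> y)"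
    using germ_strict_monotone[OF assms] by blast
  obtain \<sigma> :: real where \<sigma>: "\<bar>\<sigma>\<bar> = 1" "\<And>a b. R a b \<Longrightarrow> \<sigma> * a \<le> \<sigma> * b"
    using R(1) that[of 1] that[of "-1"] by fastforce
  have "\<sigma> * \<phi> x \<le> \<sigma> * \<phi> y" if "0 < x" "x \<le> y" "y < \<epsilon>" for x y
    using \<sigma>(2)[OF R(3)] that by (cases "x = y") auto
  then have "\<forall>\<^sub>F \<epsilon> in at_right 0. \<forall>x y. 0 < x \<longrightarrow> x \<le> y \<longrightarrow> y < \<epsilon> \<longrightarrow> \<sigma> * \<phi> x \<le> \<sigma> * \<phi> y"
    unfolding eventually_at_right_field using R(2) by (intro exI[of _ \<epsilon>]) auto
  with that \<sigma>(1) show thesis by blast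
qed

lemma kurdyka:
  fixes F :: "real^'n \<Rightarrow> real"
  assumes F: "def_map F" and G: "\<And>z. GDERIV F z :> G z" and contG: "continuous_on UNIV G"
  obtains \<epsilon> \<psi> B where "0 < \<epsilon>" "continuous_on {0<..<\<epsilon>} \<psi>" "mono_on {0<..<\<epsilon>} \<psi>"
    "\<And>r. 0 < r \<Longrightarrow> r < \<epsilon> \<Longrightarrow> \<bar>\<psi> r\<bar> \<le> B"
    "\<And>z r h. \<forall>j. \<bar>z $ j\<bar> \<le> M \<Longrightarrow> F z = l + r \<Longrightarrow> 0 < r \<Longrightarrow> r < \<epsilon> \<Longrightarrow> norm (G z) < h \<Longrightarrow>
      \<forall>\<^sub>F s in at r. \<bar>s - r\<bar> \<le> h * \<bar>\<psi> s - \<psi> r\<bar>"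
proof -
  \<comment> \<open>The squared norm is minimized because it is a polynomial in the gradient
    components, hence a definable term.\<close>
  define q where "q z = (\<Sum>j\<in>UNIV. G z $ j * G z $ j)" for z
  define K where "K r = {z :: real^'n. (\<forall>j\<in>UNIV. \<bar>z $ j\<bar> \<le> M) \<and> F z = l + r}" for r
  have q_norm: "q z = (norm (G z))\<^sup>2" for z
    by (simp add: q_def power2_norm_eq_inner inner_vec_def)
  have contF: "continuous_on UNIV F"
    using G by (auto simp: gderiv_def intro!: continuous_at_imp_continuous_on has_derivative_continuous)
  have def_map_q: "def_map q" unfolding def_map_def q_def
    by (auto intro!: def_term_sum def_term_mult def_mapD[OF def_map_gderiv[OF F G]])
  have "def_family K" unfolding def_family_def K_def mem_Collect_eq
    by (intro allI impI def_pred_conj def_pred_ball def_pred_le def_pred_eq def_term_abs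
        def_term_add def_term_const def_mapD[OF F] def_mapD[OF def_map_nth]) auto
  moreover have compactK: "compact (K r)" for r
  proof -
    have "K r = cbox (\<chi> j. - M) (\<chi> j. M) \<inter> {z. F z = l + r}"
      by (auto simp: K_def mem_box_cart abs_le_iff minus_le_iff)
    moreover have "closed {z. F z = l + r}"
      by (intro closed_Collect_eq contF continuous_on_const)
    ultimately show ?thesis by (simp add: compact_Int_closed)
  qed
  have contq: "continuous_on UNIV q" unfolding q_def by (intro continuous_intros contG)
  obtain \<xi> where tm: "\<And>j. def_term 1 (\<lambda>\<rho>. \<xi> (\<rho> 0) $ j)"
    and \<xi>: "\<And>r. minimizers q (K r) \<noteq> {} \<Longrightarrow> \<xi> r \<in> minimizers q (K r)"
    using definable_selection[OF def_family_minimizers[OF \<open>def_family K\<close> def_map_q]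
        compact_minimizers[OF compactK contq]]
    by blast
  have "def_pred 1 (\<lambda>\<rho>. \<exists>z. z \<in> K (\<rho> 0))"
    by (intro def_pred_ex_vec def_familyD[OF \<open>def_family K\<close>] def_term_var supported_mem
        supported_var) (auto simp: idx_less)
  then consider "\<forall>\<^sub>F r in at_right 0. \<exists>z. z \<in> K r" | "\<forall>\<^sub>F r in at_right 0. \<not> (\<exists>z. z \<in> K r)"
    using def_pred_germ[where a = 0 and P = "\<lambda>r. \<exists>z. z \<in> K r"] by blast
  then show thesis
  proof cases
    \<comment> \<open>Levels just above \<open>l\<close> miss the cube, so the claim about
      \<open>z\<close> is vacuous and the zero function will do.\<close>
    case 2
    then obtain \<epsilon> where \<epsilon>: "\<epsilon> > 0" "\<And>r. 0 < r \<Longrightarrow> r < \<epsilon> \<Longrightarrow> \<not> (\<exists>z. z \<in> K r)"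
      by (auto simp: eventually_at_right_field)
    show thesis
      by (rule that[of \<epsilon> "\<lambda>_. 0" 0]) (use \<epsilon> in \<open>auto simp: K_def mono_on_def\<close>)
  next
    case 1
    have "\<forall>j. \<exists>\<sigma>. \<bar>\<sigma>\<bar> = 1 \<and> (\<forall>\<^sub>F \<epsilon> in at_right 0. \<forall>x y. 0 < x \<longrightarrow> x \<le> y \<longrightarrow> y < \<epsilon> \<longrightarrow>
        \<sigma> * \<xi> x $ j \<le> \<sigma> * \<xi> y $ j)"
    proof
      fix j
      show "\<exists>\<sigma>. \<bar>\<sigma>\<bar> = 1 \<and> (\<forall>\<^sub>F \<epsilon> in at_right 0. \<forall>x y. 0 < x \<longrightarrow> x \<le> y \<longrightarrow> y < \<epsilon> \<longrightarrow>
        \<sigma> * \<xi> x $ j \<le> \<sigma> * \<xi> y $ j)"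
        by (rule germ_monotone_sign[OF tm[of j]]) blast
    qed
    from choice[OF this] obtain \<sigma> where \<sigma>: "\<And>j. \<bar>\<sigma> j\<bar> = 1" "\<And>j. \<forall>\<^sub>F \<epsilon> in at_right 0. \<forall>x y. 0 < x \<longrightarrow> x
        \<le> y \<longrightarrow> y < \<epsilon> \<longrightarrow>
        \<sigma> j * \<xi> x $ j \<le> \<sigma> j * \<xi> y $ j" by blast
    have "\<forall>\<^sub>F \<epsilon> in at_right 0. \<forall>j x y. 0 < x \<longrightarrow> x \<le> y \<longrightarrow> y < \<epsilon> \<longrightarrow> \<sigma> j * \<xi> x $ j \<le> \<sigma> j * \<xi> y $ j"
      using \<sigma>(2) by (rule eventually_all_finite)
    then obtain \<epsilon>1 where \<epsilon>1: "\<epsilon>1 > 0" "\<And>x y j. 0 < x \<Longrightarrow> x \<le> y \<Longrightarrow> y < \<epsilon>1 \<Longrightarrow> \<sigma> j * \<xi> x $ j \<le> \<sigma> j * \<xi> y $ j"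
    proof -
      assume ev: "\<forall>\<^sub>F \<epsilon> in at_right 0. \<forall>j x y. 0 < x \<longrightarrow> x \<le> y \<longrightarrow> y < \<epsilon> \<longrightarrow> \<sigma> j * \<xi> x $ j \<le> \<sigma> j * \<xi> y $ j"
      then obtain b where b: "b > 0" "\<And>\<epsilon>. 0 < \<epsilon> \<Longrightarrow> \<epsilon> < b \<Longrightarrow>
          \<forall>j x y. 0 < x \<longrightarrow> x \<le> y \<longrightarrow> y < \<epsilon> \<longrightarrow> \<sigma> j * \<xi> x $ j \<le> \<sigma> j * \<xi> y $ j"
        unfolding eventually_at_right_field by blast
      show thesis by (rule that[of "b / 2"]) (use b(1) b(2)[of "b / 2"] in auto)
    qed
    have "\<forall>\<^sub>F r in at_right 0. \<forall>j. isCont (\<lambda>r. \<xi> r $ j) r"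
      by (intro eventually_all_finite germ_continuous[OF tm])
    from eventually_conj[OF 1 this] obtain \<epsilon>2 where \<epsilon>2: "\<epsilon>2 > 0"
      "\<And>r. 0 < r \<Longrightarrow> r < \<epsilon>2 \<Longrightarrow> (\<exists>z. z \<in> K r) \<and> (\<forall>j. isCont (\<lambda>r. \<xi> r $ j) r)"
      unfolding eventually_at_right_field by blast
    define \<epsilon> where "\<epsilon> = min \<epsilon>1 \<epsilon>2"
    define \<psi> where "\<psi> r = (\<Sum>j\<in>UNIV. \<sigma> j * \<xi> r $ j)" for r
    have \<epsilon>: "\<epsilon> > 0" using \<epsilon>1 \<epsilon>2 by (simp add: \<epsilon>_def)
    have cont: "isCont (\<lambda>r. \<xi> r $ j) r" if "0 < r" "r < \<epsilon>" for r j
      using \<epsilon>2(2)[of r] that by (simp add: \<epsilon>_def)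
    have cont\<xi>: "isCont \<xi> r" if "0 < r" "r < \<epsilon>" for r
      using cont[OF that] unfolding isCont_def by (intro vec_tendstoI)
    have \<xi>K: "\<xi> r \<in> minimizers q (K r)" if "0 < r" "r < \<epsilon>" for r
      using \<epsilon>2(2)[of r] that minimizers_nonempty[OF compactK _ contq] \<xi> by (auto simp: \<epsilon>_def)
    have mono: "\<sigma> j * \<xi> x $ j \<le> \<sigma> j * \<xi> y $ j" if "0 < x" "x \<le> y" "y < \<epsilon>" for x y j
      using \<epsilon>1(2) that by (simp add: \<epsilon>_def)
    have norm_le: "norm (\<xi> y - \<xi> x) \<le> \<bar>\<psi> y - \<psi> x\<bar>" if "0 < x" "x \<le> y" "y < \<epsilon>" for x y
    proof -
      \<comment> \<open>All signed coordinates are nondecreasing, so the l1 distance between two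
        points of the curve equals the increment of \<open>\<psi>\<close>.\<close>
      have "norm (\<xi> y - \<xi> x) \<le> (\<Sum>j\<in>UNIV. \<bar>(\<xi> y - \<xi> x) $ j\<bar>)" by (rule norm_le_l1_cart)
      also have "\<dots> = (\<Sum>j\<in>UNIV. \<sigma> j * \<xi> y $ j - \<sigma> j * \<xi> x $ j)"
      proof (rule sum.cong[OF refl])
        fix j
        have "\<bar>(\<xi> y - \<xi> x) $ j\<bar> = \<bar>\<sigma> j * (\<xi> y $ j - \<xi> x $ j)\<bar>" by (simp add: abs_mult \<sigma>(1))
        also have "\<dots> = \<sigma> j * \<xi> y $ j - \<sigma> j * \<xi> x $ j"
          using mono[OF that, of j] by (simp add: right_diff_distrib)
        finally show "\<bar>(\<xi> y - \<xi> x) $ j\<bar> = \<sigma> j * \<xi> y $ j - \<sigma> j * \<xi> x $ j" .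
      qed
      also have "\<dots> = \<psi> y - \<psi> x" by (simp add: \<psi>_def sum_subtractf)
      finally show ?thesis by simp
    qed
    show thesis
    proof (rule that[of \<epsilon> \<psi> "\<Sum>j\<in>(UNIV :: 'n set). M"])
      show "\<epsilon> > 0" by fact
      show "continuous_on {0<..<\<epsilon>} \<psi>" unfolding \<psi>_def
        by (intro continuous_at_imp_continuous_on ballI continuous_sum continuous_mult
            continuous_const cont) auto
      show "mono_on {0<..<\<epsilon>} \<psi>" unfolding \<psi>_def
        by (intro mono_onI sum_mono mono) auto
      show "\<bar>\<psi> r\<bar> \<le> (\<Sum>j\<in>(UNIV :: 'n set). M)" if "0 < r" "r < \<epsilon>" for r
        unfolding \<psi>_def
        by (rule order_trans[OF sum_abs], rule sum_mono)
          (use \<xi>K[OF that] in \<open>auto simp: minimizers_def K_def abs_mult \<sigma>(1)\<close>)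
    next
      fix z r h
      assume z: "\<forall>j. \<bar>z $ j\<bar> \<le> M" "F z = l + r" and r: "0 < r" "r < \<epsilon>" and h: "norm (G z) < h"
      have "z \<in> K r" using z by (simp add: K_def)
      then have "q (\<xi> r) \<le> q z" using \<xi>K[OF r] by (simp add: minimizers_def)
      then have "norm (G (\<xi> r)) < h" using h by (simp add: q_norm)
      \<comment> \<open>The tolerance \<open>h - norm (G (\<xi> r))\<close> is positive and, added
        to the linear part, gives the factor \<open>h\<close> exactly.\<close>
      then obtain d where d: "d > 0" "\<And>w. norm (w - \<xi> r) < d \<Longrightarrow>
          \<bar>F w - F (\<xi> r) - (w - \<xi> r) \<bullet> G (\<xi> r)\<bar> \<le> (h - norm (G (\<xi> r))) * norm (w - \<xi> r)"
        using G[of "\<xi> r"] unfolding gderiv_def has_derivative_at_alt by (auto dest!: spec[of _ "h -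
            norm (G (\<xi> r))"])
      have close: "\<bar>F w - F (\<xi> r)\<bar> \<le> h * norm (w - \<xi> r)" if "norm (w - \<xi> r) < d" for w
        using d(2)[OF that] Cauchy_Schwarz_ineq2[of "w - \<xi> r" "G (\<xi> r)"]
        by (simp add: algebra_simps)
      have "\<forall>\<^sub>F s in at r. dist (\<xi> s) (\<xi> r) < d"
        using cont\<xi>[OF r] d(1) unfolding isCont_def by (rule tendstoD)
      moreover have "\<forall>\<^sub>F s in at r. s \<in> {0<..<\<epsilon>}"
        using r by (intro eventually_at_in_open') auto
      ultimately show "\<forall>\<^sub>F s in at r. \<bar>s - r\<bar> \<le> h * \<bar>\<psi> s - \<psi> r\<bar>"
      proof eventually_elim
        fix s assume s: "dist (\<xi> s) (\<xi> r) < d" "s \<in> {0<..<\<epsilon>}"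
        have "F (\<xi> s) = l + s" "F (\<xi> r) = l + r"
          using \<xi>K[of s] \<xi>K[of r] s r by (auto simp: minimizers_def K_def)
        then have "\<bar>s - r\<bar> \<le> h * norm (\<xi> s - \<xi> r)"
          using close[of "\<xi> s"] s(1) by (simp add: dist_norm)
        also have "\<dots> \<le> h * \<bar>\<psi> s - \<psi> r\<bar>"
        proof (rule mult_left_mono)
          show "norm (\<xi> s - \<xi> r) \<le> \<bar>\<psi> s - \<psi> r\<bar>"
            using norm_le[of s r] norm_le[of r s] s(2) r
            by (cases "s \<le> r") (auto simp: norm_minus_commute abs_minus_commute)
          show "0 \<le> h" using h norm_ge_zero[of "G z"] by linarith
        qed
        finally show "\<bar>s - r\<bar> \<le> h * \<bar>\<psi> s - \<psi> r\<bar>" .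
      qed
    qed
  qed
qed

end

section \<open>Global Picard iteration\<close>

lemma at_within_Icc_Ici:
  fixes t :: real
  assumes "t < T"
  shows "at t within {a..T} = at t within {a..}"
  by (rule at_within_nhd[where S = "{..<T}"]) (use assms in auto)

lemma indefinite_integral_has_vector_derivative_Ici:
  fixes g :: "real \<Rightarrow> 'a::banach"
  assumes g: "continuous_on {a..} g" and t: "a \<le> t"
  shows "((\<lambda>u. integral {a..u} g) has_vector_derivative g t) (at t within {a..})"
proof -
  have "((\<lambda>u. integral {a..u} g) has_vector_derivative g t) (at t within {a..t + 1})"
    using t by (intro integral_has_vector_derivative continuous_on_subset[OF g]) auto
  then show ?thesis using at_within_Icc_Ici[of t "t + 1" a] by simp
qed

lemma continuous_on_Ici:
  assumes "\<And>T. a \<le> T \<Longrightarrow> continuous_on {a..T} g"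
  shows "continuous_on {a::real..} g"
  unfolding continuous_on_eq_continuous_within
proof
  fix t assume t: "t \<in> {a..}"
  then have "continuous (at t within {a..t + 1}) g"
    using assms[of "t + 1"] by (auto simp: continuous_on_eq_continuous_within)
  then show "continuous (at t within {a..}) g" using at_within_Icc_Ici[of t "t + 1" a] by simp
qed

text \<open>The differences of successive iterates on \<open>[0, T]\<close> are at most
  \<open>M (|L| t)^n / n!\<close>, which is summable for every \<open>T\<close>. Convergence is thus
  uniform on each bounded interval with no restriction on its length, and the Lipschitz constant may
  depend on \<open>T\<close>.\<close>

theorem picard_global:
  fixes G :: "real \<Rightarrow> 'a::banach \<Rightarrow> 'a"
  assumes cont: "continuous_on ({0..} \<times> UNIV) (\<lambda>(t, w). G t w)"
    and lip: "\<And>T. 0 \<le> T \<Longrightarrow> \<exists>L. \<forall>t\<in>{0..T}. \<forall>w w'. norm (G t w - G t w') \<le> L * norm (w - w')"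
  obtains w where "w 0 = w0"
    "\<And>t. 0 \<le> t \<Longrightarrow> (w has_vector_derivative G t (w t)) (at t within {0..})"
proof -
  have contG: "continuous_on {0..} (\<lambda>s. G s (u s))" if "continuous_on {0..} u" for u
  proof -
    have "continuous_on {0..} ((\<lambda>(t, w). G t w) \<circ> (\<lambda>s. (s, u s)))"
      using that by (intro continuous_on_compose continuous_intros continuous_on_subset[OF cont]) auto
    then show ?thesis by (simp add: o_def)
  qed
  define W where "W = rec_nat (\<lambda>t. w0) (\<lambda>n u t. w0 + integral {0..t} (\<lambda>s. G s (u s)))"
  have W0: "W 0 = (\<lambda>t. w0)" and WSuc: "W (Suc n) = (\<lambda>t. w0 + integral {0..t} (\<lambda>s. G s (W n s)))" for n
    by (simp_all add: W_def)
  have contI: "continuous_on {0..} (\<lambda>t. integral {0..t} g)" if "continuous_on {0..} g" for g :: "real \<Rightarrow> 'a"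
    using indefinite_integral_has_vector_derivative_Ici[OF that]
    by (auto simp: continuous_on_eq_continuous_within intro: has_vector_derivative_continuous)
  have contW: "continuous_on {0..} (W n)" for n
    by (induction n) (auto simp: W0 WSuc intro!: continuous_intros contI contG)
  have int: "(\<lambda>s. G s (W n s)) integrable_on {0..t}" for n t
    by (intro integrable_continuous_real continuous_on_subset[OF contG[OF contW]]) auto
  \<comment> \<open>The limit is written as a telescoping series, to which the Weierstrass M-test
    applies.\<close>
  define w where "w t = w0 + (\<Sum>n. W (Suc n) t - W n t)" for t
  have unif: "uniform_limit {0..T} W w sequentially" if T: "0 \<le> T" for T
  proof -
    obtain L where "\<forall>t\<in>{0..T}. \<forall>w w'. norm (G t w - G t w') \<le> L * norm (w - w')"
      using lip[OF T] by blast
    then have L: "norm (G t w - G t w') \<le> \<bar>L\<bar> * norm (w - w')" if "t \<in> {0..T}" for t w w'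
      using that by (meson abs_ge_self mult_right_mono norm_ge_zero order_trans)
    have "bounded ((\<lambda>t. W (Suc 0) t - W 0 t) ` {0..T})"
      by (intro compact_imp_bounded compact_continuous_image continuous_intros
          continuous_on_subset[OF contW]) auto
    then obtain M where M: "0 < M" "\<And>t. t \<in> {0..T} \<Longrightarrow> norm (W (Suc 0) t - W 0 t) \<le> M"
      unfolding bounded_pos by auto
    have bound: "norm (W (Suc n) t - W n t) \<le> M * (\<bar>L\<bar> * t) ^ n / fact n" if "t \<in> {0..T}" for n t
      using that
    proof (induction n arbitrary: t)
      case 0
      then show ?case using M(2) by simp
    next
      case (Suc n)
      have der: "((\<lambda>s. s ^ Suc n / fact (Suc n)) has_real_derivative s ^ n / fact n) (at s within
          {0..t})" for s :: real
      proof -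
        have "((\<lambda>s. s ^ Suc n / fact (Suc n)) has_real_derivative (real (Suc n) * s ^ n) / fact (Suc
            n)) (at s within {0..t})"
          by (rule DERIV_cdivide) (use DERIV_pow[of "Suc n" s] in simp)
        moreover have "(real (Suc n) * s ^ n) / fact (Suc n) = s ^ n / fact n"
          using of_nat_neq_0[of n, where 'a = real] by (simp only: fact_Suc of_nat_mult) simp
        ultimately show ?thesis by (simp only:)
      qed
      have "((\<lambda>s. s ^ n / fact n) has_integral (t ^ Suc n / fact (Suc n) - 0 ^ Suc n / fact (Suc n))) {0..t}"
        using Suc.prems der
        by (intro fundamental_theorem_of_calculus) (auto simp flip:
            has_real_derivative_iff_has_vector_derivative)
      from has_integral_mult_right[OF this, of "M * \<bar>L\<bar> ^ Suc n"]
      have hi: "((\<lambda>s. M * \<bar>L\<bar> ^ Suc n * s ^ n / fact n) has_integral M * (\<bar>L\<bar> * t) ^ Suc n / fact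
          (Suc n)) {0..t}"
        by (simp add: power_mult_distrib mult_ac)
      have "W (Suc (Suc n)) t - W (Suc n) t = integral {0..t} (\<lambda>s. G s (W (Suc n) s) - G s (W n s))"
        unfolding WSuc[of "Suc n"] WSuc[of n] using integral_diff[OF int[of "Suc n" t] int[of n t]]
        by (simp add: WSuc)
      moreover have "norm (integral {0..t} (\<lambda>s. G s (W (Suc n) s) - G s (W n s))) \<le>
          integral {0..t} (\<lambda>s. M * \<bar>L\<bar> ^ Suc n * s ^ n / fact n)"
      proof (rule integral_norm_bound_integral)
        fix s assume s: "s \<in> {0..t}"
        with Suc.prems have sT: "s \<in> {0..T}" by auto
        have "norm (G s (W (Suc n) s) - G s (W n s)) \<le> \<bar>L\<bar> * norm (W (Suc n) s - W n s)"
          by (rule L[OF sT])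
        also have "\<dots> \<le> \<bar>L\<bar> * (M * (\<bar>L\<bar> * s) ^ n / fact n)"
          by (intro mult_left_mono Suc.IH sT) auto
        finally show "norm (G s (W (Suc n) s) - G s (W n s)) \<le> M * \<bar>L\<bar> ^ Suc n * s ^ n / fact n"
          by (simp add: power_mult_distrib mult_ac)
      qed (use hi int in \<open>auto intro: integrable_diff\<close>)
      ultimately show ?case unfolding integral_unique[OF hi] by (simp only:)
    qed
    have sm: "summable (\<lambda>n. M * ((\<bar>L\<bar> * T) ^ n / fact n))"
      by (intro summable_mult) (use summable_exp[of "\<bar>L\<bar> * T"] in \<open>simp add: field_simps\<close>)
    have "uniform_limit {0..T} (\<lambda>n t. \<Sum>i<n. W (Suc i) t - W i t) (\<lambda>t. \<Sum>i. W (Suc i) t - W i t) sequentially"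
    proof (rule Weierstrass_m_test[OF _ sm])
      fix n t assume t: "t \<in> {0..T}"
      then have "M * (\<bar>L\<bar> * t) ^ n / fact n \<le> M * (\<bar>L\<bar> * T) ^ n / fact n"
        using M(1) by (intro divide_right_mono mult_left_mono power_mono) auto
      then show "norm (W (Suc n) t - W n t) \<le> M * ((\<bar>L\<bar> * T) ^ n / fact n)"
        using bound[OF t, of n] by simp
    qed
    then have "uniform_limit {0..T} (\<lambda>n t. w0 + (\<Sum>i<n. W (Suc i) t - W i t)) w sequentially"
      unfolding w_def[abs_def] by (intro uniform_limit_intros)
    then show ?thesis
      using sum_lessThan_telescope[of "\<lambda>i. W i _"] by (simp add: W0)
  qed
  have contw: "continuous_on {0..} w"
    by (rule continuous_on_Ici, rule uniform_limit_theorem[OF _ unif])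
      (auto intro!: always_eventually continuous_on_subset[OF contW])
  have eq: "w t = w0 + integral {0..t} (\<lambda>s. G s (w s))" if t: "0 \<le> t" for t
  proof -
    obtain L where "\<forall>s\<in>{0..t}. \<forall>w w'. norm (G s w - G s w') \<le> L * norm (w - w')"
      using lip[OF t] by blast
    \<comment> \<open>Adding 1 makes the constant positive, so that \<open>e\<close> can be divided
      by it.\<close>
    then have L: "norm (G s w - G s w') \<le> (\<bar>L\<bar> + 1) * norm (w - w')" if "s \<in> {0..t}" for s w w'
      using that abs_ge_self[of L] by (smt (verit) mult_right_mono norm_ge_zero)
    have "uniform_limit {0..t} (\<lambda>n s. G s (W n s)) (\<lambda>s. G s (w s)) sequentially"
    proof (rule uniform_limitI)
      fix e :: real assume "e > 0"
      then have "e / (\<bar>L\<bar> + 1) > 0" by (simp add: add_nonneg_pos)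
      from uniform_limitD[OF unif[OF t] this]
      show "\<forall>\<^sub>F n in sequentially. \<forall>s\<in>{0..t}. dist (G s (W n s)) (G s (w s)) < e"
      proof eventually_elim
        case (elim n)
        show ?case
        proof
          fix s assume s: "s \<in> {0..t}"
          with elim have "(\<bar>L\<bar> + 1) * norm (W n s - w s) < e"
            by (simp add: dist_norm pos_less_divide_eq add_nonneg_pos mult.commute)
          with L[OF s] show "dist (G s (W n s)) (G s (w s)) < e"
            unfolding dist_norm by (rule order_le_less_trans)
        qed
      qed
    qed
    then obtain I J where IJ: "\<And>n. ((\<lambda>s. G s (W n s)) has_integral I n) {0..t}"
        "((\<lambda>s. G s (w s)) has_integral J) {0..t}" "I \<longlonglongrightarrow> J"
      by (rule uniform_limit_integral) (auto intro: continuous_on_subset[OF contG[OF contW]])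
    have "(\<lambda>n. W (Suc n) t) \<longlonglongrightarrow> w0 + J"
      unfolding WSuc integral_unique[OF IJ(1)] by (intro tendsto_intros IJ(3))
    moreover have "(\<lambda>n. W n t) \<longlonglongrightarrow> w t"
      using tendsto_uniform_limitI[OF unif[OF t]] t by simp
    ultimately have "w t = w0 + J" using LIMSEQ_Suc LIMSEQ_unique by blast
    with IJ(2) show ?thesis by (simp add: integral_unique)
  qed
  show thesis
  proof (rule that)
    show "w 0 = w0" using eq[of 0] by simp
    fix t :: real assume t: "0 \<le> t"
    have "((\<lambda>t. w0 + integral {0..t} (\<lambda>s. G s (w s))) has_vector_derivative G t (w t)) (at t within {0..})"
      using indefinite_integral_has_vector_derivative_Ici[OF contG[OF contw] t]
      by (auto intro!: derivative_eq_intros)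
    then show "(w has_vector_derivative G t (w t)) (at t within {0..})"
      by (rule has_vector_derivative_transform[rotated 2]) (use t eq in auto)
  qed
qed

section \<open>Limits and integrals on half-lines\<close>

lemma mono_bounded_tendsto_at_top:
  fixes h :: "real \<Rightarrow> real"
  assumes mono: "\<And>s t. a \<le> s \<Longrightarrow> s \<le> t \<Longrightarrow> h s \<le> h t" and bd: "\<And>t. a \<le> t \<Longrightarrow> h t \<le> B"
  obtains l where "(h \<longlongrightarrow> l) at_top" "\<And>t. a \<le> t \<Longrightarrow> h t \<le> l"
proof -
  let ?l = "SUP t\<in>{a..}. h t"
  have bdd: "bdd_above (h ` {a..})" using bd by (auto intro!: bdd_aboveI2)
  have le: "h t \<le> ?l" if "a \<le> t" for t using that bdd by (intro cSUP_upper) auto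
  have "(h \<longlongrightarrow> ?l) at_top"
  proof (rule order_tendstoI)
    fix y assume "y < ?l"
    then obtain s where "s \<ge> a" "y < h s" using less_cSUP_iff[OF _ bdd] by auto
    then have "\<forall>t\<ge>s. y < h t" using mono by (meson less_le_trans)
    then show "\<forall>\<^sub>F t in at_top. y < h t" unfolding eventually_at_top_linorder by blast
  next
    fix y assume "?l < y"
    then have "\<forall>t\<ge>a. h t < y" using le by (meson le_less_trans)
    then show "\<forall>\<^sub>F t in at_top. h t < y" unfolding eventually_at_top_linorder by blast
  qed
  with le that show thesis by blast
qed

lemma integral_Icc_mono:
  fixes h :: "real \<Rightarrow> real"
  assumes h: "continuous_on {a..} h" "\<And>t. a \<le> t \<Longrightarrow> 0 \<le> h t" and st: "s \<le> t"
  shows "integral {a..s} h \<le> integral {a..t} h"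
  by (intro integral_subset_le integrable_continuous_real continuous_on_subset[OF h(1)]) (use h st in auto)

lemma integrable_on_Ici_if_bounded:
  fixes h :: "real \<Rightarrow> real"
  assumes h: "continuous_on {a..} h" "\<And>t. a \<le> t \<Longrightarrow> 0 \<le> h t"
    and B: "\<And>t. a \<le> t \<Longrightarrow> integral {a..t} h \<le> B"
  shows "h integrable_on {a..}"
proof -
  obtain l where "((\<lambda>t. integral {a..t} h) \<longlongrightarrow> l) at_top"
    by (rule mono_bounded_tendsto_at_top[of a "\<lambda>t. integral {a..t} h" B])
      (auto intro: integral_Icc_mono[OF h] B)
  then have "(h has_integral l) {a..}"
    by (rule has_integral_to_inf[rotated])
      (use h in \<open>auto intro!: integrable_continuous_real continuous_on_subset[OF h(1)]\<close>)
  then show ?thesis by blast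
qed

text \<open>If \<open>norm (u t)\<close> is at least \<open>e\<close>, it stays above
  \<open>e / 2\<close> for a time \<open>d\<close> that depends only on \<open>e\<close> and
  \<open>K\<close>, and adds at least \<open>(e / 2)\<^sup>2 * d\<close> to the integral. Late in
  time the convergent integral has less than that left to gain.\<close>

lemma barbalat:
  fixes u :: "real \<Rightarrow> 'a::real_normed_vector"
  assumes lip: "\<And>s t. 0 \<le> s \<Longrightarrow> 0 \<le> t \<Longrightarrow> norm (u s - u t) \<le> K * \<bar>s - t\<bar>"
    and cont: "continuous_on {0..} u"
    and B: "\<And>t. 0 \<le> t \<Longrightarrow> integral {0..t} (\<lambda>s. (norm (u s))\<^sup>2) \<le> B"
  shows "((\<lambda>t. norm (u t)) \<longlongrightarrow> 0) at_top"
proof -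
  let ?h = "\<lambda>s. (norm (u s))\<^sup>2"
  have h: "continuous_on {0..} ?h" by (intro continuous_intros cont)
  have int: "?h integrable_on {s..t}" if "0 \<le> s" for s t
    using that by (intro integrable_continuous_real continuous_on_subset[OF h]) auto
  obtain l where l: "((\<lambda>t. integral {0..t} ?h) \<longlongrightarrow> l) at_top" "\<And>t. 0 \<le> t \<Longrightarrow> integral {0..t} ?h \<le> l"
    by (rule mono_bounded_tendsto_at_top[of 0 "\<lambda>t. integral {0..t} ?h" B])
      (auto intro: integral_Icc_mono[OF h] B)
  \<comment> \<open>The maximum with 1 provides a positive constant to divide by, whatever the sign
    of \<open>K\<close>.\<close>
  define K' where "K' = max K 1"
  have K': "K' > 0" "K \<le> K'" by (auto simp: K'_def)
  have "\<forall>\<^sub>F t in at_top. norm (u t) < e" if e: "e > 0" for e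
  proof -
    define d where "d = e / (2 * K')"
    have d: "d > 0" using e K' by (simp add: d_def)
    have "l - (e / 2)\<^sup>2 * d < l" using e d by simp
    from order_tendstoD(1)[OF l(1) this] eventually_ge_at_top[of 0]
    show ?thesis
    proof eventually_elim
      fix t :: real assume t: "l - (e / 2)\<^sup>2 * d < integral {0..t} ?h" "0 \<le> t"
      show "norm (u t) < e"
      proof (rule ccontr)
        assume big: "\<not> norm (u t) < e"
        have "(e / 2)\<^sup>2 \<le> ?h s" if s: "s \<in> {t..t + d}" for s
        proof (rule power_mono)
          have "norm (u t - u s) \<le> K * \<bar>t - s\<bar>" by (rule lip) (use s t in auto)
          also have "\<dots> \<le> K' * d" using s K' by (intro mult_mono) auto
          also have "\<dots> = e / 2" using K' by (simp add: d_def)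
          finally show "e / 2 \<le> norm (u s)"
            using big norm_triangle_sub[of "u t" "u s"] by simp
        qed (use e in auto)
        then have "integral {t..t + d} (\<lambda>s. (e / 2)\<^sup>2) \<le> integral {t..t + d} ?h"
          using t(2) by (intro integral_le int) auto
        then have "(e / 2)\<^sup>2 * d \<le> integral {t..t + d} ?h" using d by (simp add: mult.commute)
        moreover have "integral {0..t} ?h + integral {t..t + d} ?h = integral {0..t + d} ?h"
          using t(2) d by (intro Henstock_Kurzweil_Integration.integral_combine int) auto
        ultimately show False using l(2)[of "t + d"] t d by linarith
      qed
    qed
  qed
  then show ?thesis by (intro tendstoI) simp
qed

text \<open>For fixed slack \<open>e\<close>, the points \<open>s\<close> with
  \<open>\<Phi> a - e * (s - a) \<le> \<Phi> s\<close> form a closed set that continues to the right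
  of each of its points below \<open>b\<close>, so its supremum is \<open>b\<close>. Only one-sided
  difference inequalities enter, which suits a \<open>\<Phi>\<close> built from the continuous
  monotone function \<open>\<psi>\<close>.\<close>

lemma nondecreasing_if_lower_dini_nonneg:
  fixes \<Phi> :: "real \<Rightarrow> real"
  assumes ab: "a \<le> b" and cont: "continuous_on {a..b} \<Phi>"
    and dini: "\<And>t e. a \<le> t \<Longrightarrow> t < b \<Longrightarrow> 0 < e \<Longrightarrow> \<forall>\<^sub>F s in at_right t. \<Phi> t - e * (s - t) \<le> \<Phi> s"
  shows "\<Phi> a \<le> \<Phi> b"
proof (rule field_le_epsilon)
  fix e' :: real assume e': "0 < e'"
  \<comment> \<open>The summand 1 keeps the divisor positive when \<open>a = b\<close>.\<close>
  define e where "e = e' / (b - a + 1)"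
  have e: "e > 0" using e' ab by (simp add: e_def)
  define A where "A = {s \<in> {a..b}. \<Phi> a - e * (s - a) \<le> \<Phi> s}"
  have "closed A" unfolding A_def
    by (intro continuous_on_closed_Collect_le continuous_intros cont)
  have aA: "a \<in> A" using ab by (simp add: A_def)
  have bdd: "bdd_above A" by (auto simp: A_def intro!: bdd_aboveI[of _ b])
  define s0 where "s0 = Sup A"
  have s0A: "s0 \<in> A" unfolding s0_def by (rule closed_contains_Sup) (use aA bdd \<open>closed A\<close> in auto)
  have "s0 = b"
  proof (rule ccontr)
    assume "s0 \<noteq> b"
    then have s0: "a \<le> s0" "s0 < b" using s0A by (auto simp: A_def)
    obtain c where c: "c > s0" "\<And>s. s0 < s \<Longrightarrow> s < c \<Longrightarrow> \<Phi> s0 - e * (s - s0) \<le> \<Phi> s"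
      using dini[OF s0 e] by (auto simp: eventually_at_right_field)
    obtain s where s: "s0 < s" "s < min c b" using dense[of s0 "min c b"] c s0 by auto
    have "\<Phi> a - e * (s0 - a) \<le> \<Phi> s0" using s0A by (simp add: A_def)
    with c(2)[of s] s have "\<Phi> a - e * (s - a) \<le> \<Phi> s" by (simp add: algebra_simps)
    then have "s \<in> A" using s s0 by (simp add: A_def)
    then have "s \<le> s0" unfolding s0_def by (rule cSup_upper[OF _ bdd])
    with s show False by simp
  qed
  with s0A have "\<Phi> a - e * (b - a) \<le> \<Phi> b" by (simp add: A_def)
  moreover have "e * (b - a) \<le> e'"
  proof -
    have "e * (b - a) \<le> e * (b - a + 1)" using e by (simp add: algebra_simps)
    also have "\<dots> = e'" using ab by (simp add: e_def)
    finally show ?thesis .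
  qed
  ultimately show "\<Phi> a \<le> \<Phi> b + e'" by simp
qed

lemma norm_diff_le_if_derivative_bounded:
  fixes x :: "real \<Rightarrow> 'a::banach"
  assumes st: "s \<le> t" and x: "\<And>r. r \<in> {s..t} \<Longrightarrow> (x has_vector_derivative v r) (at r within {s..t})"
    and B: "\<And>r. r \<in> {s..t} \<Longrightarrow> norm (v r) \<le> B"
  shows "norm (x t - x s) \<le> B * (t - s)"
proof -
  have "0 \<le> B" by (rule order_trans[OF norm_ge_zero B[of s]]) (use st in simp)
  moreover have "(v has_integral (x t - x s)) (cbox s t)"
    using fundamental_theorem_of_calculus[OF st x] by simp
  ultimately have "norm (x t - x s) \<le> B * measure lborel (cbox s t)"
    using B by (rule has_integral_bound) auto
  then show ?thesis using st by simp
qed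

lemma absolutely_integrable_on_Ici_if_bounded:
  fixes v :: "real \<Rightarrow> 'a::euclidean_space"
  assumes v: "continuous_on {a..} v"
    and B: "\<And>t. a \<le> t \<Longrightarrow> integral {a..t} (\<lambda>s. norm (v s)) \<le> B"
  shows "v absolutely_integrable_on {a..}"
proof -
  have norm: "(\<lambda>s. norm (v s)) integrable_on {a..}"
    by (rule integrable_on_Ici_if_bounded[OF _ _ B]) (auto intro: continuous_on_norm v)
  moreover have "v integrable_on {a..}"
  proof (rule integrable_on_all_intervals_integrable_bound[OF _ _ norm])
    fix p q :: real
    have "v integrable_on {max a p..q}"
      by (intro integrable_continuous_real continuous_on_subset[OF v]) auto
    moreover have "{max a p..q} = {a..} \<inter> cbox p q" by auto
    ultimately have "v integrable_on {a..} \<inter> cbox p q" by (simp only:)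
    then show "(\<lambda>s. if s \<in> {a..} then v s else 0) integrable_on cbox p q"
      by (simp only: integrable_restrict_Int)
  qed simp
  ultimately show ?thesis by (simp add: absolutely_integrable_on_def)
qed

text \<open>Adding the arc length \<open>J\<close> to a coordinate makes it nondecreasing. Both
  \<open>J\<close> and the sum are monotone and bounded, so the coordinate converges as their
  difference.\<close>

lemma tendsto_at_top_if_length_bounded:
  fixes x :: "real \<Rightarrow> real^'n"
  assumes v: "continuous_on {0..} v"
    and x: "\<And>t. 0 \<le> t \<Longrightarrow> (x has_vector_derivative v t) (at t within {0..})"
    and B: "\<And>t. 0 \<le> t \<Longrightarrow> integral {0..t} (\<lambda>s. norm (v s)) \<le> B"
  obtains u where "(x \<longlongrightarrow> u) at_top"
proof -
  define J where "J t = integral {0..t} (\<lambda>s. norm (v s))" for t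
  have nv: "continuous_on {0..} (\<lambda>s. norm (v s))" by (intro continuous_on_norm v)
  have dist_le: "norm (x t - x s) \<le> J t - J s" if st: "0 \<le> s" "s \<le> t" for s t
  proof -
    have int: "(\<lambda>s. norm (v s)) integrable_on {p..q}" if "0 \<le> p" for p q
      using that by (intro integrable_continuous_real continuous_on_subset[OF nv]) auto
    have "(v has_integral (x t - x s)) {s..t}"
      using st by (intro fundamental_theorem_of_calculus has_vector_derivative_within_subset[OF x]) auto
    then have "norm (x t - x s) \<le> integral {s..t} (\<lambda>s. norm (v s))"
      using integral_norm_bound_integral[of v "{s..t}" "\<lambda>s. norm (v s)"] int st
      by (auto simp: has_integral_iff)
    also have "\<dots> = J t - J s"
      using Henstock_Kurzweil_Integration.integral_combine[of 0 s t, OF st int[of 0 t]]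
      by (simp add: J_def)
    finally show ?thesis .
  qed
  have J0: "J 0 = 0" by (simp add: J_def)
  have JB: "J t \<le> B" if "0 \<le> t" for t using B[OF that] by (simp add: J_def)
  have J_mono: "J s \<le> J t" if "0 \<le> s" "s \<le> t" for s t
    using dist_le[OF that] norm_ge_zero[of "x t - x s"] by linarith
  obtain j where j: "(J \<longlongrightarrow> j) at_top"
    by (rule mono_bounded_tendsto_at_top[of 0 J B, OF J_mono JB])
  have "\<exists>l. ((\<lambda>t. x t $ i) \<longlongrightarrow> l) at_top" for i
  proof -
    have comp: "\<bar>x t $ i - x s $ i\<bar> \<le> J t - J s" if "0 \<le> s" "s \<le> t" for s t
      using component_le_norm_cart[of "x t - x s" i] dist_le[OF that] by simp
    have mono: "J s + x s $ i \<le> J t + x t $ i" if "0 \<le> s" "s \<le> t" for s t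
      using comp[OF that] by linarith
    have bd: "J t + x t $ i \<le> 2 * B + x 0 $ i" if "0 \<le> t" for t
      using comp[of 0 t] JB[OF that] J0 that by auto
    obtain l where "((\<lambda>t. J t + x t $ i) \<longlongrightarrow> l) at_top"
      by (rule mono_bounded_tendsto_at_top[of 0 "\<lambda>t. J t + x t $ i" "2 * B + x 0 $ i", OF mono bd])
    from tendsto_diff[OF this j] show ?thesis by auto
  qed
  then have "\<forall>i. \<exists>l. ((\<lambda>t. x t $ i) \<longlongrightarrow> l) at_top" by blast
  from choice[OF this] obtain l where "\<And>i. ((\<lambda>t. x t $ i) \<longlongrightarrow> l i) at_top" by blast
  then have "(x \<longlongrightarrow> (\<chi> i. l i)) at_top" by (intro vec_tendstoI) simp
  with that show thesis by blast
qed

section \<open>Energy estimates and global existence\<close>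

lemma C2_imp_GDERIV: "C2 f \<Longrightarrow> GDERIV f u :> grad f u"
  by (auto simp: C2_def)

lemma C2_imp_continuous_on_grad:
  assumes "C2 f" shows "continuous_on S (grad f)"
  using assms unfolding C2_def
  by (blast intro: continuous_at_imp_continuous_on has_derivative_continuous)

lemma C2_imp_continuous_on:
  assumes "C2 f" shows "continuous_on S f"
  using C2_imp_GDERIV[OF assms] unfolding gderiv_def
  by (blast intro: continuous_at_imp_continuous_on has_derivative_continuous)

text \<open>The second derivative is bounded on the compact ball, and convexity of the ball allows
  the mean value inequality.\<close>

lemma C2_imp_grad_lipschitz_on_ball:
  fixes f :: "real^'d \<Rightarrow> real"
  assumes "C2 f"
  obtains L where "0 \<le> L"
    "\<And>u w. norm u \<le> R \<Longrightarrow> norm w \<le> R \<Longrightarrow> norm (grad f u - grad f w) \<le> L * norm (u - w)"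
proof -
  obtain H :: "real^'d \<Rightarrow> (real^'d) \<Rightarrow>\<^sub>L (real^'d)" where H: "continuous_on UNIV H"
    "\<And>u. (grad f has_derivative blinfun_apply (H u)) (at u)"
    using assms unfolding C2_def by blast
  have "bounded (H ` cball 0 R)"
    by (intro compact_imp_bounded compact_continuous_image continuous_on_subset[OF H(1)]) auto
  then obtain L where L: "0 < L" "\<And>u. u \<in> cball 0 R \<Longrightarrow> norm (H u) \<le> L"
    unfolding bounded_pos by blast
  have "norm (grad f u - grad f w) \<le> L * norm (u - w)" if "norm u \<le> R" "norm w \<le> R" for u w
  proof (rule differentiable_bound[of "cball 0 R"])
    show "(grad f has_derivative blinfun_apply (H z)) (at z within cball 0 R)" for z
      using H(2) by (rule has_derivative_at_withinI)
    show "onorm (blinfun_apply (H z)) \<le> L" if "z \<in> cball 0 R" for z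
      using L(2)[OF that] by (simp add: norm_blinfun.rep_eq)
  qed (use that in auto)
  with L(1) that[of L] show thesis by auto
qed

text \<open>Clipping each coordinate is nonexpansive, fixes the ball of radius \<open>R\<close>, has
  bounded range, and is jointly continuous in \<open>R\<close> and \<open>y\<close>, as a
  time-dependent radius requires.\<close>

definition truncate :: "real \<Rightarrow> real^'n \<Rightarrow> real^'n" where
  "truncate R y = (\<chi> i. max (- R) (min R (y $ i)))"

lemma truncate_id: "norm y \<le> R \<Longrightarrow> truncate R y = y"
proof -
  assume "norm y \<le> R"
  then have "y $ i \<le> R" "- R \<le> y $ i" for i using component_le_norm_cart[of y i] by linarith+
  then show ?thesis by (simp add: truncate_def vec_eq_iff min_absorb2 max_absorb2)
qed

lemma norm_truncate_diff_le: "norm (truncate R y - truncate R y') \<le> norm (y - y')"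
  by (rule norm_le_componentwise_cart) (simp add: truncate_def)

lemma norm_truncate_le:
  fixes y :: "real^'n"
  assumes "0 \<le> R" "R \<le> R'" shows "norm (truncate R y) \<le> real CARD('n) * R'"
proof -
  have "norm (truncate R y) \<le> (\<Sum>i\<in>UNIV. \<bar>truncate R y $ i\<bar>)" by (rule norm_le_l1_cart)
  also have "\<dots> \<le> (\<Sum>i\<in>(UNIV :: 'n set). R')"
    using assms by (intro sum_mono) (auto simp: truncate_def)
  finally show ?thesis by simp
qed

lemma continuous_on_truncate:
  "continuous_on S r \<Longrightarrow> continuous_on S y \<Longrightarrow> continuous_on S (\<lambda>p. truncate (r p) (y p))"
  unfolding truncate_def by (intro continuous_intros)

section \<open>Dissipation, decay of the energy and global existence\<close>

locale isihd =
  fixes f :: "real^'d \<Rightarrow> real" and \<gamma> :: "real \<Rightarrow> real" and c C \<beta> :: real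
  assumes f_C2: "C2 f"
    and f_below: "bdd_below (range f)"
    and \<gamma>_cont: "continuous_on {0..} \<gamma>"
    and c_pos: "0 < c" and c_le_C: "c \<le> C"
    and \<gamma>_bounds: "\<And>t. t \<ge> 0 \<Longrightarrow> c \<le> \<gamma> t \<and> \<gamma> t \<le> C"
    and \<beta>_pos: "0 < \<beta>" and \<beta>_small: "\<beta> < 2 * c / C^2"
begin

text \<open>The coercivity constant of the dissipation form: completing the square spends half of
  the damping on \<open>v\<close> and at most the fraction \<open>\<beta> * C / 2\<close> of the
  gradient term. It is positive because \<open>\<beta> * C < 2\<close>.\<close>

definition \<delta> :: real where "\<delta> = min (c / 2) (\<beta> * (1 - \<beta> * C / 2))"

lemma C_pos: "0 < C" using c_pos c_le_C by simp

lemma \<beta>C_less: "\<beta> * C < 2"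
proof -
  have "\<beta> * C\<^sup>2 < 2 * c" using \<beta>_small C_pos by (simp add: pos_less_divide_eq)
  also have "\<dots> \<le> 2 * C" using c_le_C by simp
  finally have "(\<beta> * C) * C < 2 * C" by (simp add: power2_eq_square mult.assoc)
  then show ?thesis using C_pos by simp
qed

lemma \<delta>_pos: "0 < \<delta>"
  using c_pos \<beta>_pos \<beta>C_less by (simp add: \<delta>_def)

text \<open>The right-hand side equals
  \<open>k / 2 * (norm (v + \<beta> *\<^sub>R g))\<^sup>2\<close> plus \<open>k / 2 * (norm
  v)\<^sup>2 + \<beta> * (1 - \<beta> * k / 2) * (norm g)\<^sup>2\<close>. Dropping the square
  removes the mixed term.\<close>

lemma dissipation:
  fixes g v :: "'a::real_inner"
  assumes k: "c \<le> k" "k \<le> C"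
  shows "\<delta> * ((norm v)\<^sup>2 + (norm g)\<^sup>2) \<le> k * (norm v)\<^sup>2 + \<beta> * k * (g \<bullet> v) + \<beta> * (norm g)\<^sup>2"
proof -
  have k0: "0 < k" using k c_pos by simp
  have "0 \<le> (norm (v + \<beta> *\<^sub>R g))\<^sup>2" by simp
  then have "0 \<le> (norm v)\<^sup>2 + 2 * \<beta> * (g \<bullet> v) + \<beta>\<^sup>2 * (norm g)\<^sup>2"
    unfolding power2_norm_eq_inner
    by (simp add: inner_commute[of v g] algebra_simps power2_eq_square)
  then have "0 \<le> k / 2 * ((norm v)\<^sup>2 + 2 * \<beta> * (g \<bullet> v) + \<beta>\<^sup>2 * (norm g)\<^sup>2)"
    using k0 by (intro mult_nonneg_nonneg) auto
  also have "\<dots> = k / 2 * (norm v)\<^sup>2 + \<beta> * k * (g \<bullet> v) + \<beta> * (\<beta> * k / 2) * (norm g)\<^sup>2"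
    by (simp add: algebra_simps power2_eq_square)
  finally have "k / 2 * (norm v)\<^sup>2 + \<beta> * (1 - \<beta> * k / 2) * (norm g)\<^sup>2
      \<le> k * (norm v)\<^sup>2 + \<beta> * k * (g \<bullet> v) + \<beta> * (norm g)\<^sup>2"
    by (simp add: algebra_simps)
  moreover have "\<delta> * (norm v)\<^sup>2 \<le> k / 2 * (norm v)\<^sup>2"
    using k by (intro mult_right_mono) (auto simp: \<delta>_def)
  moreover have "\<delta> * (norm g)\<^sup>2 \<le> \<beta> * (1 - \<beta> * k / 2) * (norm g)\<^sup>2"
  proof (intro mult_right_mono)
    have "\<delta> \<le> \<beta> * (1 - \<beta> * C / 2)" by (simp add: \<delta>_def)
    also have "\<dots> \<le> \<beta> * (1 - \<beta> * k / 2)" using k \<beta>_pos by (intro mult_left_mono) auto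
    finally show "\<delta> \<le> \<beta> * (1 - \<beta> * k / 2)" .
  qed simp
  ultimately show ?thesis by (simp add: algebra_simps)
qed

definition energy :: "real^'d \<Rightarrow> real^'d \<Rightarrow> real" where
  "energy x v = f (x + \<beta> *\<^sub>R v) + (norm v)\<^sup>2 / 2"

lemma energy_has_derivative:
  assumes x: "(x has_vector_derivative v t) (at t within J)"
    and v: "(v has_vector_derivative - k *\<^sub>R v t - grad f (x t + \<beta> *\<^sub>R v t)) (at t within J)"
  shows "((\<lambda>t. energy (x t) (v t)) has_real_derivative
    - (k * (norm (v t))\<^sup>2 + \<beta> * k * (grad f (x t + \<beta> *\<^sub>R v t) \<bullet> v t)
        + \<beta> * (norm (grad f (x t + \<beta> *\<^sub>R v t)))\<^sup>2)) (at t within J)"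
proof -
  let ?g = "grad f (x t + \<beta> *\<^sub>R v t)"
  let ?a = "- k *\<^sub>R v t - ?g"
  have y: "((\<lambda>t. x t + \<beta> *\<^sub>R v t) has_vector_derivative v t + \<beta> *\<^sub>R ?a) (at t within J)"
    by (intro has_vector_derivative_add x
        bounded_linear.has_vector_derivative[OF bounded_linear_scaleR_right] v)
  have fd: "(f has_derivative (\<lambda>h. h \<bullet> ?g)) (at (x t + \<beta> *\<^sub>R v t) within (\<lambda>t. x t + \<beta> *\<^sub>R v t) ` J)"
    using C2_imp_GDERIV[OF f_C2] unfolding gderiv_def by (rule has_derivative_at_withinI)
  have "((f \<circ> (\<lambda>t. x t + \<beta> *\<^sub>R v t)) has_vector_derivative (v t + \<beta> *\<^sub>R ?a) \<bullet> ?g) (at t within J)"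
    by (rule vector_derivative_diff_chain_within[OF y fd])
  then have "((\<lambda>t. f (x t + \<beta> *\<^sub>R v t)) has_vector_derivative (v t + \<beta> *\<^sub>R ?a) \<bullet> ?g) (at t within J)"
    by (simp add: o_def)
  moreover have "((\<lambda>t. v t \<bullet> v t) has_vector_derivative (v t \<bullet> ?a + ?a \<bullet> v t)) (at t within J)"
    by (rule bounded_bilinear.has_vector_derivative[OF bounded_bilinear_inner v v])
  ultimately have "((\<lambda>t. f (x t + \<beta> *\<^sub>R v t) + (v t \<bullet> v t) / 2) has_vector_derivative
      ((v t + \<beta> *\<^sub>R ?a) \<bullet> ?g + (v t \<bullet> ?a + ?a \<bullet> v t) / 2)) (at t within J)"
    by (intro has_vector_derivative_add has_vector_derivative_divide)
  \<comment> \<open>The products of \<open>v t\<close> and \<open>?g\<close> coming from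
    \<open>f\<close> and from the kinetic energy cancel; the mixed term that remains comes from
    \<open>\<beta> *\<^sub>R ?a\<close>.\<close>
  moreover have "(v t + \<beta> *\<^sub>R ?a) \<bullet> ?g + (v t \<bullet> ?a + ?a \<bullet> v t) / 2 =
      - (k * (norm (v t))\<^sup>2 + \<beta> * k * (?g \<bullet> v t) + \<beta> * (norm ?g)\<^sup>2)"
    by (simp add: power2_norm_eq_inner inner_add inner_diff inner_commute algebra_simps
        add_divide_distrib diff_divide_distrib)
  ultimately show ?thesis
    by (simp add: energy_def power2_norm_eq_inner has_real_derivative_iff_has_vector_derivative)
qed

lemma energy_decay:
  assumes st: "0 \<le> s" "s \<le> t"
    and x: "\<And>r. r \<in> {s..t} \<Longrightarrow> (x has_vector_derivative v r) (at r within {s..t})"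
    and v: "\<And>r. r \<in> {s..t} \<Longrightarrow>
      (v has_vector_derivative - \<gamma> r *\<^sub>R v r - grad f (x r + \<beta> *\<^sub>R v r)) (at r within {s..t})"
  shows "energy (x t) (v t) +
    \<delta> * integral {s..t} (\<lambda>r. (norm (v r))\<^sup>2 + (norm (grad f (x r + \<beta> *\<^sub>R v r)))\<^sup>2) \<le> energy (x s) (v s)"
    and "energy (x t) (v t) \<le> energy (x s) (v s)"
proof -
  let ?g = "\<lambda>r. grad f (x r + \<beta> *\<^sub>R v r)"
  let ?D = "\<lambda>r. (norm (v r))\<^sup>2 + (norm (?g r))\<^sup>2"
  let ?E' = "\<lambda>r. - (\<gamma> r * (norm (v r))\<^sup>2 + \<beta> * \<gamma> r * (?g r \<bullet> v r) + \<beta> * (norm (?g r))\<^sup>2)"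
  have E': "(?E' has_integral (energy (x t) (v t) - energy (x s) (v s))) {s..t}"
    using energy_has_derivative[OF x v] st
    by (intro fundamental_theorem_of_calculus)
      (auto simp: has_real_derivative_iff_has_vector_derivative)
  have int: "?D integrable_on {s..t}"
  proof (rule integrable_continuous_real)
    have cx: "continuous_on {s..t} x" by (rule continuous_on_vector_derivative, rule x)
    have cv: "continuous_on {s..t} v" by (rule continuous_on_vector_derivative, rule v)
    have "continuous_on {s..t} ?g"
      by (rule continuous_on_compose2[OF C2_imp_continuous_on_grad[OF f_C2, of UNIV]])
        (auto intro!: continuous_intros cx cv)
    with cv show "continuous_on {s..t} ?D" by (intro continuous_intros)
  qed
  have D: "((\<lambda>r. - (\<delta> * ?D r)) has_integral - (\<delta> * integral {s..t} ?D)) {s..t}"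
    by (intro has_integral_neg has_integral_mult_right integrable_integral int)
  have "energy (x t) (v t) - energy (x s) (v s) \<le> - (\<delta> * integral {s..t} ?D)"
  proof (rule has_integral_le[OF E' D])
    fix r assume "r \<in> {s..t}"
    then have "c \<le> \<gamma> r \<and> \<gamma> r \<le> C" using st by (intro \<gamma>_bounds) auto
    then show "?E' r \<le> - (\<delta> * ?D r)" using dissipation[of "\<gamma> r" "v r" "?g r"] by simp
  qed
  then show main: "energy (x t) (v t) + \<delta> * integral {s..t} ?D \<le> energy (x s) (v s)" by simp
  have "0 \<le> \<delta> * integral {s..t} ?D"
    using \<delta>_pos int by (intro mult_nonneg_nonneg Henstock_Kurzweil_Integration.integral_nonneg) auto
  with main show "energy (x t) (v t) \<le> energy (x s) (v s)" by linarith
qed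

text \<open>A speed bound: when the energy does not exceed its initial value, the kinetic part is at
  most that value minus the infimum of \<open>f\<close>.\<close>

definition V :: "real^'d \<Rightarrow> real^'d \<Rightarrow> real" where
  "V x0 v0 = sqrt (2 * (energy x0 v0 - (INF u. f u)))"

lemma energy_ge: "(INF u. f u) + (norm v)\<^sup>2 / 2 \<le> energy x v"
  unfolding energy_def using cINF_lower[OF f_below, of "x + \<beta> *\<^sub>R v"] by simp

lemma norm_le_V:
  assumes "energy x v \<le> energy x0 v0" shows "norm v \<le> V x0 v0"
proof -
  have "(norm v)\<^sup>2 \<le> 2 * (energy x0 v0 - (INF u. f u))" using energy_ge[of v x] assms by simp
  then show ?thesis unfolding V_def by (rule real_le_rsqrt)
qed

text \<open>Truncating the argument of the gradient at a radius that grows faster than any trajectory of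
  bounded energy makes the right-hand side globally Lipschitz without changing the solution.\<close>
lemma global_solution:
  obtains x v where "x 0 = x0" "v 0 = v0"
    "\<And>t. 0 \<le> t \<Longrightarrow> (x has_vector_derivative v t) (at t within {0..})"
    "\<And>t. 0 \<le> t \<Longrightarrow>
      (v has_vector_derivative - \<gamma> t *\<^sub>R v t - grad f (x t + \<beta> *\<^sub>R v t)) (at t within {0..})"
proof -
  define W where "W = V x0 v0"
  have W0: "norm v0 \<le> W" unfolding W_def by (rule norm_le_V[of x0]) simp
  then have W: "0 \<le> W" using norm_ge_zero order_trans by blast
  \<comment> \<open>While the speed is at most \<open>W\<close>, the position is bounded by
    \<open>norm x0 + W * t\<close> and the shift by \<open>\<beta> * W\<close>; the final 1 is the
    margin for the continuation argument.\<close>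
  define R where "R t = norm x0 + W * t + \<beta> * W + 1" for t
  have R_mono: "0 \<le> R t" "R t \<le> R T" if "0 \<le> t" "t \<le> T" for t T
    using that W \<beta>_pos by (auto simp: R_def mult_left_mono)
  define G where "G t w = (snd w, - \<gamma> t *\<^sub>R snd w - grad f (truncate (R t) (fst w + \<beta> *\<^sub>R snd w)))"
    for t and w :: "(real^'d) \<times> (real^'d)"
  have "continuous_on ({0..} \<times> UNIV) (\<lambda>p. \<gamma> (fst p))"
    by (rule continuous_on_compose2[OF \<gamma>_cont]) (auto intro!: continuous_intros)
  moreover have "continuous_on ({0..} \<times> UNIV)
      (\<lambda>p. grad f (truncate (R (fst p)) (fst (snd p) + \<beta> *\<^sub>R snd (snd p))))"
    by (rule continuous_on_compose2[OF C2_imp_continuous_on_grad[OF f_C2, of UNIV]])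
      (auto simp: R_def intro!: continuous_intros continuous_on_truncate)
  ultimately have contG: "continuous_on ({0..} \<times> UNIV) (\<lambda>(t, w). G t w)"
    unfolding G_def case_prod_unfold by (intro continuous_intros)
  have lipG: "\<exists>L. \<forall>t\<in>{0..T}. \<forall>w w'. norm (G t w - G t w') \<le> L * norm (w - w')" if T: "0 \<le> T" for T
  proof -
    \<comment> \<open>A cube of half-width \<open>R t\<close> with \<open>t\<close> at most
      \<open>T\<close> lies in the ball of radius \<open>CARD('d) * R T\<close>, so one Lipschitz
      constant serves the whole interval.\<close>
    obtain L where L: "0 \<le> L" "\<And>u w. norm u \<le> real CARD('d) * R T \<Longrightarrow> norm w \<le> real CARD('d) * R T \<Longrightarrow>
        norm (grad f u - grad f w) \<le> L * norm (u - w)"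
      using C2_imp_grad_lipschitz_on_ball[OF f_C2] by blast
    have "norm (G t w - G t w') \<le> (1 + C + L * (1 + \<beta>)) * norm (w - w')" if t: "t \<in> {0..T}" for t w w'
    proof -
      let ?P = "\<lambda>w. truncate (R t) (fst w + \<beta> *\<^sub>R snd w)"
      let ?n = "norm (w - w')"
      have n1: "norm (fst w - fst w') \<le> ?n" and n2: "norm (snd w - snd w') \<le> ?n"
        using norm_fst_le[of "fst (w - w')" "snd (w - w')"] norm_snd_le[of "snd (w - w')" "fst (w - w')"]
        unfolding prod.collapse by simp_all
      have "norm (grad f (?P w) - grad f (?P w')) \<le> L * norm (?P w - ?P w')"
        using t R_mono by (intro L(2) norm_truncate_le) auto
      also have "\<dots> \<le> L * norm ((fst w + \<beta> *\<^sub>R snd w) - (fst w' + \<beta> *\<^sub>R snd w'))"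
        by (intro mult_left_mono norm_truncate_diff_le L)
      also have "norm ((fst w + \<beta> *\<^sub>R snd w) - (fst w' + \<beta> *\<^sub>R snd w')) \<le> (1 + \<beta>) * ?n"
      proof -
        have "(fst w + \<beta> *\<^sub>R snd w) - (fst w' + \<beta> *\<^sub>R snd w') = (fst w - fst w') + \<beta> *\<^sub>R (snd w - snd w')"
          by (simp add: algebra_simps)
        also have "norm \<dots> \<le> norm (fst w - fst w') + \<beta> * norm (snd w - snd w')"
          using norm_triangle_ineq[of "fst w - fst w'" "\<beta> *\<^sub>R (snd w - snd w')"] \<beta>_pos by simp
        also have "\<dots> \<le> ?n + \<beta> * ?n"
          using n1 n2 \<beta>_pos by (intro add_mono mult_left_mono) auto
        finally show ?thesis by (simp add: algebra_simps)
      qed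
      finally have g: "norm (grad f (?P w) - grad f (?P w')) \<le> L * ((1 + \<beta>) * ?n)"
        using L(1) by (simp add: mult_left_mono)
      have \<gamma>t: "\<bar>\<gamma> t\<bar> \<le> C" using \<gamma>_bounds[of t] t c_pos by auto
      have "G t w - G t w' = (snd w - snd w',
          - \<gamma> t *\<^sub>R (snd w - snd w') - (grad f (?P w) - grad f (?P w')))"
        by (simp add: G_def algebra_simps)
      then have "norm (G t w - G t w') \<le> norm (snd w - snd w') +
          norm (- \<gamma> t *\<^sub>R (snd w - snd w') - (grad f (?P w) - grad f (?P w')))"
        by (simp only: norm_Pair_le)
      also have "\<dots> \<le> ?n + (C * ?n + L * ((1 + \<beta>) * ?n))"
      proof (rule add_mono[OF n2], rule order_trans[OF norm_triangle_ineq4], rule add_mono[OF _ g])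
        show "norm (- \<gamma> t *\<^sub>R (snd w - snd w')) \<le> C * ?n"
          using \<gamma>t n2 C_pos by (simp add: mult_mono)
      qed
      finally show ?thesis by (simp add: algebra_simps)
    qed
    then show ?thesis by blast
  qed
  obtain w where w0: "w 0 = (x0, v0)"
    and w: "\<And>t. 0 \<le> t \<Longrightarrow> (w has_vector_derivative G t (w t)) (at t within {0..})"
    using picard_global[OF contG lipG] by blast
  define x where "x t = fst (w t)" for t
  define v where "v t = snd (w t)" for t
  define y where "y t = x t + \<beta> *\<^sub>R v t" for t
  have x: "(x has_vector_derivative v t) (at t within {0..})" if "0 \<le> t" for t
    using bounded_linear.has_vector_derivative[OF bounded_linear_fst w[OF that]]
    by (simp add: x_def[abs_def] v_def[abs_def] G_def)
  have v: "(v has_vector_derivative - \<gamma> t *\<^sub>R v t - grad f (truncate (R t) (y t))) (at t within {0..})"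
    if "0 \<le> t" for t
    using bounded_linear.has_vector_derivative[OF bounded_linear_snd w[OF that]]
    by (simp add: x_def[abs_def] v_def[abs_def] y_def G_def)
  have cx: "continuous_on {0..} x" by (rule continuous_on_vector_derivative, rule x) simp
  have cv: "continuous_on {0..} v" by (rule continuous_on_vector_derivative, rule v) simp
  have cy: "continuous_on {0..} y" unfolding y_def[abs_def] by (intro continuous_intros cx cv)
  \<comment> \<open>The bootstrap step: as long as the truncation is inactive, the true energy
    decays, and the resulting speed bound gains the margin 1.\<close>
  have improved: "norm (y t) \<le> R t - 1" if t: "0 \<le> t" and ok: "\<And>s. 0 \<le> s \<Longrightarrow> s \<le> t \<Longrightarrow> norm (y s) \<le> R s" for t
  proof -
    have v': "(v has_vector_derivative - \<gamma> r *\<^sub>R v r - grad f (x r + \<beta> *\<^sub>R v r)) (at r within {0..s})"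
      if "r \<in> {0..s}" "s \<le> t" for r s
      using v[of r] truncate_id[OF ok[of r]] that
      by (auto simp: y_def intro: has_vector_derivative_within_subset)
    have vW: "norm (v s) \<le> W" if s: "s \<in> {0..t}" for s
    proof -
      have "energy (x s) (v s) \<le> energy (x 0) (v 0)"
        using s v' by (intro energy_decay(2) has_vector_derivative_within_subset[OF x]) auto
      then show ?thesis using w0 norm_le_V[of "x s" "v s" x0 v0] by (simp add: W_def x_def v_def)
    qed
    have "norm (x t - x 0) \<le> W * (t - 0)"
      using t vW by (intro norm_diff_le_if_derivative_bounded[of 0 t x v]
          has_vector_derivative_within_subset[OF x]) auto
    moreover have "norm (\<beta> *\<^sub>R v t) \<le> \<beta> * W" using vW[of t] t \<beta>_pos by simp
    moreover have "norm (y t) \<le> norm (x 0) + norm (x t - x 0) + norm (\<beta> *\<^sub>R v t)"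
      unfolding y_def using norm_triangle_ineq[of "x t" "\<beta> *\<^sub>R v t"] norm_triangle_sub[of "x t" "x
          0"] by linarith
    ultimately show ?thesis using w0 by (simp add: R_def x_def)
  qed
  have bound: "norm (y t) \<le> R t" if "0 \<le> t" for t
  proof (rule ccontr)
    assume "\<not> norm (y t) \<le> R t"
    \<comment> \<open>At the first time \<open>s0\<close> where the radius is reached, the bound
      holds up to and including \<open>s0\<close> by continuity, so \<open>improved\<close> applies
      there and contradicts \<open>s0 \<in> A\<close>.\<close>
    define A where "A = {s \<in> {0..}. R s \<le> norm (y s)}"
    have "closed A" unfolding A_def
      by (intro continuous_on_closed_Collect_le) (auto simp: R_def intro!: continuous_intros cy)
    have tA: "t \<in> A" using \<open>\<not> norm (y t) \<le> R t\<close> that by (simp add: A_def)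
    have bdd: "bdd_below A" by (auto simp: A_def intro!: bdd_belowI[of _ 0])
    define s0 where "s0 = Inf A"
    have s0A: "s0 \<in> A" unfolding s0_def by (rule closed_contains_Inf) (use tA bdd \<open>closed A\<close> in auto)
    have s0: "0 \<le> s0" "R s0 \<le> norm (y s0)" using s0A by (auto simp: A_def)
    have before: "norm (y s) \<le> R s" if "0 \<le> s" "s < s0" for s
      using cInf_lower[OF _ bdd, of s] that unfolding s0_def A_def by fastforce
    have y0: "norm (y 0) < R 0"
    proof -
      have "norm (y 0) \<le> norm x0 + \<beta> * norm v0"
        using norm_triangle_ineq[of x0 "\<beta> *\<^sub>R v0"] \<beta>_pos w0 by (simp add: y_def x_def v_def)
      moreover have "\<beta> * norm v0 \<le> \<beta> * W" using W0 \<beta>_pos by (intro mult_left_mono) auto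
      ultimately show ?thesis unfolding R_def by linarith
    qed
    then have "0 < s0" using s0 by (cases "s0 = 0") auto
    have "closed {s \<in> {0..s0}. norm (y s) \<le> R s}"
      by (intro continuous_on_closed_Collect_le)
        (auto simp: R_def intro!: continuous_intros continuous_on_subset[OF cy])
    then have "closure {0..<s0} \<subseteq> {s \<in> {0..s0}. norm (y s) \<le> R s}"
      using before by (intro closure_minimal) auto
    then have "{0..s0} \<subseteq> {s \<in> {0..s0}. norm (y s) \<le> R s}"
      using \<open>0 < s0\<close> by (simp add: closure_atLeastLessThan)
    then have "norm (y s) \<le> R s" if "0 \<le> s" "s \<le> s0" for s using that by auto
    from improved[OF s0(1) this] s0(2) show False by simp
  qed
  show thesis
  proof (rule that[of x v])
    show "x 0 = x0" "v 0 = v0" using w0 by (simp_all add: x_def v_def)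
    show "(x has_vector_derivative v t) (at t within {0..})" if "0 \<le> t" for t by (rule x[OF that])
    show "(v has_vector_derivative - \<gamma> t *\<^sub>R v t - grad f (x t + \<beta> *\<^sub>R v t)) (at t within {0..})"
      if "0 \<le> t" for t
      using v[OF that] truncate_id[OF bound[OF that]] by (simp add: y_def)
  qed
qed

lemma isihd_sol_exists: "\<exists>x v a. isihd_sol f \<gamma> \<beta> x0 v0 x v a"
proof -
  obtain x v where sol: "x 0 = x0" "v 0 = v0"
    "\<And>t. 0 \<le> t \<Longrightarrow> (x has_vector_derivative v t) (at t within {0..})"
    "\<And>t. 0 \<le> t \<Longrightarrow>
      (v has_vector_derivative - \<gamma> t *\<^sub>R v t - grad f (x t + \<beta> *\<^sub>R v t)) (at t within {0..})"
    by (rule global_solution[where ?x0.0 = x0 and ?v0.0 = v0]) (rule that)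
  have cx: "continuous_on {0..} x" by (rule continuous_on_vector_derivative, rule sol(3)) simp
  have cv: "continuous_on {0..} v" by (rule continuous_on_vector_derivative, rule sol(4)) simp
  have "continuous_on {0..} (\<lambda>t. grad f (x t + \<beta> *\<^sub>R v t))"
    by (rule continuous_on_compose2[OF C2_imp_continuous_on_grad[OF f_C2, of UNIV]])
      (auto intro!: continuous_intros cx cv)
  then have "continuous_on {0..} (\<lambda>t. - \<gamma> t *\<^sub>R v t - grad f (x t + \<beta> *\<^sub>R v t))"
    by (intro continuous_intros \<gamma>_cont cv)
  with sol have "isihd_sol f \<gamma> \<beta> x0 v0 x v (\<lambda>t. - \<gamma> t *\<^sub>R v t - grad f (x t + \<beta> *\<^sub>R v t))"
    by (simp add: isihd_sol_def)
  then show ?thesis by blast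
qed

end

section \<open>Asymptotics of trajectories\<close>

text \<open>The energy as a function on \<open>real^('d option)\<close>: only the norm of the velocity matters, and it
  is stored in the coordinate \<open>None\<close>.\<close>
definition kinetic_lift :: "(real^'d \<Rightarrow> real) \<Rightarrow> real^('d option) \<Rightarrow> real" where
  "kinetic_lift f z = f (\<chi> i. z $ Some i) + (z $ None) * (z $ None) / 2"

definition kinetic_pair :: "real^'d \<Rightarrow> real \<Rightarrow> real^('d option)" where
  "kinetic_pair y s = (\<chi> k. case k of None \<Rightarrow> s | Some i \<Rightarrow> y $ i)"

lemma sum_UNIV_option: "(\<Sum>k\<in>UNIV. h k) = h None + (\<Sum>i\<in>UNIV. h (Some i))" for h :: "'d::finite option \<Rightarrow> real"
proof -
  have "(\<Sum>k\<in>UNIV. h k) = h None + sum h (range Some)"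
    unfolding UNIV_option_conv by (rule sum.insert) auto
  also have "sum h (range Some) = (\<Sum>i\<in>UNIV. h (Some i))"
    by (simp add: sum.reindex)
  finally show ?thesis .
qed

text \<open>At the pair of gradient and speed this is the quantity \<open>D\<close> of the
  dissipation estimate; it links the gradient of the lifted energy to the decay of the
  energy.\<close>

lemma norm_kinetic_pair: "(norm (kinetic_pair y s))\<^sup>2 = (norm y)\<^sup>2 + s\<^sup>2"
  unfolding power2_norm_eq_inner
  by (simp add: inner_vec_def kinetic_pair_def sum_UNIV_option power2_eq_square)

lemma kinetic_lift_pair: "kinetic_lift f (kinetic_pair y s) = f y + s\<^sup>2 / 2"
  by (simp add: kinetic_lift_def kinetic_pair_def power2_eq_square)

lemma GDERIV_kinetic_lift:
  fixes f :: "real^'d \<Rightarrow> real"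
  assumes "C2 f"
  shows "GDERIV (kinetic_lift f) z :> kinetic_pair (grad f (\<chi> i. z $ Some i)) (z $ None)"
proof -
  let ?P = "\<lambda>z :: real^('d option). \<chi> i. z $ Some i"
  have "linear ?P" by (rule linearI) (simp_all add: vec_eq_iff)
  then have P: "(?P has_derivative ?P) (at z)"
    by (intro bounded_linear_imp_has_derivative linear_conv_bounded_linear[THEN iffD1])
  have N: "((\<lambda>z. z $ None) has_derivative (\<lambda>h. h $ None)) (at z)"
    by (intro bounded_linear_imp_has_derivative bounded_linear_vec_nth)
  have "(f has_derivative (\<lambda>h. h \<bullet> grad f (?P z))) (at (?P z))"
    using C2_imp_GDERIV[OF assms] by (simp add: gderiv_def)
  from has_derivative_compose[OF P this]
  have "((\<lambda>z. f (?P z)) has_derivative (\<lambda>h. ?P h \<bullet> grad f (?P z))) (at z)" .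
  moreover have "((\<lambda>z. (z $ None) * (z $ None) / 2) has_derivative (\<lambda>h. h $ None * z $ None)) (at z)"
    by (rule derivative_eq_intros N | simp)+
  ultimately have "(kinetic_lift f has_derivative (\<lambda>h. ?P h \<bullet> grad f (?P z) + h $ None * z $ None)) (at z)"
    unfolding kinetic_lift_def[abs_def] by (rule has_derivative_add)
  moreover have "?P h \<bullet> grad f (?P z) + h $ None * z $ None = h \<bullet> kinetic_pair (grad f (?P z)) (z $
      None)" for h
    by (simp add: inner_vec_def sum_UNIV_option kinetic_pair_def)
  ultimately show ?thesis by (simp add: gderiv_def)
qed

lemma continuous_on_kinetic_lift_gradient:
  fixes f :: "real^'d \<Rightarrow> real"
  assumes "C2 f"
  shows "continuous_on UNIV (\<lambda>z :: real^('d option). kinetic_pair (grad f (\<chi> i. z $ Some i)) (z $ None))"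
proof -
  have g: "continuous_on UNIV (\<lambda>z :: real^('d option). grad f (\<chi> i. z $ Some i))"
    by (rule continuous_on_compose2[OF C2_imp_continuous_on_grad[OF assms, of UNIV]])
      (auto intro!: continuous_intros)
  have "continuous_on UNIV (\<lambda>z :: real^('d option). case k of None \<Rightarrow> z $ None | Some i \<Rightarrow> grad f (\<chi>
      i. z $ Some i) $ i)" for k
    using g by (cases k) (auto intro!: continuous_intros)
  then show ?thesis unfolding kinetic_pair_def by (intro continuous_on_vec_lambda)
qed

lemma (in o_minimal) def_map_kinetic_lift:
  assumes f: "def_map f" shows "def_map (kinetic_lift f)"
  unfolding def_map_def kinetic_lift_def
proof (intro allI impI)
  fix n and t :: "'a option \<Rightarrow> (nat \<Rightarrow> real) \<Rightarrow> real" assume t: "\<forall>j. def_term n (t j)"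
  have "def_term n (\<lambda>\<rho>. f (\<chi> i. t (Some i) \<rho>) + t None \<rho> * t None \<rho> * (1 / 2))"
    using t by (intro def_term_add def_term_mult def_term_const def_mapD[OF f]) auto
  then show "def_term n (\<lambda>\<rho>. f (\<chi> i. (\<chi> j. t j \<rho>) $ Some i) + (\<chi> j. t j \<rho>) $ None * (\<chi> j. t j \<rho>) $ None / 2)"
    by simp
qed

section \<open>Integral estimates along a trajectory\<close>

locale isihd_trajectory = isihd f \<gamma> c C \<beta>
  for f :: "real^'d \<Rightarrow> real" and \<gamma> c C \<beta> +
  fixes x v :: "real \<Rightarrow> real^'d"
  assumes x_deriv: "\<And>t. 0 \<le> t \<Longrightarrow> (x has_vector_derivative v t) (at t within {0..})"
    and v_deriv: "\<And>t. 0 \<le> t \<Longrightarrow>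
      (v has_vector_derivative - \<gamma> t *\<^sub>R v t - grad f (x t + \<beta> *\<^sub>R v t)) (at t within {0..})"
begin

definition y :: "real \<Rightarrow> real^'d" where "y t = x t + \<beta> *\<^sub>R v t"
definition g :: "real \<Rightarrow> real^'d" where "g t = grad f (y t)"
definition E :: "real \<Rightarrow> real" where "E t = energy (x t) (v t)"
definition D :: "real \<Rightarrow> real" where "D t = (norm (v t))\<^sup>2 + (norm (g t))\<^sup>2"

lemma cont_x: "continuous_on {0..} x" by (rule continuous_on_vector_derivative, rule x_deriv) simp
lemma cont_v: "continuous_on {0..} v" by (rule continuous_on_vector_derivative, rule v_deriv) simp
lemma cont_y: "continuous_on {0..} y" unfolding y_def[abs_def] by (intro continuous_intros cont_x cont_v)
lemma cont_g: "continuous_on {0..} g" unfolding g_def[abs_def]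
  by (rule continuous_on_compose2[OF C2_imp_continuous_on_grad[OF f_C2, of UNIV] cont_y]) simp
lemma cont_D: "continuous_on {0..} D" unfolding D_def[abs_def] by (intro continuous_intros cont_v cont_g)

lemma D_nonneg: "0 \<le> D t" by (simp add: D_def)

lemma E_decay:
  assumes "0 \<le> s" "s \<le> t"
  shows "E t + \<delta> * integral {s..t} D \<le> E s" "E t \<le> E s"
proof -
  have x: "(x has_vector_derivative v r) (at r within {s..t})" if "r \<in> {s..t}" for r
    by (rule has_vector_derivative_within_subset[OF x_deriv]) (use that assms in auto)
  have v: "(v has_vector_derivative - \<gamma> r *\<^sub>R v r - grad f (x r + \<beta> *\<^sub>R v r)) (at r within {s..t})"
    if "r \<in> {s..t}" for r
    by (rule has_vector_derivative_within_subset[OF v_deriv]) (use that assms in auto)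
  show "E t + \<delta> * integral {s..t} D \<le> E s" "E t \<le> E s"
    using energy_decay[OF assms x v] by (simp_all add: E_def D_def[abs_def] g_def y_def)
qed

lemma E_deriv:
  assumes "0 \<le> t"
  obtains e where "(E has_real_derivative e) (at t within {0..})" "e \<le> - \<delta> * D t"
proof -
  let ?e = "- (\<gamma> t * (norm (v t))\<^sup>2 + \<beta> * \<gamma> t * (g t \<bullet> v t) + \<beta> * (norm (g t))\<^sup>2)"
  have "(E has_real_derivative ?e) (at t within {0..})"
    using energy_has_derivative[OF x_deriv v_deriv, OF assms assms] by (simp add: E_def[abs_def] g_def y_def)
  moreover have "?e \<le> - \<delta> * D t"
    using dissipation[of "\<gamma> t" "v t" "g t"] \<gamma>_bounds[OF assms] by (simp add: D_def)
  ultimately show thesis by (rule that)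
qed

lemma E_ge: "(INF u. f u) \<le> E t"
  using energy_ge[of "v t" "x t"] zero_le_power2[of "norm (v t)"] unfolding E_def by linarith

lemma norm_v_le: "0 \<le> t \<Longrightarrow> norm (v t) \<le> V (x 0) (v 0)"
  using norm_le_V E_decay(2)[of 0 t] by (simp add: E_def)

lemma integral_D_le: "0 \<le> t \<Longrightarrow> integral {0..t} D \<le> (E 0 - (INF u. f u)) / \<delta>"
  using E_decay(1)[of 0 t] E_ge[of t] \<delta>_pos by (simp add: pos_le_divide_eq mult.commute)

text \<open>The square integrability statements all reduce to comparison with \<open>D\<close>,
  whose integral is controlled by the total possible drop of the energy.\<close>

lemma integral_le_if_le_D:
  assumes h: "continuous_on {0..} h" "\<And>t. 0 \<le> t \<Longrightarrow> h t \<le> k * D t" and k: "0 \<le> k" and t: "0 \<le> t"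
  shows "integral {0..t} h \<le> k * ((E 0 - (INF u. f u)) / \<delta>)"
proof -
  have "integral {0..t} h \<le> integral {0..t} (\<lambda>s. k * D s)"
    by (intro integral_le integrable_continuous_real continuous_intros continuous_on_subset[OF h(1)]
        continuous_on_subset[OF cont_D]) (use h in auto)
  also have "\<dots> = k * integral {0..t} D" by simp
  also have "\<dots> \<le> k * ((E 0 - (INF u. f u)) / \<delta>)" by (intro mult_left_mono integral_D_le t k)
  finally show ?thesis .
qed

lemma v_square_integral_le: "0 \<le> t \<Longrightarrow> integral {0..t} (\<lambda>t. (norm (v t))\<^sup>2) \<le> 1 * ((E 0 - (INF u. f u)) / \<delta>)"
  by (intro integral_le_if_le_D continuous_intros cont_v) (auto simp: D_def)

lemma g_square_integral_le: "0 \<le> t \<Longrightarrow> integral {0..t} (\<lambda>t. (norm (g t))\<^sup>2) \<le> 1 * ((E 0 - (INF u. f u)) / \<delta>)"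
  by (intro integral_le_if_le_D continuous_intros cont_g) (auto simp: D_def)

lemma v_square_integrable: "(\<lambda>t. (norm (v t))\<^sup>2) integrable_on {0..}"
  by (rule integrable_on_Ici_if_bounded[OF _ _ v_square_integral_le]) (auto intro!: continuous_intros cont_v)

lemma g_square_integrable: "(\<lambda>t. (norm (g t))\<^sup>2) integrable_on {0..}"
  by (rule integrable_on_Ici_if_bounded[OF _ _ g_square_integral_le]) (auto intro!: continuous_intros cont_g)

lemma E_tendsto:
  obtains l where "(E \<longlongrightarrow> l) at_top" "\<And>t. 0 \<le> t \<Longrightarrow> l \<le> E t"
proof -
  have mono: "- E s \<le> - E t" if "0 \<le> s" "s \<le> t" for s t using E_decay(2)[OF that] by simp
  have bd: "- E t \<le> - (INF u. f u)" if "0 \<le> t" for t using E_ge[of t] by simp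
  obtain l where l: "((\<lambda>t. - E t) \<longlongrightarrow> l) at_top" "\<And>t. 0 \<le> t \<Longrightarrow> - E t \<le> l"
    by (rule mono_bounded_tendsto_at_top[of 0 "\<lambda>t. - E t", OF mono bd]) (assumption | rule that)+
  show thesis
    by (rule that[of "- l"]) (use tendsto_minus[OF l(1)] l(2) in \<open>auto simp: minus_le_iff\<close>)
qed

lemma lipschitz_if_derivative_bounded:
  fixes u :: "real \<Rightarrow> real^'d"
  assumes u: "\<And>t. 0 \<le> t \<Longrightarrow> (u has_vector_derivative u' t) (at t within {0..})"
    and B: "\<And>t. 0 \<le> t \<Longrightarrow> norm (u' t) \<le> B" and st: "0 \<le> s" "0 \<le> t"
  shows "norm (u s - u t) \<le> B * \<bar>s - t\<bar>"
proof -
  have *: "norm (u q - u p) \<le> B * (q - p)" if "0 \<le> p" "p \<le> q" for p q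
    using that by (intro norm_diff_le_if_derivative_bounded[where v = u' and s = p and t = q]
        has_vector_derivative_within_subset[OF u] B) auto
  show ?thesis using *[of s t] *[of t s] st
    by (cases "s \<le> t") (auto simp: norm_minus_commute)
qed

end

section \<open>Bounded trajectories: vanishing gradient, finite length and convergence\<close>

locale isihd_bounded_trajectory = isihd_trajectory +
  assumes x_bounded: "bounded (x ` {0..})"
begin

lemma bounded_by:
  obtains M where "\<And>t. 0 \<le> t \<Longrightarrow> norm (x t) \<le> M" "\<And>t. 0 \<le> t \<Longrightarrow> norm (y t) \<le> M"
    "\<And>t. 0 \<le> t \<Longrightarrow> norm (v t) \<le> M"
proof -
  obtain b where b: "\<And>t. 0 \<le> t \<Longrightarrow> norm (x t) \<le> b" "0 < b"
    using x_bounded unfolding bounded_pos by auto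
  let ?V = "V (x 0) (v 0)"
  have V: "0 \<le> ?V" using norm_v_le[of 0] norm_ge_zero order_trans by blast
  have "norm (y t) \<le> b + \<beta> * ?V" if t: "0 \<le> t" for t
  proof -
    have "norm (y t) \<le> norm (x t) + \<beta> * norm (v t)"
      unfolding y_def using norm_triangle_ineq[of "x t" "\<beta> *\<^sub>R v t"] \<beta>_pos by simp
    also have "\<dots> \<le> b + \<beta> * ?V"
      using b(1)[OF t] norm_v_le[OF t] \<beta>_pos by (intro add_mono mult_left_mono) auto
    finally show ?thesis .
  qed
  moreover have "0 \<le> \<beta> * ?V" using V \<beta>_pos by simp
  ultimately show thesis
    using that[of "b + \<beta> * ?V + ?V"] b norm_v_le V by (smt (verit))
qed

lemma velocity_and_gradient_tendsto_0:
  shows "((\<lambda>t. norm (v t)) \<longlongrightarrow> 0) at_top" and "((\<lambda>t. norm (g t)) \<longlongrightarrow> 0) at_top"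
    and "(\<lambda>t. (norm (grad f (x t)))\<^sup>2) integrable_on {0..}"
    and "((\<lambda>t. norm (grad f (x t))) \<longlongrightarrow> 0) at_top"
proof -
  obtain M where M: "\<And>t. 0 \<le> t \<Longrightarrow> norm (x t) \<le> M" "\<And>t. 0 \<le> t \<Longrightarrow> norm (y t) \<le> M"
    "\<And>t. 0 \<le> t \<Longrightarrow> norm (v t) \<le> M" by (rule bounded_by) (rule that)
  obtain L where L: "0 \<le> L" "\<And>u w. norm u \<le> M \<Longrightarrow> norm w \<le> M \<Longrightarrow>
      norm (grad f u - grad f w) \<le> L * norm (u - w)"
    by (rule C2_imp_grad_lipschitz_on_ball[OF f_C2]) (rule that)
  \<comment> \<open>On the ball of radius \<open>M\<close> the gradient is
    \<open>L\<close>-Lipschitz, and two points of the orbit of \<open>y\<close> are at most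
    \<open>M + M\<close> apart.\<close>
  define B where "B = norm (g 0) + L * (M + M)"
  have gB: "norm (g t) \<le> B" if t: "0 \<le> t" for t
  proof -
    have "norm (g t - g 0) \<le> L * norm (y t - y 0)" unfolding g_def using M t by (intro L(2)) auto
    also have "\<dots> \<le> L * (M + M)"
      using norm_triangle_ineq4[of "y t" "y 0"] M(2)[OF t] M(2)[of 0] L(1) by (intro mult_left_mono) auto
    finally show ?thesis unfolding B_def using norm_triangle_sub[of "g t" "g 0"] by linarith
  qed
  have aB: "norm (- \<gamma> t *\<^sub>R v t - grad f (x t + \<beta> *\<^sub>R v t)) \<le> C * M + B" if t: "0 \<le> t" for t
  proof (rule order_trans[OF norm_triangle_ineq4], rule add_mono)
    show "norm (- \<gamma> t *\<^sub>R v t) \<le> C * M"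
      using \<gamma>_bounds[OF t] c_pos M(3)[OF t] by (auto intro!: mult_mono)
    show "norm (grad f (x t + \<beta> *\<^sub>R v t)) \<le> B" using gB[OF t] by (simp add: g_def y_def)
  qed
  have v_lip: "norm (v s - v t) \<le> (C * M + B) * \<bar>s - t\<bar>" if "0 \<le> s" "0 \<le> t" for s t
    by (rule lipschitz_if_derivative_bounded[OF v_deriv aB that])
  show v0: "((\<lambda>t. norm (v t)) \<longlongrightarrow> 0) at_top"
    by (rule barbalat[OF v_lip cont_v v_square_integral_le])
  have y_deriv: "(y has_vector_derivative v t + \<beta> *\<^sub>R (- \<gamma> t *\<^sub>R v t - grad f (x t + \<beta> *\<^sub>R v t)))
      (at t within {0..})"
    if "0 \<le> t" for t
    unfolding y_def[abs_def]
    by (intro has_vector_derivative_add x_deriv v_deriv that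
        bounded_linear.has_vector_derivative[OF bounded_linear_scaleR_right])
  have yB: "norm (v t + \<beta> *\<^sub>R (- \<gamma> t *\<^sub>R v t - grad f (x t + \<beta> *\<^sub>R v t))) \<le> M + \<beta> * (C * M + B)"
    if t: "0 \<le> t" for t
  proof (rule order_trans[OF norm_triangle_ineq], rule add_mono[OF M(3)[OF t]])
    show "norm (\<beta> *\<^sub>R (- \<gamma> t *\<^sub>R v t - grad f (x t + \<beta> *\<^sub>R v t))) \<le> \<beta> * (C * M + B)"
      unfolding norm_scaleR using aB[OF t] \<beta>_pos by (intro mult_mono) auto
  qed
  have g_lip: "norm (g s - g t) \<le> (L * (M + \<beta> * (C * M + B))) * \<bar>s - t\<bar>" if st: "0 \<le> s" "0 \<le> t" for s t
  proof -
    have "norm (g s - g t) \<le> L * norm (y s - y t)" unfolding g_def using M st by (intro L(2)) auto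
    also have "\<dots> \<le> L * ((M + \<beta> * (C * M + B)) * \<bar>s - t\<bar>)"
      by (intro mult_left_mono lipschitz_if_derivative_bounded[OF y_deriv yB] st L(1))
    finally show ?thesis by (simp add: mult.assoc)
  qed
  show g0: "((\<lambda>t. norm (g t)) \<longlongrightarrow> 0) at_top"
    by (rule barbalat[OF g_lip cont_g g_square_integral_le])
  \<comment> \<open>Statements about the gradient at \<open>x\<close> follow from those at
    \<open>y\<close>, because \<open>x\<close> and \<open>y\<close> differ by
    \<open>\<beta> *\<^sub>R v t\<close>.\<close>
  have close: "norm (grad f (x t)) \<le> norm (g t) + L * \<beta> * norm (v t)" if t: "0 \<le> t" for t
  proof -
    have "norm (grad f (x t) - g t) \<le> L * norm (x t - y t)" unfolding g_def using M t by (intro L(2)) auto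
    then show ?thesis
      using norm_triangle_sub[of "grad f (x t)" "g t"] \<beta>_pos by (simp add: y_def)
  qed
  have cont: "continuous_on {0..} (\<lambda>t. grad f (x t))"
    by (rule continuous_on_compose2[OF C2_imp_continuous_on_grad[OF f_C2, of UNIV] cont_x]) simp
  have sq: "(norm (grad f (x t)))\<^sup>2 \<le> (2 + 2 * (L * \<beta>)\<^sup>2) * D t" if t: "0 \<le> t" for t
  proof -
    let ?p = "norm (g t)" and ?q = "norm (v t)" and ?k = "L * \<beta>"
    have "(norm (grad f (x t)))\<^sup>2 \<le> (?p + ?k * ?q)\<^sup>2"
      using close[OF t] by (intro power_mono) auto
    also have "\<dots> \<le> 2 * ?p\<^sup>2 + 2 * ?k\<^sup>2 * ?q\<^sup>2"
      using zero_le_power2[of "?p - ?k * ?q"] by (simp add: power2_sum power2_diff power_mult_distrib)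
    also have "\<dots> \<le> (2 + 2 * ?k\<^sup>2) * (?q\<^sup>2 + ?p\<^sup>2)"
      by (simp add: distrib_left distrib_right)
    finally show ?thesis by (simp add: D_def)
  qed
  have cont_sq: "continuous_on {0..} (\<lambda>t. (norm (grad f (x t)))\<^sup>2)" by (intro continuous_intros cont)
  have sq_integral: "integral {0..t} (\<lambda>t. (norm (grad f (x t)))\<^sup>2) \<le>
      (2 + 2 * (L * \<beta>)\<^sup>2) * ((E 0 - (INF u. f u)) / \<delta>)" if "0 \<le> t" for t
    by (rule integral_le_if_le_D[OF cont_sq sq _ that]) auto
  show "(\<lambda>t. (norm (grad f (x t)))\<^sup>2) integrable_on {0..}"
    by (rule integrable_on_Ici_if_bounded[OF cont_sq _ sq_integral]) auto
  have lim: "((\<lambda>t. norm (g t) + L * \<beta> * norm (v t)) \<longlongrightarrow> 0) at_top"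
    using tendsto_add[OF g0 tendsto_mult_left[OF v0, of "L * \<beta>"]] by simp
  have upper: "\<forall>\<^sub>F t in at_top. norm (grad f (x t)) \<le> norm (g t) + L * \<beta> * norm (v t)"
    using eventually_ge_at_top[of 0] by eventually_elim (rule close)
  show "((\<lambda>t. norm (grad f (x t))) \<longlongrightarrow> 0) at_top"
    by (rule tendsto_sandwich[OF always_eventually upper tendsto_const lim]) simp
qed

text \<open>\<open>f\<close> along \<open>y\<close> is the energy minus a vanishing kinetic term, so
  it converges. Uniform continuity on a ball transfers the limit to \<open>x\<close>, since
  \<open>x - y\<close> tends to 0.\<close>

lemma f_x_tendsto: "\<exists>l. ((\<lambda>t. f (x t)) \<longlongrightarrow> l) at_top"
proof -
  obtain M where M: "\<And>t. 0 \<le> t \<Longrightarrow> norm (x t) \<le> M" "\<And>t. 0 \<le> t \<Longrightarrow> norm (y t) \<le> M"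
    "\<And>t. 0 \<le> t \<Longrightarrow> norm (v t) \<le> M" by (rule bounded_by) (rule that)
  obtain l where l: "(E \<longlongrightarrow> l) at_top" by (rule E_tendsto)
  have "((\<lambda>t. E t - (norm (v t))\<^sup>2 / 2) \<longlongrightarrow> l - 0\<^sup>2 / 2) at_top"
    by (intro tendsto_intros l velocity_and_gradient_tendsto_0) simp
  then have fy: "((\<lambda>t. f (y t)) \<longlongrightarrow> l) at_top" by (simp add: E_def energy_def y_def)
  have uc: "uniformly_continuous_on (cball 0 M) f"
    by (intro compact_uniformly_continuous C2_imp_continuous_on[OF f_C2]) simp
  have "((\<lambda>t. f (x t) - f (y t)) \<longlongrightarrow> 0) at_top"
  proof (rule tendstoI)
    fix e :: real assume "e > 0"
    then obtain d where d: "d > 0" "\<And>u w. u \<in> cball 0 M \<Longrightarrow> w \<in> cball 0 M \<Longrightarrow> dist u w < d \<Longrightarrow> dist (f u) (f w) < e"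
      using uc unfolding uniformly_continuous_on_def by metis
    have "\<forall>\<^sub>F t in at_top. norm (v t) < d / \<beta>"
      using order_tendstoD(2)[OF velocity_and_gradient_tendsto_0(1), of "d / \<beta>"] d(1) \<beta>_pos by simp
    then show "\<forall>\<^sub>F t in at_top. dist (f (x t) - f (y t)) 0 < e"
      using eventually_ge_at_top[of 0]
    proof eventually_elim
      fix t :: real assume t: "norm (v t) < d / \<beta>" "0 \<le> t"
      have "dist (x t) (y t) < d" using t(1) \<beta>_pos by (simp add: y_def dist_norm pos_less_divide_eq
          mult.commute)
      then show "dist (f (x t) - f (y t)) 0 < e"
        using d(2)[of "x t" "y t"] M[OF t(2)] by (simp add: dist_norm)
    qed
  qed
  from tendsto_add[OF this fy] show ?thesis by auto
qed

text \<open>Along the trajectory, \<open>\<psi> (E - l) + \<delta>/4 \<integral> |\<nabla>F|\<close> is nonincreasing, where \<open>F\<close> is the lifted energy and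
  \<open>\<psi>\<close> its desingularizing function.\<close>
lemma length_bounded:
  assumes def: "definable f"
  obtains B where "\<And>t. 0 \<le> t \<Longrightarrow> integral {0..t} (\<lambda>s. norm (v s)) \<le> B"
proof -
  \<comment> \<open>\<open>N\<close> is the norm of the gradient of the lifted energy along the
    trajectory.\<close>
  define N where "N t = sqrt (D t)" for t
  have contN: "continuous_on {0..} N" unfolding N_def[abs_def] by (intro continuous_intros cont_D)
  have N0: "0 \<le> N t" for t by (simp add: N_def D_nonneg)
  have N2: "(N t)\<^sup>2 = D t" for t by (simp add: N_def D_nonneg)
  have v_le_N: "norm (v t) \<le> N t" for t unfolding N_def by (rule real_le_rsqrt) (simp add: D_def)
  have intv: "(\<lambda>s. norm (v s)) integrable_on {p..q}" and intN: "N integrable_on {p..q}" if "0 \<le> p" for p q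
    using that by (auto intro!: integrable_continuous_real continuous_on_norm
        continuous_on_subset[OF cont_v] continuous_on_subset[OF contN])
  \<comment> \<open>It suffices to bound the integral of the larger function \<open>N\<close> from
    some time on.\<close>
  have reduce: "\<exists>B. \<forall>t\<ge>0. integral {0..t} (\<lambda>s. norm (v s)) \<le> B"
    if T: "0 \<le> T" and K: "\<And>t. T \<le> t \<Longrightarrow> integral {T..t} N \<le> K" for T K
  proof (intro exI allI impI)
    fix t :: real assume t: "0 \<le> t"
    let ?I = "\<lambda>p q. integral {p..q} (\<lambda>s. norm (v s))"
    have "?I 0 t \<le> ?I 0 (max t T)"
      by (rule integral_Icc_mono) (auto intro!: continuous_on_norm cont_v)
    also have "\<dots> = ?I 0 T + ?I T (max t T)"
      using T by (intro Henstock_Kurzweil_Integration.integral_combine[symmetric] intv) auto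
    also have "?I T (max t T) \<le> integral {T..max t T} N"
      using T v_le_N by (intro integral_le intv intN) auto
    also have "\<dots> \<le> K" by (rule K) simp
    finally show "?I 0 t \<le> ?I 0 T + K" by simp
  qed
  obtain l where l: "(E \<longlongrightarrow> l) at_top" "\<And>t. 0 \<le> t \<Longrightarrow> l \<le> E t" by (rule E_tendsto) (rule that)
  have "\<exists>B. \<forall>t\<ge>0. integral {0..t} (\<lambda>s. norm (v s)) \<le> B"
  proof (cases "\<exists>T\<ge>0. E T = l")
    \<comment> \<open>Once the energy reaches its limit it cannot drop further, so \<open>D\<close>
      vanishes from then on. This case is separate because Kurdyka's inequality speaks of levels
      strictly above \<open>l\<close>.\<close>
    case True
    then obtain T where T: "0 \<le> T" "E T = l" by blast
    have "integral {T..t} N \<le> 0" if t: "T \<le> t" for t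
    proof (cases "T = t")
      case False
      have "\<delta> * integral {T..t} D \<le> 0"
        using E_decay(1)[OF T(1) t] l(2)[of t] T t by linarith
      then have "integral {T..t} D \<le> 0" using \<delta>_pos by (simp add: mult_le_0_iff)
      moreover have cD: "continuous_on {T..t} D" using T by (intro continuous_on_subset[OF cont_D]) auto
      ultimately have "integral {T..t} D = 0"
        using Henstock_Kurzweil_Integration.integral_nonneg[OF integrable_continuous_real[OF cD]]
            D_nonneg by force
      then have "\<forall>s\<in>{T..t}. D s = 0"
        using integral_eq_0_iff[OF cD] False t D_nonneg by auto
      then have "integral {T..t} N = integral {T..t} (\<lambda>s. 0)"
        by (intro Henstock_Kurzweil_Integration.integral_cong) (simp add: N_def)
      then show ?thesis by simp
    qed simp
    then show ?thesis by (rule reduce[OF T(1)])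
  next
    case False
    then have pos: "0 < E t - l" if "0 \<le> t" for t using l(2)[OF that] that by (auto simp: order_less_le)
    obtain S where S: "o_minimal_structure S" "definable_fun S f"
      using def unfolding definable_def by blast
    interpret o_minimal S by unfold_locales (rule S(1))
    have def_map: "def_map (kinetic_lift f)" by (intro def_map_kinetic_lift definable_fun_def_map S(2))
    obtain M where M: "\<And>t. 0 \<le> t \<Longrightarrow> norm (x t) \<le> M" "\<And>t. 0 \<le> t \<Longrightarrow> norm (y t) \<le> M"
      "\<And>t. 0 \<le> t \<Longrightarrow> norm (v t) \<le> M" by (rule bounded_by) (rule that)
    obtain \<epsilon> \<psi> B where \<epsilon>: "0 < \<epsilon>" and \<psi>: "continuous_on {0<..<\<epsilon>} \<psi>" "mono_on {0<..<\<epsilon>} \<psi>"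
      "\<And>r. 0 < r \<Longrightarrow> r < \<epsilon> \<Longrightarrow> \<bar>\<psi> r\<bar> \<le> B"
      and KL: "\<And>z r h. \<forall>j. \<bar>z $ j\<bar> \<le> M \<Longrightarrow> kinetic_lift f z = l + r \<Longrightarrow> 0 < r \<Longrightarrow> r < \<epsilon> \<Longrightarrow>
        norm (kinetic_pair (grad f (\<chi> i. z $ Some i)) (z $ None)) < h \<Longrightarrow>
        \<forall>\<^sub>F s in at r. \<bar>s - r\<bar> \<le> h * \<bar>\<psi> s - \<psi> r\<bar>"
      by (rule kurdyka[OF def_map GDERIV_kinetic_lift[OF f_C2] continuous_on_kinetic_lift_gradient[OF f_C2],
            where M = M and l = l]) (rule that)
    define r where "r t = E t - l" for t
    have "\<forall>\<^sub>F t in at_top. E t < l + \<epsilon>" using order_tendstoD(2)[OF l(1), of "l + \<epsilon>"] \<epsilon> by simp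
    then obtain T0 where T0: "\<And>t. T0 \<le> t \<Longrightarrow> E t < l + \<epsilon>" unfolding eventually_at_top_linorder by blast
    define T where "T = max 0 T0"
    have T: "0 \<le> T" by (simp add: T_def)
    have r: "0 < r t" "r t < \<epsilon>" if "T \<le> t" for t
      using that pos[of t] T0[of t] T by (auto simp: r_def T_def)
    have r_anti: "r t \<le> r s" if "T \<le> s" "s \<le> t" for s t
      using E_decay(2)[of s t] that T by (simp add: r_def)
    have \<psi>_anti: "\<psi> (r t) \<le> \<psi> (r s)" if "T \<le> s" "s \<le> t" for s t
      using r[of s] r[of t] that r_anti[OF that] by (intro mono_onD[OF \<psi>(2)]) auto
    \<comment> \<open>The factor 2 makes \<open>h\<close> strictly larger than the gradient norm
      \<open>N t\<close>.\<close>
    have KL_traj: "\<forall>\<^sub>F s in at (r t). \<bar>s - r t\<bar> \<le> (2 * N t) * \<bar>\<psi> s - \<psi> (r t)\<bar>"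
      if t: "T \<le> t" and Npos: "0 < N t" for t
    proof (rule KL[of "kinetic_pair (y t) (norm (v t))"])
      have t0: "0 \<le> t" using t T by simp
      have "norm (v t) \<le> M" "\<bar>y t $ i\<bar> \<le> M" for i
        using M(2,3)[OF t0] component_le_norm_cart[of "y t" i] by linarith+
      then show "\<forall>j. \<bar>kinetic_pair (y t) (norm (v t)) $ j\<bar> \<le> M"
        by (auto simp: kinetic_pair_def split: option.split)
    next
      show "kinetic_lift f (kinetic_pair (y t) (norm (v t))) = l + r t"
        by (simp add: kinetic_lift_pair r_def E_def energy_def y_def)
      have "(norm (kinetic_pair (g t) (norm (v t))))\<^sup>2 = (N t)\<^sup>2"
        by (simp add: norm_kinetic_pair N2 D_def)
      then have "norm (kinetic_pair (g t) (norm (v t))) = N t"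
        using N0 by (simp add: power2_eq_iff_nonneg)
      then show "norm (kinetic_pair (grad f (\<chi> i. kinetic_pair (y t) (norm (v t)) $ Some i))
          (kinetic_pair (y t) (norm (v t)) $ None)) < 2 * N t"
        using Npos by (simp add: kinetic_pair_def g_def)
    qed (use r[OF t] in auto)
    define J where "J t = integral {T..t} N" for t
    \<comment> \<open>The constant \<open>\<delta> / 4\<close> is the decay rate
      \<open>\<delta>\<close>, halved once to get a strict inequality for difference quotients of
      the energy and once by the factor 2 in \<open>KL_traj\<close>.\<close>
    define \<Phi> where "\<Phi> t = - \<psi> (r t) - \<delta> / 4 * J t" for t
    have contN': "continuous_on {T..} N" using T by (intro continuous_on_subset[OF contN]) auto
    have J_deriv: "(J has_real_derivative N t) (at t within {T..})" if "T \<le> t" for t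
      unfolding has_real_derivative_iff_has_vector_derivative J_def[abs_def]
      by (rule indefinite_integral_has_vector_derivative_Ici[OF contN' that])
    have contE: "continuous_on {0..} E"
      unfolding E_def[abs_def] energy_def
      by (intro continuous_intros cont_v continuous_on_compose2[OF C2_imp_continuous_on[OF f_C2, of
          UNIV]] cont_x) auto
    have cont_r: "continuous_on {T..} r"
      unfolding r_def[abs_def] using T by (intro continuous_intros continuous_on_subset[OF contE]) auto
    have cont\<Phi>: "continuous_on {T..} \<Phi>"
    proof -
      have "continuous_on {T..} (\<lambda>t. \<psi> (r t))"
        by (rule continuous_on_compose2[OF \<psi>(1) cont_r]) (use r in auto)
      moreover have "continuous_on {T..} J"
        by (rule DERIV_continuous_on[where D = N]) (use J_deriv in auto)
      ultimately show ?thesis unfolding \<Phi>_def[abs_def] by (intro continuous_intros)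
    qed
    have dini: "\<forall>\<^sub>F s in at_right t. \<Phi> t - e * (s - t) \<le> \<Phi> s" if t: "T \<le> t" and e: "0 < e" for t e
    proof -
      have t0: "0 \<le> t" using t T by simp
      have sub: "at_right t \<le> at t within {T..}" "at_right t \<le> at t within {0..}"
        using t t0 by (auto intro!: at_le)
      have "((\<lambda>s. (J s - J t) / (s - t)) \<longlongrightarrow> N t) (at_right t)"
        using J_deriv[OF t] tendsto_mono[OF sub(1)] unfolding has_field_derivative_iff by blast
      \<comment> \<open>After multiplication by \<open>\<delta> / 4\<close> the tolerance
        \<open>4 * e / \<delta>\<close> becomes the slack \<open>e\<close>.\<close>
      from order_tendstoD(2)[OF this, of "N t + 4 * e / \<delta>"] e \<delta>_pos
      have "\<forall>\<^sub>F s in at_right t. (J s - J t) / (s - t) < N t + 4 * e / \<delta>" by simp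
      then have J_le: "\<forall>\<^sub>F s in at_right t. \<delta> / 4 * (J s - J t) \<le> (\<delta> / 4 * N t + e) * (s - t)"
        using eventually_at_right_less[of t]
      proof eventually_elim
        fix s assume s: "(J s - J t) / (s - t) < N t + 4 * e / \<delta>" "t < s"
        then have "J s - J t \<le> (N t + 4 * e / \<delta>) * (s - t)" by (simp add: pos_divide_less_eq)
        then have "\<delta> / 4 * (J s - J t) \<le> \<delta> / 4 * ((N t + 4 * e / \<delta>) * (s - t))"
          using \<delta>_pos by (intro mult_left_mono) auto
        also have "\<dots> = (\<delta> / 4 * N t + e) * (s - t)" using \<delta>_pos by (simp add: field_simps)
        finally show "\<delta> / 4 * (J s - J t) \<le> (\<delta> / 4 * N t + e) * (s - t)" .
      qed
      have \<psi>_ge: "\<forall>\<^sub>F s in at_right t. \<delta> / 4 * N t * (s - t) \<le> \<psi> (r t) - \<psi> (r s)"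
      proof (cases "N t = 0")
        case True
        show ?thesis
          using eventually_at_right_less[of t]
          by eventually_elim (use True \<psi>_anti[OF t] in \<open>simp add: order_less_imp_le\<close>)
      next
        case False
        then have Npos: "0 < N t" using N0[of t] by simp
        obtain d where d: "(E has_real_derivative d) (at t within {0..})" "d \<le> - \<delta> * D t"
          by (rule E_deriv[OF t0])
        have "((\<lambda>s. (E s - E t) / (s - t)) \<longlongrightarrow> d) (at_right t)"
          using d(1) tendsto_mono[OF sub(2)] unfolding has_field_derivative_iff by blast
        moreover have "d < - \<delta> / 2 * (N t)\<^sup>2"
        proof -
          have "0 < \<delta> * (N t)\<^sup>2" using \<delta>_pos Npos by simp
          then show ?thesis using d(2) N2[of t] by simp
        qed
        ultimately have "\<forall>\<^sub>F s in at_right t. (E s - E t) / (s - t) < - \<delta> / 2 * (N t)\<^sup>2"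
          by (rule order_tendstoD(2))
        then have E_drop: "\<forall>\<^sub>F s in at_right t. \<delta> / 2 * (N t)\<^sup>2 * (s - t) < r t - r s"
          using eventually_at_right_less[of t]
        proof eventually_elim
          fix s assume s: "(E s - E t) / (s - t) < - \<delta> / 2 * (N t)\<^sup>2" "t < s"
          then have "E s - E t < - \<delta> / 2 * (N t)\<^sup>2 * (s - t)" by (simp only: pos_divide_less_eq
              diff_gt_0_iff_gt)
          then show "\<delta> / 2 * (N t)\<^sup>2 * (s - t) < r t - r s" by (simp add: r_def)
        qed
        \<comment> \<open>Kurdyka's inequality holds on a punctured neighbourhood of the level
          \<open>r t\<close>. The strict drop of the energy ensures that \<open>r s\<close> avoids
          \<open>r t\<close>, so the inequality can be pulled back to times
          \<open>s\<close>.\<close>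
        have "filterlim r (at (r t)) (at_right t)"
        proof (rule filterlim_atI)
          have "(r \<longlongrightarrow> r t) (at t within {T..})"
            using cont_r t by (auto simp: continuous_on_def)
          then show "(r \<longlongrightarrow> r t) (at_right t)" by (rule tendsto_mono[OF sub(1)])
          show "\<forall>\<^sub>F s in at_right t. r s \<noteq> r t"
            using E_drop eventually_at_right_less[of t]
          proof eventually_elim
            fix s assume s: "\<delta> / 2 * (N t)\<^sup>2 * (s - t) < r t - r s" "t < s"
            moreover have "0 \<le> \<delta> / 2 * (N t)\<^sup>2 * (s - t)" using \<delta>_pos s(2) by simp
            ultimately show "r s \<noteq> r t" by linarith
          qed
        qed
        from filterlim_iff[THEN iffD1, OF this, rule_format, OF KL_traj[OF t Npos]]
        have "\<forall>\<^sub>F s in at_right t. \<bar>r s - r t\<bar> \<le> (2 * N t) * \<bar>\<psi> (r s) - \<psi> (r t)\<bar>" .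
        then show ?thesis using E_drop eventually_at_right_less[of t]
        proof eventually_elim
          fix s assume s: "\<bar>r s - r t\<bar> \<le> (2 * N t) * \<bar>\<psi> (r s) - \<psi> (r t)\<bar>"
            "\<delta> / 2 * (N t)\<^sup>2 * (s - t) < r t - r s" "t < s"
          have "\<bar>\<psi> (r s) - \<psi> (r t)\<bar> = \<psi> (r t) - \<psi> (r s)" using \<psi>_anti[OF t, of s] s(3) by simp
          with s(1) have "r t - r s \<le> (2 * N t) * (\<psi> (r t) - \<psi> (r s))" by simp
          moreover have "(2 * N t) * (\<delta> / 4 * N t * (s - t)) = \<delta> / 2 * (N t)\<^sup>2 * (s - t)"
            by (simp add: power2_eq_square)
          ultimately have "(2 * N t) * (\<delta> / 4 * N t * (s - t)) \<le> (2 * N t) * (\<psi> (r t) - \<psi> (r s))"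
            using s(2) by linarith
          then show "\<delta> / 4 * N t * (s - t) \<le> \<psi> (r t) - \<psi> (r s)"
            using Npos by (simp only: mult_le_cancel_left_pos mult_pos_pos zero_less_numeral)
        qed
      qed
      from \<psi>_ge J_le show ?thesis
      proof eventually_elim
        fix s assume "\<delta> / 4 * N t * (s - t) \<le> \<psi> (r t) - \<psi> (r s)"
          "\<delta> / 4 * (J s - J t) \<le> (\<delta> / 4 * N t + e) * (s - t)"
        then show "\<Phi> t - e * (s - t) \<le> \<Phi> s" unfolding \<Phi>_def by (simp add: algebra_simps diff_divide_distrib)
      qed
    qed
    have "integral {T..t} N \<le> 4 / \<delta> * (2 * B)" if t: "T \<le> t" for t
    proof -
      have "\<Phi> T \<le> \<Phi> t"
        by (rule nondecreasing_if_lower_dini_nonneg[OF t])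
          (use dini in \<open>auto intro: continuous_on_subset[OF cont\<Phi>]\<close>)
      then have "\<delta> / 4 * J t \<le> \<psi> (r T) - \<psi> (r t)" by (simp add: \<Phi>_def J_def)
      \<comment> \<open>The length of the tail is paid for by the total oscillation of the bounded
        function \<open>\<psi>\<close>.\<close>
      also have "\<dots> \<le> 2 * B" using \<psi>(3)[OF r[of T]] \<psi>(3)[OF r[OF t]] by auto
      finally show ?thesis using \<delta>_pos by (simp add: J_def field_simps)
    qed
    then show ?thesis by (rule reduce[OF T])
  qed
  then show thesis using that by blast
qed

lemma convergence:
  assumes "definable f"
  shows "v absolutely_integrable_on {0..}" "\<exists>u. (x \<longlongrightarrow> u) at_top \<and> grad f u = 0"
proof -
  obtain B where B: "\<And>t. 0 \<le> t \<Longrightarrow> integral {0..t} (\<lambda>s. norm (v s)) \<le> B"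
    by (rule length_bounded[OF assms]) (rule that)
  show "v absolutely_integrable_on {0..}"
    by (rule absolutely_integrable_on_Ici_if_bounded[OF cont_v B])
  obtain u where u: "(x \<longlongrightarrow> u) at_top"
    by (rule tendsto_at_top_if_length_bounded[OF cont_v x_deriv B])
  have "isCont (grad f) u"
    using C2_imp_continuous_on_grad[OF f_C2, of UNIV] by (simp add: continuous_on_eq_continuous_at)
  then have "((\<lambda>t. grad f (x t)) \<longlongrightarrow> grad f u) at_top"
    using u by (rule isCont_tendsto_compose)
  then have "((\<lambda>t. norm (grad f (x t))) \<longlongrightarrow> norm (grad f u)) at_top" by (rule tendsto_norm)
  then have "norm (grad f u) = 0"
    using velocity_and_gradient_tendsto_0(4) by (rule tendsto_unique[OF trivial_limit_at_top_linorder])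
  with u show "\<exists>u. (x \<longlongrightarrow> u) at_top \<and> grad f u = 0" by auto
qed

end

text \<open>A solution satisfies the equation for positive times only. The residual is continuous on
  the closed half-line and vanishes on the open one, so it vanishes at 0 too and \<open>a\<close>
  can be eliminated.\<close>

lemma (in isihd) isihd_sol_trajectory:
  assumes sol: "isihd_sol f \<gamma> \<beta> x0 v0 x v a"
  shows "isihd_trajectory f \<gamma> c C \<beta> x v"
proof -
  have x: "(x has_vector_derivative v t) (at t within {0..})"
    and v: "(v has_vector_derivative a t) (at t within {0..})" if "0 \<le> t" for t
    using sol that by (auto simp: isihd_sol_def)
  have cx: "continuous_on {0..} x" by (rule continuous_on_vector_derivative, rule x) simp
  have cv: "continuous_on {0..} v" by (rule continuous_on_vector_derivative, rule v) simp
  let ?h = "\<lambda>t. a t + \<gamma> t *\<^sub>R v t + grad f (x t + \<beta> *\<^sub>R v t)"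
  have "continuous_on {0..} (\<lambda>t. grad f (x t + \<beta> *\<^sub>R v t))"
    by (rule continuous_on_compose2[OF C2_imp_continuous_on_grad[OF f_C2, of UNIV]])
      (auto intro!: continuous_intros cx cv)
  then have "continuous_on {0..} ?h"
    using sol by (intro continuous_intros \<gamma>_cont cv) (auto simp: isihd_sol_def)
  then have cont: "continuous_on (closure {0<..}) ?h" by simp
  have "?h t = 0" if "0 \<le> t" for t
    by (rule continuous_constant_on_closure[OF cont]) (use sol that in \<open>auto simp: isihd_sol_def\<close>)
  then have "a t = - \<gamma> t *\<^sub>R v t - grad f (x t + \<beta> *\<^sub>R v t)" if "0 \<le> t" for t
    using that by (simp add: eq_neg_iff_add_eq_0 algebra_simps)
  with x v show ?thesis by unfold_locales auto
qed

theorem mainTheorem10: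
  fixes f :: "real^'d \<Rightarrow> real" and \<gamma> :: "real \<Rightarrow> real"
    and c C \<beta> :: real and x0 v0 :: "real^'d"
  assumes f_C2: "C2 f"
    and f_below: "bdd_below (range f)"
    and \<gamma>_cont: "continuous_on {0..} \<gamma>"
    and c_pos: "0 < c" and c_le_C: "c \<le> C"
    and \<gamma>_bounds: "\<And>t. t \<ge> 0 \<Longrightarrow> c \<le> \<gamma> t \<and> \<gamma> t \<le> C"
    and \<beta>_pos: "0 < \<beta>" and \<beta>_small: "\<beta> < 2 * c / C^2"
  shows "(\<exists>x v a. isihd_sol f \<gamma> \<beta> x0 v0 x v a) \<and>
    (\<forall>x v a. isihd_sol f \<gamma> \<beta> x0 v0 x v a \<longrightarrow>
      ((\<lambda>t. (norm (v t))^2) integrable_on {0..} \<and>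
       (\<lambda>t. (norm (grad f (x t + \<beta> *\<^sub>R v t)))^2) integrable_on {0..}) \<and>
      (bounded (x ` {0..}) \<longrightarrow>
         (\<lambda>t. (norm (grad f (x t)))^2) integrable_on {0..} \<and>
         ((\<lambda>t. norm (grad f (x t))) \<longlongrightarrow> 0) at_top \<and>
         ((\<lambda>t. norm (v t)) \<longlongrightarrow> 0) at_top \<and>
         (\<exists>L. ((\<lambda>t. f (x t)) \<longlongrightarrow> L) at_top) \<and>
         (definable f \<longrightarrow>
            v absolutely_integrable_on {0..} \<and>
            (\<exists>u. (x \<longlongrightarrow> u) at_top \<and> grad f u = 0))))"
proof -
  interpret isihd f \<gamma> c C \<beta>
    by unfold_locales (fact f_C2 f_below \<gamma>_cont c_pos c_le_C \<gamma>_bounds \<beta>_pos \<beta>_small)+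
  show ?thesis
  proof (intro conjI allI impI)
    show "\<exists>x v a. isihd_sol f \<gamma> \<beta> x0 v0 x v a" by (rule isihd_sol_exists)
  next
    fix x v a assume sol: "isihd_sol f \<gamma> \<beta> x0 v0 x v a"
    interpret isihd_trajectory f \<gamma> c C \<beta> x v by (rule isihd_sol_trajectory[OF sol])
    show "(\<lambda>t. (norm (v t))^2) integrable_on {0..}" by (rule v_square_integrable)
    show "(\<lambda>t. (norm (grad f (x t + \<beta> *\<^sub>R v t)))^2) integrable_on {0..}"
      using g_square_integrable by (simp add: g_def y_def)
    assume bd: "bounded (x ` {0..})"
    interpret isihd_bounded_trajectory f \<gamma> c C \<beta> x v by unfold_locales (rule bd)
    show "(\<lambda>t. (norm (grad f (x t)))^2) integrable_on {0..}"
      "((\<lambda>t. norm (grad f (x t))) \<longlongrightarrow> 0) at_top" "((\<lambda>t. norm (v t)) \<longlongrightarrow> 0) at_top"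
      by (rule velocity_and_gradient_tendsto_0)+
    show "\<exists>L. ((\<lambda>t. f (x t)) \<longlongrightarrow> L) at_top" by (rule f_x_tendsto)
    assume "definable f"
    then show "v absolutely_integrable_on {0..}" "\<exists>u. (x \<longlongrightarrow> u) at_top \<and> grad f u = 0"
      by (rule convergence)+
  qed
qed

end
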